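(* Assume the Exponential Time Hypothesis (ETH). Then no $T(k)\cdot n^{o(k)}$-time algorithm can approximate $k$-Dominating Set to within a factor of $(\log n)^{1/\mathrm{poly}(k)}$. That is, there is a polynomial $p$ (with $p(k)\ge 1$ for all $k\ge 1$) such that for no computable function $T:\mathbb N\to\mathbb N$ and no function $g:\mathbb N\to\mathbb R_{\ge 0}$ with $g(k)=o(k)$ does there exist an algorithm with the following property: on every input $(G,k)$, where $k\ge 1$ is an integer and $G$ is a graph on $n\ge 2$ vertices, it runs in time $T(k)\cdot n^{g(k)}$ and, whenever the minimum dominating set of $G$ has size at most $k$, it outputs a dominating set of $G$ of size at most $(\log n)^{1/p(k)}\cdot k$.
   Context: Logarithms are base 2. A dominating set of an undirected graph $G$ is a set $S\subseteq V(G)$ such that every vertex outside $S$ has a neighbor in $S$. ETH: there exists $\delta>0$ such that no algorithm can solve 3-SAT (satisfiability of CNF formulae with at most 3 literals per clause) in $O(2^{\delta n})$ time, where $n$ is the number of variables; moreover, this holds even when restricted to formulae in which each variable appears in at most three clauses. *)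

theory Defs
  imports Complex_Main "HOL-Library.Landau_Symbols" "HOL-Computational_Algebra.Polynomial"
begin

section \<open>Model of computation\<close>

text \<open>
  Algorithms are programs of N. D. Jones's WHILE language (\<^emph>\<open>Computability and Complexity from a
  Programming Perspective\<close>): imperative programs with finitely many variables holding binary trees,
  whose only data operations are \<open>nil\<close>, \<open>cons\<close>, \<open>hd\<close>, \<open>tl\<close> and the test for \<open>nil\<close>. All of them are
  constant-time pointer operations (there is no equality test on trees and no arithmetic), so unit
  cost is realistic: the model simulates multi-tape Turing machines with constant overhead and is
  simulated by them with polynomial overhead. Every notion of running time used below (the
  existence of some exponent \<open>\<delta> > 0\<close>; the class \<open>T(k) n^o(k)\<close>) is insensitive to such overhead.
\<close>

datatype tree = Nl | Cn tree tree

fun hd_tree :: "tree \<Rightarrow> tree" where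
  "hd_tree Nl = Nl"
| "hd_tree (Cn a b) = a"

fun tl_tree :: "tree \<Rightarrow> tree" where
  "tl_tree Nl = Nl"
| "tl_tree (Cn a b) = b"

datatype exp = Var nat | NilE | ConsE exp exp | HdE exp | TlE exp

type_synonym state = "nat \<Rightarrow> tree"

fun eval_exp :: "exp \<Rightarrow> state \<Rightarrow> tree" where
  "eval_exp (Var x) s = s x"
| "eval_exp NilE s = Nl"
| "eval_exp (ConsE a b) s = Cn (eval_exp a s) (eval_exp b s)"
| "eval_exp (HdE a) s = hd_tree (eval_exp a s)"
| "eval_exp (TlE a) s = tl_tree (eval_exp a s)"

fun cost_exp :: "exp \<Rightarrow> nat" where
  "cost_exp (Var x) = 1"
| "cost_exp NilE = 1"
| "cost_exp (ConsE a b) = cost_exp a + cost_exp b + 1"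
| "cost_exp (HdE a) = cost_exp a + 1"
| "cost_exp (TlE a) = cost_exp a + 1"

datatype com =
    Skip
  | Assign nat exp
  | Seq com com
  | If exp com com
  | While exp com

text \<open>\<open>exec c s t s'\<close>: started in \<open>s\<close>, the program \<open>c\<close> halts after exactly \<open>t\<close> steps in \<open>s'\<close>.\<close>

inductive exec :: "com \<Rightarrow> state \<Rightarrow> nat \<Rightarrow> state \<Rightarrow> bool" where
  Skip: "exec Skip s 1 s"
| Assign: "exec (Assign x e) s (cost_exp e + 1) (s(x := eval_exp e s))"
| Seq: "exec c s t s' \<Longrightarrow> exec d s' u s'' \<Longrightarrow> exec (Seq c d) s (t + u) s''"
| IfTrue: "eval_exp e s \<noteq> Nl \<Longrightarrow> exec c s t s' \<Longrightarrow> exec (If e c d) s (cost_exp e + 1 + t) s'"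
| IfFalse: "eval_exp e s = Nl \<Longrightarrow> exec d s t s' \<Longrightarrow> exec (If e c d) s (cost_exp e + 1 + t) s'"
| WhileFalse: "eval_exp e s = Nl \<Longrightarrow> exec (While e c) s (cost_exp e + 1) s"
| WhileTrue: "eval_exp e s \<noteq> Nl \<Longrightarrow> exec c s t s' \<Longrightarrow> exec (While e c) s' u s'' \<Longrightarrow>
    exec (While e c) s (cost_exp e + 1 + t + u) s''"

inductive_cases exec_SkipE: "exec Skip s t s'"
inductive_cases exec_AssignE: "exec (Assign x e) s t s'"
inductive_cases exec_SeqE: "exec (Seq c d) s t s'"
inductive_cases exec_IfE: "exec (If e c d) s t s'"
inductive_cases exec_WhileE: "exec (While e c) s t s'"

lemma exec_deterministic:
  "exec c s t s' \<Longrightarrow> exec c s u s'' \<Longrightarrow> t = u \<and> s' = s''"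
proof (induction arbitrary: u s'' rule: exec.induct)
  case (Skip s)
  from Skip.prems show ?case by (rule exec_SkipE) simp
next
  case (Assign x e s)
  from Assign.prems show ?case by (rule exec_AssignE) simp
next
  case (Seq c s t s' d w s3)
  from Seq.prems show ?case by (rule exec_SeqE) (metis Seq.IH)
next
  case (IfTrue e s c t s' d)
  from IfTrue.prems show ?case
    by (rule exec_IfE) (use IfTrue.hyps(1) in \<open>auto dest: IfTrue.IH\<close>)
next
  case (IfFalse e s d t s' c)
  from IfFalse.prems show ?case
    by (rule exec_IfE) (use IfFalse.hyps(1) in \<open>auto dest: IfFalse.IH\<close>)
next
  case (WhileFalse e s c)
  from WhileFalse.prems show ?case
    by (rule exec_WhileE) (use WhileFalse.hyps in simp_all)
next
  case (WhileTrue e s c t s' w s3)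
  from WhileTrue.prems show ?case
    by (rule exec_WhileE) (use WhileTrue.hyps(1) in \<open>auto dest!: WhileTrue.IH\<close>)
qed

text \<open>Input and output are passed in variable 0; all other variables are initially \<open>nil\<close>.\<close>

definition outputs :: "com \<Rightarrow> tree \<Rightarrow> nat \<Rightarrow> tree \<Rightarrow> bool" where
  "outputs A x t y \<longleftrightarrow> (\<exists>s. exec A ((\<lambda>_. Nl)(0 := x)) t s \<and> s 0 = y)"


section \<open>Encodings\<close>

text \<open>
  Natural numbers are written in unary. This affects the encoding length of the formulae and graphs
  below only polynomially in the number of variables resp. vertices.
\<close>

definition enc_list :: "tree list \<Rightarrow> tree" where
  "enc_list xs = foldr Cn xs Nl"

definition enc_nat :: "nat \<Rightarrow> tree" where
  "enc_nat n = enc_list (replicate n Nl)"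

definition enc_bool :: "bool \<Rightarrow> tree" where
  "enc_bool b = (if b then Cn Nl Nl else Nl)"

lemma enc_list_inject: "enc_list xs = enc_list ys \<longleftrightarrow> xs = ys"
proof (induction xs arbitrary: ys)
  case Nil
  then show ?case by (cases ys) (auto simp: enc_list_def)
next
  case (Cons x xs)
  then show ?case by (cases ys) (auto simp: enc_list_def)
qed

lemma enc_nat_inject: "enc_nat m = enc_nat n \<longleftrightarrow> m = n"
  by (metis enc_nat_def enc_list_inject length_replicate)

lemma enc_bool_inject: "enc_bool a = enc_bool b \<longleftrightarrow> a = b"
  by (auto simp: enc_bool_def)

definition computable :: "(nat \<Rightarrow> nat) \<Rightarrow> bool" where
  "computable f \<longleftrightarrow> (\<exists>A. \<forall>k. \<exists>t. outputs A (enc_nat k) t (enc_nat (f k)))"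


section \<open>3-SAT and the Exponential Time Hypothesis\<close>

text \<open>The literal \<open>(True, i)\<close> is the variable \<open>x\<^sub>i\<close>, and \<open>(False, i)\<close> is its negation.\<close>

type_synonym literal = "bool \<times> nat"
type_synonym clause = "literal list"
type_synonym cnf = "clause list"

text \<open>
  \<open>F\<close> is a 3-CNF formula over the \<open>n\<close> variables with indices below \<open>n\<close>. A clause is a set of literals
  and a formula a set of clauses, listed in arbitrary order but without repetition. The latter
  matters: with repeated clauses the length of a formula would not be bounded in terms of \<open>n\<close>, and
  no algorithm could even read its input within a time bound depending on \<open>n\<close> only.
\<close>

definition cnf3 :: "nat \<Rightarrow> cnf \<Rightarrow> bool" where
  "cnf3 n F \<longleftrightarrow> distinct (map set F) \<and>
     (\<forall>c \<in> set F. distinct c \<and> length c \<le> 3 \<and> (\<forall>(b, i) \<in> set c. i < n))"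

definition satisfiable :: "cnf \<Rightarrow> bool" where
  "satisfiable F \<longleftrightarrow> (\<exists>v :: nat \<Rightarrow> bool. \<forall>c \<in> set F. \<exists>(b, i) \<in> set c. v i = b)"

definition three_occurrences :: "cnf \<Rightarrow> bool" where
  "three_occurrences F \<longleftrightarrow> (\<forall>i. card {c \<in> set F. \<exists>b. (b, i) \<in> set c} \<le> 3)"

definition enc_clause :: "clause \<Rightarrow> tree" where
  "enc_clause c = enc_list (map (\<lambda>(b, i). Cn (enc_bool b) (enc_nat i)) c)"

definition enc_cnf :: "nat \<Rightarrow> cnf \<Rightarrow> tree" where
  "enc_cnf n F = Cn (enc_nat n) (enc_list (map enc_clause F))"

text \<open>
  \<open>A\<close> decides satisfiability of the 3-CNF formulae in the class \<open>R\<close>, in time \<open>f n\<close> on those with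
  \<open>n\<close> variables.
\<close>

definition solves_3sat_on :: "(cnf \<Rightarrow> bool) \<Rightarrow> com \<Rightarrow> (nat \<Rightarrow> real) \<Rightarrow> bool" where
  "solves_3sat_on R A f \<longleftrightarrow>
     (\<forall>n F. cnf3 n F \<and> R F \<longrightarrow>
        (\<exists>t. outputs A (enc_cnf n F) t (enc_bool (satisfiable F)) \<and> real t \<le> f n))"

definition ETH :: bool where
  "ETH \<longleftrightarrow> (\<exists>\<delta>::real. \<delta> > 0 \<and>
     \<not> (\<exists>A f. f \<in> O(\<lambda>n. 2 powr (\<delta> * real n)) \<and> solves_3sat_on (\<lambda>F. True) A f) \<and>
     \<not> (\<exists>A f. f \<in> O(\<lambda>n. 2 powr (\<delta> * real n)) \<and> solves_3sat_on three_occurrences A f))"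


section \<open>Dominating sets\<close>

text \<open>Input graphs are simple, undirected, and have vertex set \<open>{..<n}\<close>.\<close>

definition graph :: "nat \<Rightarrow> nat set set \<Rightarrow> bool" where
  "graph n E \<longleftrightarrow> (\<forall>e \<in> E. e \<subseteq> {..<n} \<and> card e = 2)"

definition dominating_set :: "nat \<Rightarrow> nat set set \<Rightarrow> nat set \<Rightarrow> bool" where
  "dominating_set n E S \<longleftrightarrow> S \<subseteq> {..<n} \<and> (\<forall>v \<in> {..<n} - S. \<exists>u \<in> S. {u, v} \<in> E)"

definition domination_number :: "nat \<Rightarrow> nat set set \<Rightarrow> nat" where
  "domination_number n E = Min {card S |S. dominating_set n E S}"

text \<open>Sets of vertices are encoded by characteristic vectors, graphs by adjacency matrices.\<close>

definition enc_set :: "nat \<Rightarrow> nat set \<Rightarrow> tree" where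
  "enc_set n S = enc_list (map (\<lambda>v. enc_bool (v \<in> S)) [0..<n])"

definition enc_graph :: "nat \<Rightarrow> nat set set \<Rightarrow> tree" where
  "enc_graph n E = enc_list (map (\<lambda>v. enc_set n {u. {v, u} \<in> E}) [0..<n])"

text \<open>
  \<open>A\<close> runs in time \<open>\<tau> k n\<close> on every input \<open>(G, k)\<close> with \<open>n \<ge> 2\<close> vertices and \<open>k \<ge> 1\<close>, and if \<open>G\<close> has a
  dominating set of size at most \<open>k\<close>, it outputs one of size at most \<open>\<rho> k n * k\<close>.
\<close>

definition approximates_domset ::
  "com \<Rightarrow> (nat \<Rightarrow> nat \<Rightarrow> real) \<Rightarrow> (nat \<Rightarrow> nat \<Rightarrow> real) \<Rightarrow> bool" where
  "approximates_domset A \<tau> \<rho> \<longleftrightarrow>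
     (\<forall>k n E. k \<ge> 1 \<and> n \<ge> 2 \<and> graph n E \<longrightarrow>
        (\<exists>t y. outputs A (Cn (enc_nat k) (enc_graph n E)) t y \<and> real t \<le> \<tau> k n \<and>
           (domination_number n E \<le> k \<longrightarrow>
              (\<exists>D. dominating_set n E D \<and> real (card D) \<le> \<rho> k n * real k \<and> y = enc_set n D))))"

end

theory Submission
  imports Defs
begin

text \<open>
  Split the clauses of a sparse 3-CNF formula into \<open>k\<close> chunks. A label is a satisfying assignment of one
  chunk; a satisfying assignment of the formula is a choice of one label per chunk such that any two
  agree on the variables shared by their chunks. The agreement is tested through hash values of length
  \<open>3 * l\<close> under a Toeplitz key \<open>r\<close>. For every key, Feige's hypercube gadget yields graph vertices whose
  domination forces, among the chosen labels, one label per chunk such that all \<open>k * k\<close> pairwise hash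
  values match. A set of at most \<open>2 ^ l\<close> vertices contains so few pairs of labels that some key separates
  all distinct patterns occurring in it; for this key matching hash values mean consistent labels. Hence
  the minimum dominating set has size at most \<open>k\<close> for satisfiable formulae and more than \<open>2 ^ l\<close> otherwise.
  The gadget has \<open>k ^ (2 ^ (3 * l * k\<^sup>2))\<close> vertices per key, so \<open>2 ^ l\<close> may grow like the power
  \<open>1 / (3 * k\<^sup>2)\<close> of the number of variables, which beats \<open>k * (log n) ^ (1 / (4 * k\<^sup>2))\<close>.

  The reduction takes time polynomial in \<open>2 ^ (n / k)\<close>, with an exponent that does not depend on \<open>k\<close>.
  As the exponent of ETH is a fixed \<open>\<delta>\<close>, it suffices to run the approximation algorithm for one constant
  \<open>k\<close> with \<open>k\<close> and \<open>k / g k\<close> large compared to \<open>1 / \<delta>\<close>; then \<open>T k\<close> is a constant as well.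
\<close>

text \<open>Hashing is what makes the gadget affordable. Over an alphabet \<open>U\<close> of
  guesses the gadget has \<open>k ^ |U|\<close> points per key. With unhashed assignments of the
  shared variables \<open>U\<close> could be exponential in the chunk size \<open>c\<close>, and the
  gadget doubly exponential; hash values of \<open>3 * l\<close> bits keep \<open>k ^ |U|\<close> at
  most \<open>2 ^ c\<close>. The price is that a key separates only few patterns: at most
  \<open>2 ^ (2 * l)\<close> pairs of labels occur, each colliding for a fraction of at most
  \<open>1 / 2 ^ (3 * l)\<close> of the keys. A good key must moreover be the key of no element in
  the dominating set, since such a vertex dominates itself; this costs at most \<open>2 ^ l\<close>
  further keys. The good key depends on the set, so the gadgets of all keys stand side by side in
  one graph.

  The second obstacle is the order of choices: \<open>k\<close> has to be large compared to the
  exponent \<open>d\<close> of the reduction, so \<open>d\<close> must be known before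
  \<open>k\<close>. Hence a single program serves all \<open>k\<close>, with \<open>k\<close> as
  part of its input, and running times are measured by a weight of the instance instead of by its
  length.\<close>

declare One_nat_def [simp del] add_2_eq_Suc [simp del] add_2_eq_Suc' [simp del]

section \<open>Programs with a stack\<close>

text \<open>An upper bound in place of the exact time of \<open>exec\<close> lets branches and
  iterations of different cost share one statement.\<close>

definition halts :: "com \<Rightarrow> state \<Rightarrow> nat \<Rightarrow> (state \<Rightarrow> bool) \<Rightarrow> bool" where
  "halts c s B P \<longleftrightarrow> (\<exists>t s'. exec c s t s' \<and> t \<le> B \<and> P s')"

text \<open>Variable 0 holds input and output, variable 1 a stack that every program leaves as it found it.
  The other variables may initially contain anything.\<close>

definition runs :: "com \<Rightarrow> tree \<Rightarrow> nat \<Rightarrow> tree \<Rightarrow> bool" where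
  "runs c x B y \<longleftrightarrow> (\<forall>s. s 0 = x \<longrightarrow> halts c s B (\<lambda>s'. s' 0 = y \<and> s' 1 = s 1))"

lemma halts_mono: "halts c s B P \<Longrightarrow> B \<le> B' \<Longrightarrow> (\<And>s. P s \<Longrightarrow> Q s) \<Longrightarrow> halts c s B' Q"
  unfolding halts_def by (meson le_trans)

lemma halts_Skip: "P s \<Longrightarrow> halts Skip s 1 P"
  unfolding halts_def by (blast intro: exec.Skip)

lemma halts_Assign: "P (s(x := eval_exp e s)) \<Longrightarrow> halts (Assign x e) s (cost_exp e + 1) P"
  unfolding halts_def by (blast intro: exec.Assign)

lemma halts_Seq: "halts c s B (\<lambda>s'. halts d s' B' P) \<Longrightarrow> halts (Seq c d) s (B + B') P"
  unfolding halts_def by (meson exec.Seq add_mono)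

lemma halts_IfTrue: "eval_exp e s \<noteq> Nl \<Longrightarrow> halts c s B P \<Longrightarrow> halts (If e c d) s (cost_exp e + 1 + B) P"
  unfolding halts_def by (meson exec.IfTrue add_left_mono)

lemma halts_IfFalse: "eval_exp e s = Nl \<Longrightarrow> halts d s B P \<Longrightarrow> halts (If e c d) s (cost_exp e + 1 + B) P"
  unfolding halts_def by (meson exec.IfFalse add_left_mono)

lemma halts_WhileFalse: "eval_exp e s = Nl \<Longrightarrow> P s \<Longrightarrow> halts (While e c) s (cost_exp e + 1) P"
  unfolding halts_def by (meson exec.WhileFalse order_refl)

lemma halts_WhileTrue:
  assumes "eval_exp e s \<noteq> Nl" "halts c s B (\<lambda>s'. halts (While e c) s' B' P)"
  shows "halts (While e c) s (cost_exp e + 1 + B + B') P"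
proof -
  from assms obtain t s' u s'' where *: "exec c s t s'" "t \<le> B" "exec (While e c) s' u s''" "u \<le> B'" "P s''"
    unfolding halts_def by blast
  show ?thesis unfolding halts_def
    by (rule exI[of _ "cost_exp e + 1 + t + u"], rule exI[of _ s''])
       (use exec.WhileTrue[OF assms(1) *(1,3)] * in auto)
qed

lemma halts_runs:
  "runs c (s 0) B y \<Longrightarrow> (\<And>s'. s' 0 = y \<Longrightarrow> s' 1 = s 1 \<Longrightarrow> P s') \<Longrightarrow> halts c s B P"
  unfolding runs_def halts_def by blast

lemma runs_mono: "runs c x B y \<Longrightarrow> B \<le> B' \<Longrightarrow> runs c x B' y"
  unfolding runs_def by (metis (no_types, lifting) halts_mono)

lemma runs_Seq: "runs c x B y \<Longrightarrow> runs d y B' z \<Longrightarrow> runs (Seq c d) x (B + B') z"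
  unfolding runs_def
  by (intro allI impI halts_Seq) (erule allE, erule (1) impE, erule halts_mono, auto)

text \<open>The input waits on the stack while \<open>c\<close> runs, then the result of
  \<open>c\<close> takes its place while \<open>d\<close> runs. Variable 2 carries a value only
  across plain assignments, since subprograms may overwrite it.\<close>

definition pair_com :: "com \<Rightarrow> com \<Rightarrow> com" where
  "pair_com c d = Seq (Assign 1 (ConsE (Var 0) (Var 1)))
     (Seq c (Seq (Assign 2 (Var 0)) (Seq (Assign 0 (HdE (Var 1)))
     (Seq (Assign 1 (ConsE (Var 2) (TlE (Var 1)))) (Seq d
     (Seq (Assign 0 (ConsE (HdE (Var 1)) (Var 0))) (Assign 1 (TlE (Var 1)))))))))"

lemma runs_pair:
  assumes "runs c x B y" "runs d x B' z"
  shows "runs (pair_com c d) x (B + B' + 30) (Cn y z)"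
  unfolding runs_def
proof (intro allI impI)
  fix s :: state assume x: "s 0 = x"
  show "halts (pair_com c d) s (B + B' + 30) (\<lambda>s'. s' 0 = Cn y z \<and> s' 1 = s 1)"
    unfolding pair_com_def
    apply (rule halts_mono)
      apply (rule halts_Seq, rule halts_Assign)
      apply (rule halts_Seq, rule halts_runs[where B = B and y = y])
       apply (simp add: x assms)
      apply (rule halts_Seq, rule halts_Assign)
      apply (rule halts_Seq, rule halts_Assign)
      apply (rule halts_Seq, rule halts_Assign)
      apply (rule halts_Seq, rule halts_runs[where B = B' and y = z])
       apply (simp add: x assms)
      apply (rule halts_Seq, rule halts_Assign)
      apply (rule halts_Assign[where P = "\<lambda>s'. s' 0 = Cn y z \<and> s' 1 = s 1"])
      apply simp
     apply simp
    apply simp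
    done
qed

definition if_com :: "com \<Rightarrow> com \<Rightarrow> com \<Rightarrow> com" where
  "if_com b c d = Seq (Assign 1 (ConsE (Var 0) (Var 1)))
     (Seq b (Seq (Assign 2 (Var 0)) (Seq (Assign 0 (HdE (Var 1)))
     (Seq (Assign 1 (TlE (Var 1))) (If (Var 2) c d)))))"

lemma runs_if:
  assumes "runs b x B y" "y \<noteq> Nl \<Longrightarrow> runs c x B' z" "y = Nl \<Longrightarrow> runs d x B' z"
  shows "runs (if_com b c d) x (B + B' + 30) z"
  unfolding runs_def
proof (intro allI impI)
  fix s :: state assume x: "s 0 = x"
  have *: "halts (If (Var 2) c d) s' (2 + B') (\<lambda>s''. s'' 0 = z \<and> s'' 1 = s 1)"
    if "s' 0 = x" "s' 1 = s 1" "s' 2 = y" for s'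
  proof (cases "y = Nl")
    case True
    then have "halts (If (Var 2) c d) s' (cost_exp (Var 2) + 1 + B') (\<lambda>s''. s'' 0 = z \<and> s'' 1 = s' 1)"
      using that assms(3) by (intro halts_IfFalse) (auto simp: runs_def)
    then show ?thesis using that by simp
  next
    case False
    then have "halts (If (Var 2) c d) s' (cost_exp (Var 2) + 1 + B') (\<lambda>s''. s'' 0 = z \<and> s'' 1 = s' 1)"
      using that assms(2) by (intro halts_IfTrue) (auto simp: runs_def)
    then show ?thesis using that by simp
  qed
  show "halts (if_com b c d) s (B + B' + 30) (\<lambda>s'. s' 0 = z \<and> s' 1 = s 1)"
    unfolding if_com_def
    apply (rule halts_mono)
      apply (rule halts_Seq, rule halts_Assign)
      apply (rule halts_Seq, rule halts_runs[where B = B and y = y])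
       apply (simp add: x assms)
      apply (rule halts_Seq, rule halts_Assign)
      apply (rule halts_Seq, rule halts_Assign)
      apply (rule halts_Seq, rule halts_Assign)
      apply (rule *)
        apply (simp_all add: x)
    done
qed

text \<open>The stack frame is the triple of the remaining list, a fixed context and the
  accumulator. The body receives the context, the head of the list and the accumulator, and returns
  the new accumulator.\<close>

definition loop_com :: "com \<Rightarrow> com" where
  "loop_com c = Seq (Assign 1 (ConsE (Var 0) (Var 1)))
     (Seq (While (HdE (HdE (Var 1)))
        (Seq (Assign 0 (ConsE (HdE (TlE (HdE (Var 1))))
                (ConsE (HdE (HdE (HdE (Var 1)))) (TlE (TlE (HdE (Var 1)))))))
        (Seq c
          (Assign 1 (ConsE (ConsE (TlE (HdE (HdE (Var 1)))) (ConsE (HdE (TlE (HdE (Var 1)))) (Var 0)))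
             (TlE (Var 1)))))))
     (Seq (Assign 0 (TlE (TlE (HdE (Var 1))))) (Assign 1 (TlE (Var 1)))))"

lemma enc_list_simps [simp]: "enc_list [] = Nl" "enc_list (x # xs) = Cn x (enc_list xs)"
  by (simp_all add: enc_list_def)

lemma runs_loop:
  assumes step: "\<And>b j z. b \<in> set ls \<Longrightarrow> j < length ls \<Longrightarrow> I j z \<Longrightarrow>
      runs c (Cn x (Cn (e b) (e' z))) B (e' (step b z)) \<and> I (Suc j) (step b z)"
    and init: "I 0 z"
  shows "runs (loop_com c) (Cn (enc_list (map e ls)) (Cn x (e' z)))
    (length ls * (B + 60) + 60) (e' (fold step ls z))"
proof -
  let ?W = "While (HdE (HdE (Var 1)))
        (Seq (Assign 0 (ConsE (HdE (TlE (HdE (Var 1))))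
                (ConsE (HdE (HdE (HdE (Var 1)))) (TlE (TlE (HdE (Var 1)))))))
        (Seq c
          (Assign 1 (ConsE (ConsE (TlE (HdE (HdE (Var 1)))) (ConsE (HdE (TlE (HdE (Var 1)))) (Var 0)))
             (TlE (Var 1))))))"
  \<comment> \<open>Generalised over the start index \<open>j\<close>, since the induction shortens
    the list while the invariant counts up.\<close>
  have W: "halts ?W s (length ls * (B + 60) + 4) (\<lambda>s'. s' 1 = Cn (Cn Nl (Cn x (e' (fold step ls z)))) st)"
    if "s 1 = Cn (Cn (enc_list (map e ls)) (Cn x (e' z))) st" and "I j z"
      and "\<And>b j' z. b \<in> set ls \<Longrightarrow> j' < j + length ls \<Longrightarrow> I j' z \<Longrightarrow>
        runs c (Cn x (Cn (e b) (e' z))) B (e' (step b z)) \<and> I (Suc j') (step b z)" for j s st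
    using that
  proof (induction ls arbitrary: s z j)
    case Nil
    then show ?case
      by (intro halts_mono[OF halts_WhileFalse[where P = "\<lambda>s'. s' 1 = s 1"]]) auto
  next
    case (Cons b ls)
    have nz: "eval_exp (HdE (HdE (Var 1))) s \<noteq> Nl" using Cons.prems(1) by simp
    have b: "runs c (Cn x (Cn (e b) (e' z))) B (e' (step b z))" "I (Suc j) (step b z)"
      using Cons.prems(3)[of b j z] Cons.prems(2) by auto
    have "halts ?W s (cost_exp (HdE (HdE (Var 1))) + 1 + (B + 50) + (length ls * (B + 60) + 4))
        (\<lambda>s'. s' 1 = Cn (Cn Nl (Cn x (e' (fold step ls (step b z))))) st)"
      apply (rule halts_WhileTrue[OF nz])
      apply (rule halts_mono)
        apply (rule halts_Seq, rule halts_Assign)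
        apply (rule halts_Seq, rule halts_runs[where B = B and y = "e' (step b z)"])
         apply (simp add: Cons.prems b)
        apply (rule halts_Assign[where P = "\<lambda>s'. s' 1 = Cn (Cn (enc_list (map e ls)) (Cn x (e' (step b z)))) st"])
        apply (simp add: Cons.prems)
       apply simp
      apply (rule Cons.IH[where j = "Suc j"])
        apply simp
       apply (rule b)
      apply (simp add: Cons.prems)
      done
    then show ?case by (rule halts_mono) auto
  qed
  show ?thesis unfolding runs_def
  proof (intro allI impI)
    fix s :: state assume x: "s 0 = Cn (enc_list (map e ls)) (Cn x (e' z))"
    show "halts (loop_com c) s (length ls * (B + 60) + 60) (\<lambda>s'. s' 0 = e' (fold step ls z) \<and> s' 1 = s 1)"
      unfolding loop_com_def
      apply (rule halts_mono)
        apply (rule halts_Seq, rule halts_Assign)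
        apply (rule halts_Seq, rule halts_mono[OF W[where st = "s 1" and j = 0]])
            apply (simp add: x)
           apply (rule init)
          apply (simp add: step)
         apply (rule order_refl)
        apply (rule halts_Seq, rule halts_Assign)
        apply (rule halts_Assign[where P = "\<lambda>s'. s' 0 = e' (fold step ls z) \<and> s' 1 = s 1"])
        apply simp
       apply simp
      apply simp
      done
  qed
qed

section \<open>Polynomial bounds\<close>

text \<open>The base is at least 2, so a single power absorbs constants and sums and no coefficients
  are needed.\<close>

definition pbd :: "'a set \<Rightarrow> ('a \<Rightarrow> nat) \<Rightarrow> ('a \<Rightarrow> nat) \<Rightarrow> bool" where
  "pbd X \<mu> h \<longleftrightarrow> (\<exists>d. \<forall>a\<in>X. h a \<le> (\<mu> a + 2) ^ d)"

lemma pbd_mono: "pbd X \<mu> h \<Longrightarrow> (\<And>a. a \<in> X \<Longrightarrow> h' a \<le> h a) \<Longrightarrow> pbd X \<mu> h'"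
  unfolding pbd_def by (meson le_trans)

lemma pbd_measure: "pbd X \<mu> \<mu>"
  unfolding pbd_def by (rule exI[of _ 1]) simp

lemma pbd_const: "pbd X \<mu> (\<lambda>_. n)"
  unfolding pbd_def
proof (intro exI[of _ n] ballI)
  fix a
  have "n \<le> 2 ^ n" by simp
  also have "\<dots> \<le> (\<mu> a + 2) ^ n" by (rule power_mono) auto
  finally show "n \<le> (\<mu> a + 2) ^ n" .
qed

lemma pbd_mult: "pbd X \<mu> g \<Longrightarrow> pbd X \<mu> h \<Longrightarrow> pbd X \<mu> (\<lambda>a. g a * h a)"
  unfolding pbd_def
proof (elim exE)
  fix d d' assume "\<forall>a\<in>X. g a \<le> (\<mu> a + 2) ^ d" "\<forall>a\<in>X. h a \<le> (\<mu> a + 2) ^ d'"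
  then show "\<exists>d. \<forall>a\<in>X. g a * h a \<le> (\<mu> a + 2) ^ d"
    by (intro exI[of _ "d + d'"]) (auto simp: power_add intro!: mult_mono)
qed

text \<open>A sum is at most the product of the two successors, which reduces addition to
  multiplication.\<close>

lemma pbd_add:
  assumes "pbd X \<mu> g" "pbd X \<mu> h"
  shows "pbd X \<mu> (\<lambda>a. g a + h a)"
proof -
  have "pbd X \<mu> (\<lambda>a. (g a + 1) * (h a + 1))"
  proof (rule pbd_mult)
    have *: "pbd X \<mu> (\<lambda>a. f a + 1)" if "pbd X \<mu> f" for f
    proof -
      from that obtain d where d: "\<forall>a\<in>X. f a \<le> (\<mu> a + 2) ^ d" unfolding pbd_def by blast
      have "f a + 1 \<le> (\<mu> a + 2) ^ Suc d" if "a \<in> X" for a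
      proof -
        have "1 \<le> (\<mu> a + 2) ^ d" by simp
        then have "f a + 1 \<le> 2 * (\<mu> a + 2) ^ d" using bspec[OF d that] by linarith
        also have "\<dots> \<le> (\<mu> a + 2) ^ Suc d" by simp
        finally show ?thesis .
      qed
      then show ?thesis unfolding pbd_def by blast
    qed
    show "pbd X \<mu> (\<lambda>a. g a + 1)" "pbd X \<mu> (\<lambda>a. h a + 1)" using * assms by auto
  qed
  then show ?thesis by (rule pbd_mono) (simp add: algebra_simps)
qed

lemma pbd_power: "pbd X \<mu> g \<Longrightarrow> pbd X \<mu> (\<lambda>a. g a ^ n)"
  by (induction n) (auto intro: pbd_const pbd_mult)

lemma pbd_reindex:
  "pbd X \<mu> h \<Longrightarrow> (\<And>b. b \<in> Y \<Longrightarrow> q b \<in> X) \<Longrightarrow> (\<And>b. b \<in> Y \<Longrightarrow> \<nu> b = \<mu> (q b)) \<Longrightarrow> pbd Y \<nu> (\<lambda>b. h (q b))"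
  unfolding pbd_def by (metis (no_types, lifting))

section \<open>Polynomial-time computation\<close>

text \<open>In \<open>tcomp X \<mu> i f\<close> the instances are the \<open>a \<in> X\<close>; some program turns the encoding \<open>i a\<close> into
  \<open>f a\<close> within a time polynomial in \<open>\<mu> a\<close>. The measure \<open>\<mu>\<close> need not be related to the size of \<open>i a\<close>.\<close>

definition tcomp :: "'a set \<Rightarrow> ('a \<Rightarrow> nat) \<Rightarrow> ('a \<Rightarrow> tree) \<Rightarrow> ('a \<Rightarrow> tree) \<Rightarrow> bool" where
  "tcomp X \<mu> i f \<longleftrightarrow> (\<exists>c B. pbd X \<mu> B \<and> (\<forall>a\<in>X. runs c (i a) (B a) (f a)))"

lemma tcompI: "pbd X \<mu> B \<Longrightarrow> (\<And>a. a \<in> X \<Longrightarrow> runs c (i a) (B a) (f a)) \<Longrightarrow> tcomp X \<mu> i f"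
  unfolding tcomp_def by blast

lemma tcompE:
  assumes "tcomp X \<mu> i f"
  obtains c B where "pbd X \<mu> B" "\<And>a. a \<in> X \<Longrightarrow> runs c (i a) (B a) (f a)"
  using assms unfolding tcomp_def by blast

lemma tcomp_cong:
  "tcomp X \<mu> i f \<Longrightarrow> (\<And>a. a \<in> X \<Longrightarrow> f a = g a) \<Longrightarrow> tcomp X \<mu> i g"
  unfolding tcomp_def by (metis (no_types, lifting))

lemma tcomp_subset: "tcomp X \<mu> i f \<Longrightarrow> Y \<subseteq> X \<Longrightarrow> tcomp Y \<mu> i f"
  unfolding tcomp_def pbd_def by (meson subset_iff)

lemma tcomp_reindex:
  assumes "tcomp X \<mu> i f" "\<And>b. b \<in> Y \<Longrightarrow> q b \<in> X" "\<And>b. b \<in> Y \<Longrightarrow> \<nu> b = \<mu> (q b)"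
    "\<And>b. b \<in> Y \<Longrightarrow> j b = i (q b)"
  shows "tcomp Y \<nu> j (\<lambda>b. f (q b))"
proof -
  from assms(1) obtain c B where *: "pbd X \<mu> B" "\<And>a. a \<in> X \<Longrightarrow> runs c (i a) (B a) (f a)"
    by (rule tcompE) blast
  show ?thesis
    by (rule tcompI[OF pbd_reindex[OF *(1)]]) (use assms *(2) in auto)
qed

lemma tcomp_id: "tcomp X \<mu> i i"
  by (rule tcompI[where c = Skip and B = "\<lambda>_. 1"])
     (auto simp: runs_def pbd_const intro: halts_Skip)

lemma tcomp_comp:
  assumes "tcomp X \<mu> i f" "tcomp X \<mu> f g"
  shows "tcomp X \<mu> i g"
proof -
  from assms(1) obtain c B where c: "pbd X \<mu> B" "\<And>a. a \<in> X \<Longrightarrow> runs c (i a) (B a) (f a)" by (rule tcompE) blast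
  from assms(2) obtain d C where d: "pbd X \<mu> C" "\<And>a. a \<in> X \<Longrightarrow> runs d (f a) (C a) (g a)" by (rule tcompE) blast
  show ?thesis
    by (rule tcompI[OF pbd_add[OF c(1) d(1)]]) (auto intro: runs_Seq c d)
qed

lemma tcomp_assign:
  assumes "\<And>a s. a \<in> X \<Longrightarrow> s 0 = i a \<Longrightarrow> eval_exp e s = f a"
  shows "tcomp X \<mu> i f"
  by (rule tcompI[where c = "Assign 0 e" and B = "\<lambda>_. cost_exp e + 1"])
     (auto simp: runs_def pbd_const assms intro!: halts_Assign)

lemma tcomp_nil: "tcomp X \<mu> i (\<lambda>_. Nl)"
  by (rule tcomp_assign[where e = NilE]) simp

lemma tcomp_hd: "tcomp X \<mu> i f \<Longrightarrow> tcomp X \<mu> i (\<lambda>a. hd_tree (f a))"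
  by (erule tcomp_comp) (rule tcomp_assign[where e = "HdE (Var 0)"], simp)

lemma tcomp_tl: "tcomp X \<mu> i f \<Longrightarrow> tcomp X \<mu> i (\<lambda>a. tl_tree (f a))"
  by (erule tcomp_comp) (rule tcomp_assign[where e = "TlE (Var 0)"], simp)

lemma tcomp_pair:
  assumes "tcomp X \<mu> i f" "tcomp X \<mu> i g"
  shows "tcomp X \<mu> i (\<lambda>a. Cn (f a) (g a))"
proof -
  from assms(1) obtain c B where c: "pbd X \<mu> B" "\<And>a. a \<in> X \<Longrightarrow> runs c (i a) (B a) (f a)" by (rule tcompE) blast
  from assms(2) obtain d C where d: "pbd X \<mu> C" "\<And>a. a \<in> X \<Longrightarrow> runs d (i a) (C a) (g a)" by (rule tcompE) blast
  show ?thesis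
    by (rule tcompI[OF pbd_add[OF pbd_add[OF c(1) d(1)] pbd_const]]) (auto intro: runs_pair c d)
qed

lemma tcomp_const: "tcomp X \<mu> i (\<lambda>_. t)"
  by (induction t) (auto intro: tcomp_nil tcomp_pair)

lemma tcomp_if:
  assumes "tcomp X \<mu> i b" "tcomp X \<mu> i f" "tcomp X \<mu> i g"
  shows "tcomp X \<mu> i (\<lambda>a. if b a \<noteq> Nl then f a else g a)"
proof -
  from assms(1) obtain c0 B0 where c0: "pbd X \<mu> B0" "\<And>a. a \<in> X \<Longrightarrow> runs c0 (i a) (B0 a) (b a)" by (rule tcompE) blast
  from assms(2) obtain c B where c: "pbd X \<mu> B" "\<And>a. a \<in> X \<Longrightarrow> runs c (i a) (B a) (f a)" by (rule tcompE) blast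
  from assms(3) obtain d C where d: "pbd X \<mu> C" "\<And>a. a \<in> X \<Longrightarrow> runs d (i a) (C a) (g a)" by (rule tcompE) blast
  show ?thesis
  proof (rule tcompI[OF pbd_add[OF pbd_add[OF c0(1) pbd_add[OF c(1) d(1)]] pbd_const]])
    fix a assume "a \<in> X"
    then show "runs (if_com c0 c d) (i a) (B0 a + (B a + C a) + 30) (if b a \<noteq> Nl then f a else g a)"
      using runs_mono[OF c(2), of a "B a + C a"] runs_mono[OF d(2), of a "B a + C a"] c0(2)[of a]
      by (intro runs_if) auto
  qed
qed

definition encL :: "('a \<Rightarrow> tree) \<Rightarrow> 'a list \<Rightarrow> tree" where
  "encL e xs = enc_list (map e xs)"

definition encP :: "('a \<Rightarrow> tree) \<Rightarrow> ('b \<Rightarrow> tree) \<Rightarrow> 'a \<times> 'b \<Rightarrow> tree" where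
  "encP e e' = (\<lambda>(x, y). Cn (e x) (e' y))"

lemma encL_simps [simp]: "encL e [] = Nl" "encL e (x # xs) = Cn (e x) (encL e xs)"
  by (simp_all add: encL_def)

lemma encP_simps [simp]: "encP e e' (x, y) = Cn (e x) (e' y)"
  by (simp add: encP_def)

text \<open>Iterating a body that is polynomial in its own input could blow up the accumulator. The
  body is therefore bounded in the measure of the outer instance, and only on accumulators that the
  invariant admits after \<open>j\<close> rounds.\<close>

lemma tcomp_fold_counted:
  fixes ls :: "'a \<Rightarrow> 'b list" and z :: "'a \<Rightarrow> 'c" and I :: "'a \<Rightarrow> nat \<Rightarrow> 'c \<Rightarrow> bool"
  assumes ls: "tcomp X \<mu> i (\<lambda>a. encL e (ls a))" and z: "tcomp X \<mu> i (\<lambda>a. e' (z a))"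
    and st: "tcomp {(a, b, y). a \<in> X \<and> b \<in> set (ls a) \<and> (\<exists>j<length (ls a). I a j y)} (\<lambda>(a, b, y). \<mu> a)
      (\<lambda>(a, b, y). Cn (i a) (Cn (e b) (e' y))) (\<lambda>(a, b, y). e' (st a b y))"
    and len: "pbd X \<mu> (\<lambda>a. length (ls a))"
    and I0: "\<And>a. a \<in> X \<Longrightarrow> I a 0 (z a)"
    and I: "\<And>a b j y. a \<in> X \<Longrightarrow> b \<in> set (ls a) \<Longrightarrow> j < length (ls a) \<Longrightarrow> I a j y \<Longrightarrow> I a (Suc j) (st a b y)"
  shows "tcomp X \<mu> i (\<lambda>a. e' (fold (st a) (ls a) (z a)))"
proof -
  let ?Y = "{(a, b, y). a \<in> X \<and> b \<in> set (ls a) \<and> (\<exists>j<length (ls a). I a j y)}"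
  from st obtain c B where c: "pbd ?Y (\<lambda>(a, b, y). \<mu> a) B"
    "\<And>a b j y. a \<in> X \<Longrightarrow> b \<in> set (ls a) \<Longrightarrow> j < length (ls a) \<Longrightarrow> I a j y \<Longrightarrow>
        runs c (Cn (i a) (Cn (e b) (e' y))) (B (a, b, y)) (e' (st a b y))"
    by (rule tcompE) fastforce
  from c(1) obtain d where d: "\<And>a b j y. a \<in> X \<Longrightarrow> b \<in> set (ls a) \<Longrightarrow> j < length (ls a) \<Longrightarrow> I a j y \<Longrightarrow>
      B (a, b, y) \<le> (\<mu> a + 2) ^ d"
    unfolding pbd_def by fastforce
  let ?g = "\<lambda>a. Cn (encL e (ls a)) (Cn (i a) (e' (z a)))"
  have 1: "tcomp X \<mu> i ?g"
    by (intro tcomp_pair ls z tcomp_id)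
  have 2: "tcomp X \<mu> ?g (\<lambda>a. e' (fold (st a) (ls a) (z a)))"
  proof (rule tcompI[where c = "loop_com c" and B = "\<lambda>a. length (ls a) * ((\<mu> a + 2) ^ d + 60) + 60"])
    show "pbd X \<mu> (\<lambda>a. length (ls a) * ((\<mu> a + 2) ^ d + 60) + 60)"
      by (intro pbd_add pbd_mult pbd_power pbd_const len pbd_measure)
    fix a assume a: "a \<in> X"
    show "runs (loop_com c) (?g a) (length (ls a) * ((\<mu> a + 2) ^ d + 60) + 60)
        (e' (fold (st a) (ls a) (z a)))"
      unfolding encL_def
    proof (rule runs_loop[where I = "I a"])
      fix b j y assume bz: "b \<in> set (ls a)" "j < length (ls a)" "I a j y"
      show "runs c (Cn (i a) (Cn (e b) (e' y))) ((\<mu> a + 2) ^ d) (e' (st a b y)) \<and> I a (Suc j) (st a b y)"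
        using runs_mono[OF c(2)[OF a bz] d[OF a bz]] I[OF a bz] by (rule conjI)
    qed (rule I0[OF a])
  qed
  show ?thesis by (rule tcomp_comp[OF 1 2])
qed

lemma tcomp_fold:
  assumes "tcomp X \<mu> i (\<lambda>a. encL e (ls a))" "tcomp X \<mu> i (\<lambda>a. e' (z a))"
    and "tcomp {(a, b, y). a \<in> X \<and> b \<in> set (ls a)} (\<lambda>(a, b, y). \<mu> a)
      (\<lambda>(a, b, y). Cn (i a) (Cn (e b) (e' y))) (\<lambda>(a, b, y). e' (st a b y))"
    and "pbd X \<mu> (\<lambda>a. length (ls a))"
  shows "tcomp X \<mu> i (\<lambda>a. e' (fold (st a) (ls a) (z a)))"
  by (rule tcomp_fold_counted[where I = "\<lambda>_ _ _. True", OF assms(1,2) tcomp_subset[OF assms(3)] assms(4)])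
     auto

text \<open>Running time does not control the size of the output as a tree: \<open>Cn x x\<close> is
  built in constant time, so \<open>t\<close> steps may yield a tree of size exponential in
  \<open>t\<close>. The size bound is what lets an output serve as the range of a loop.\<close>

definition ptime :: "'a set \<Rightarrow> ('a \<Rightarrow> nat) \<Rightarrow> ('a \<Rightarrow> tree) \<Rightarrow> ('a \<Rightarrow> tree) \<Rightarrow> bool" where
  "ptime X \<mu> i f \<longleftrightarrow> tcomp X \<mu> i f \<and> pbd X \<mu> (\<lambda>a. size (f a))"

lemma ptimeI: "tcomp X \<mu> i f \<Longrightarrow> pbd X \<mu> (\<lambda>a. size (f a)) \<Longrightarrow> ptime X \<mu> i f"
  by (simp add: ptime_def)

lemma ptime_tcomp: "ptime X \<mu> i f \<Longrightarrow> tcomp X \<mu> i f"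
  by (simp add: ptime_def)

lemma ptime_pbd: "ptime X \<mu> i f \<Longrightarrow> pbd X \<mu> (\<lambda>a. size (f a))"
  by (simp add: ptime_def)

lemma ptime_cong: "ptime X \<mu> i f \<Longrightarrow> (\<And>a. a \<in> X \<Longrightarrow> f a = g a) \<Longrightarrow> ptime X \<mu> i g"
  unfolding ptime_def by (auto intro: tcomp_cong pbd_mono)

lemma ptime_reindex:
  assumes "ptime X \<mu> i f" "\<And>b. b \<in> Y \<Longrightarrow> q b \<in> X" "\<And>b. b \<in> Y \<Longrightarrow> \<nu> b = \<mu> (q b)"
    "\<And>b. b \<in> Y \<Longrightarrow> j b = i (q b)"
  shows "ptime Y \<nu> j (\<lambda>b. f (q b))"
  using assms unfolding ptime_def
  by (auto intro: tcomp_reindex pbd_reindex[where h = "\<lambda>a. size (f a)"])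

lemma ptime_comp: "tcomp X \<mu> i f \<Longrightarrow> ptime X \<mu> f g \<Longrightarrow> ptime X \<mu> i g"
  unfolding ptime_def by (auto intro: tcomp_comp)

lemma ptime_const: "ptime X \<mu> i (\<lambda>_. t)"
  unfolding ptime_def by (auto intro: tcomp_const pbd_const)

lemma size_hd_tree: "size (hd_tree t) \<le> size t"
  by (cases t) auto

lemma size_tl_tree: "size (tl_tree t) \<le> size t"
  by (cases t) auto

lemma ptime_hd: "ptime X \<mu> i f \<Longrightarrow> ptime X \<mu> i (\<lambda>a. hd_tree (f a))"
  unfolding ptime_def by (auto intro: tcomp_hd pbd_mono size_hd_tree)

lemma ptime_tl: "ptime X \<mu> i f \<Longrightarrow> ptime X \<mu> i (\<lambda>a. tl_tree (f a))"
  unfolding ptime_def by (auto intro: tcomp_tl pbd_mono size_tl_tree)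

lemma ptime_Cn: "ptime X \<mu> i f \<Longrightarrow> ptime X \<mu> i g \<Longrightarrow> ptime X \<mu> i (\<lambda>a. Cn (f a) (g a))"
  unfolding ptime_def
  by (auto intro!: tcomp_pair intro: pbd_mono[OF pbd_add[OF pbd_add pbd_const[where n = 1]]])

lemma ptime_if_tree:
  assumes "tcomp X \<mu> i b" "ptime X \<mu> i f" "ptime X \<mu> i g"
  shows "ptime X \<mu> i (\<lambda>a. if b a \<noteq> Nl then f a else g a)"
proof (rule ptimeI)
  show "tcomp X \<mu> i (\<lambda>a. if b a \<noteq> Nl then f a else g a)"
    using assms by (intro tcomp_if) (auto simp: ptime_def)
  have "pbd X \<mu> (\<lambda>a. size (f a) + size (g a))"
    using assms by (intro pbd_add) (auto simp: ptime_def)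
  then show "pbd X \<mu> (\<lambda>a. size (if b a \<noteq> Nl then f a else g a))"
    by (rule pbd_mono) auto
qed

subsection \<open>Booleans and pairs\<close>

lemma ptime_if:
  assumes "ptime X \<mu> i (\<lambda>a. enc_bool (b a))" "ptime X \<mu> i (\<lambda>a. e (f a))" "ptime X \<mu> i (\<lambda>a. e (g a))"
  shows "ptime X \<mu> i (\<lambda>a. e (if b a then f a else g a))"
  by (rule ptime_cong[OF ptime_if_tree[OF ptime_tcomp[OF assms(1)] assms(2,3)]])
     (auto simp: enc_bool_def)

lemma ptime_if_bool:
  assumes "ptime X \<mu> i (\<lambda>a. enc_bool (b a))" "ptime X \<mu> i (\<lambda>a. enc_bool (f a))" "ptime X \<mu> i (\<lambda>a. enc_bool (g a))"
    and "\<And>a. a \<in> X \<Longrightarrow> h a = (if b a then f a else g a)"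
  shows "ptime X \<mu> i (\<lambda>a. enc_bool (h a))"
  by (rule ptime_cong[OF ptime_if[where e = enc_bool, OF assms(1-3)]]) (simp add: assms(4))

lemma ptime_not: "ptime X \<mu> i (\<lambda>a. enc_bool (b a)) \<Longrightarrow> ptime X \<mu> i (\<lambda>a. enc_bool (\<not> b a))"
  by (erule ptime_if_bool[OF _ ptime_const[of _ _ _ "enc_bool False"] ptime_const[of _ _ _ "enc_bool True"]])
     auto

lemma ptime_conj: "ptime X \<mu> i (\<lambda>a. enc_bool (b a)) \<Longrightarrow> ptime X \<mu> i (\<lambda>a. enc_bool (c a)) \<Longrightarrow>
    ptime X \<mu> i (\<lambda>a. enc_bool (b a \<and> c a))"
  by (erule ptime_if_bool[OF _ _ ptime_const[of _ _ _ "enc_bool False"]]) auto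

lemma ptime_disj: "ptime X \<mu> i (\<lambda>a. enc_bool (b a)) \<Longrightarrow> ptime X \<mu> i (\<lambda>a. enc_bool (c a)) \<Longrightarrow>
    ptime X \<mu> i (\<lambda>a. enc_bool (b a \<or> c a))"
  by (erule ptime_if_bool[OF _ ptime_const[of _ _ _ "enc_bool True"]]) auto

lemma ptime_imp: "ptime X \<mu> i (\<lambda>a. enc_bool (b a)) \<Longrightarrow> ptime X \<mu> i (\<lambda>a. enc_bool (c a)) \<Longrightarrow>
    ptime X \<mu> i (\<lambda>a. enc_bool (b a \<longrightarrow> c a))"
  by (erule ptime_if_bool[OF _ _ ptime_const[of _ _ _ "enc_bool True"]]) auto

lemma ptime_bool_eq: "ptime X \<mu> i (\<lambda>a. enc_bool (b a)) \<Longrightarrow> ptime X \<mu> i (\<lambda>a. enc_bool (c a)) \<Longrightarrow>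
    ptime X \<mu> i (\<lambda>a. enc_bool (b a = c a))"
  by (erule ptime_if_bool[OF _ _ ptime_not[of _ _ _ c]]) auto

lemma ptime_nonnil: "tcomp X \<mu> i f \<Longrightarrow> ptime X \<mu> i (\<lambda>a. enc_bool (f a \<noteq> Nl))"
  by (erule ptime_cong[OF ptime_if_tree[OF _ ptime_const[of _ _ _ "enc_bool True"]
     ptime_const[of _ _ _ "enc_bool False"]]]) auto

lemma ptime_Pair: "ptime X \<mu> i (\<lambda>a. e (f a)) \<Longrightarrow> ptime X \<mu> i (\<lambda>a. e' (g a)) \<Longrightarrow>
    ptime X \<mu> i (\<lambda>a. encP e e' (f a, g a))"
  by (simp add: ptime_Cn)

lemma ptime_fst: "ptime X \<mu> i (\<lambda>a. encP e e' (f a)) \<Longrightarrow> ptime X \<mu> i (\<lambda>a. e (fst (f a)))"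
  by (drule ptime_hd) (auto simp: encP_def split_beta)

lemma ptime_snd: "ptime X \<mu> i (\<lambda>a. encP e e' (f a)) \<Longrightarrow> ptime X \<mu> i (\<lambda>a. e' (snd (f a)))"
  by (drule ptime_tl) (auto simp: encP_def split_beta)

subsection \<open>Lists\<close>

lemma length_le_size_encL: "length xs \<le> size (encL e xs)"
  by (induction xs) auto

lemma size_le_size_encL: "x \<in> set xs \<Longrightarrow> size (e x) \<le> size (encL e xs)"
  by (induction xs) auto

lemma size_encL_le: "(\<And>x. x \<in> set xs \<Longrightarrow> size (e x) \<le> B) \<Longrightarrow> size (encL e xs) \<le> length xs * (B + 1)"
  by (induction xs) (auto simp: add_mono)

lemma pbd_length: "ptime X \<mu> i (\<lambda>a. encL e (xs a)) \<Longrightarrow> pbd X \<mu> (\<lambda>a. length (xs a))"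
  by (drule ptime_pbd) (auto intro: pbd_mono length_le_size_encL)

lemma pbd_encL:
  assumes "pbd X \<mu> (\<lambda>a. length (xs a))"
    "pbd (SIGMA a:X. set (xs a)) (\<lambda>p. \<mu> (fst p)) (\<lambda>p. size (e (snd p)))"
  shows "pbd X \<mu> (\<lambda>a. size (encL e (xs a)))"
proof -
  from assms(2) obtain d where d: "\<And>a x. a \<in> X \<Longrightarrow> x \<in> set (xs a) \<Longrightarrow> size (e x) \<le> (\<mu> a + 2) ^ d"
    unfolding pbd_def by fastforce
  have "pbd X \<mu> (\<lambda>a. length (xs a) * ((\<mu> a + 2) ^ d + 1))"
    by (intro pbd_mult pbd_add pbd_power pbd_const assms pbd_measure)
  then show ?thesis
    by (rule pbd_mono) (auto intro: size_encL_le d)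
qed

text \<open>The instances of a loop body pair an instance with a list element.\<close>

lemma ptime_outer:
  "ptime X \<mu> i f \<Longrightarrow> ptime (SIGMA a:X. Y a) (\<lambda>p. \<mu> (fst p)) (\<lambda>p. Cn (i (fst p)) (e (snd p))) (\<lambda>p. f (fst p))"
proof (rule ptime_comp[where f = "\<lambda>p. i (fst p)"])
  show "tcomp (SIGMA a:X. Y a) (\<lambda>p. \<mu> (fst p)) (\<lambda>p. Cn (i (fst p)) (e (snd p))) (\<lambda>p. i (fst p))"
    by (rule tcomp_assign[where e = "HdE (Var 0)"]) simp
qed (auto intro: ptime_reindex)

text \<open>Access to the loop variable, as \<open>ptime_outer\<close> gives access to the enclosing
  ones. With one \<open>ptime_outer\<close> per enclosing loop, nested list comprehensions are
  handled by resolution alone.\<close>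

lemma ptime_elem:
  assumes "ptime X \<mu> i (\<lambda>a. encL e (xs a))"
  shows "ptime (SIGMA a:X. set (xs a)) (\<lambda>p. \<mu> (fst p)) (\<lambda>p. Cn (i (fst p)) (e (snd p))) (\<lambda>p. e (snd p))"
proof (rule ptimeI)
  show "tcomp (SIGMA a:X. set (xs a)) (\<lambda>p. \<mu> (fst p)) (\<lambda>p. Cn (i (fst p)) (e (snd p))) (\<lambda>p. e (snd p))"
    by (rule tcomp_assign[where e = "TlE (Var 0)"]) simp
  have "pbd (SIGMA a:X. set (xs a)) (\<lambda>p. \<mu> (fst p)) (\<lambda>p. size (encL e (xs (fst p))))"
    using ptime_pbd[OF assms] by (rule pbd_reindex) auto
  then show "pbd (SIGMA a:X. set (xs a)) (\<lambda>p. \<mu> (fst p)) (\<lambda>p. size (e (snd p)))"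
    by (rule pbd_mono) (auto intro: size_le_size_encL)
qed

lemma fold_Cons_map: "fold (\<lambda>b acc. g b # acc) xs ys = rev (map g xs) @ ys"
  by (induction xs arbitrary: ys) auto

text \<open>Pushing results onto an accumulator reverses the list; a second pass restores the order.
  The initial accumulator \<open>ys\<close> makes the lemma usable for \<open>append\<close> and for
  the body of \<open>concat\<close>.\<close>

lemma tcomp_rev_map:
  assumes xs: "tcomp X \<mu> i (\<lambda>a. encL e (xs a))" and len: "pbd X \<mu> (\<lambda>a. length (xs a))"
    and ys: "tcomp X \<mu> i (\<lambda>a. encL e' (ys a))"
    and g: "tcomp (SIGMA a:X. set (xs a)) (\<lambda>p. \<mu> (fst p)) (\<lambda>p. Cn (i (fst p)) (e (snd p)))
      (\<lambda>p. e' (g (fst p) (snd p)))"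
  shows "tcomp X \<mu> i (\<lambda>a. encL e' (rev (map (g a) (xs a)) @ ys a))"
proof -
  let ?Y = "{(a, b, y). a \<in> X \<and> b \<in> set (xs a)}" and ?\<nu> = "\<lambda>(a, b, y::'c list). \<mu> a"
    and ?j = "\<lambda>(a, b, y). Cn (i a) (Cn (e b) (encL e' y))"
  have "tcomp ?Y ?\<nu> ?j (\<lambda>(a, b, y). Cn (i a) (e b))"
    by (rule tcomp_assign[where e = "ConsE (HdE (Var 0)) (HdE (TlE (Var 0)))"]) auto
  moreover have "tcomp ?Y ?\<nu> (\<lambda>(a, b, y). Cn (i a) (e b)) (\<lambda>p. e' (g (fst (case p of (a, b, y) \<Rightarrow> (a, b))) (snd (case p of (a, b, y) \<Rightarrow> (a, b)))))"
    by (rule tcomp_reindex[OF g]) auto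
  ultimately have 1: "tcomp ?Y ?\<nu> ?j (\<lambda>(a, b, y). e' (g a b))"
    by (auto intro: tcomp_comp tcomp_cong)
  have 2: "tcomp ?Y ?\<nu> ?j (\<lambda>(a, b, y). encL e' y)"
    by (rule tcomp_assign[where e = "TlE (TlE (Var 0))"]) auto
  have "tcomp ?Y ?\<nu> ?j (\<lambda>(a, b, y). encL e' (g a b # y))"
    by (rule tcomp_cong[OF tcomp_pair[OF 1 2]]) auto
  from tcomp_fold[where e' = "encL e'" and st = "\<lambda>a b y. g a b # y", OF xs ys this len]
  show ?thesis by (simp add: fold_Cons_map)
qed

lemma ptime_rev: 
  assumes "ptime X \<mu> i (\<lambda>a. encL e (xs a))"
  shows "ptime X \<mu> i (\<lambda>a. encL e (rev (xs a)))"
proof (rule ptimeI)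
  have "tcomp X \<mu> i (\<lambda>a. encL e (rev (map (\<lambda>b. b) (xs a)) @ []))"
    by (rule tcomp_rev_map[OF ptime_tcomp[OF assms] pbd_length[OF assms]])
       (simp add: tcomp_nil, rule ptime_tcomp[OF ptime_elem[OF assms]])
  then show "tcomp X \<mu> i (\<lambda>a. encL e (rev (xs a)))" by simp
  show "pbd X \<mu> (\<lambda>a. size (encL e (rev (xs a))))"
    by (rule pbd_encL) (use assms in \<open>auto dest: pbd_length ptime_elem ptime_pbd\<close>)
qed

lemma ptime_map:
  assumes "ptime X \<mu> i (\<lambda>a. encL e (xs a))"
    "ptime (SIGMA a:X. set (xs a)) (\<lambda>p. \<mu> (fst p)) (\<lambda>p. Cn (i (fst p)) (e (snd p))) (\<lambda>p. e' (g (fst p) (snd p)))"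
  shows "ptime X \<mu> i (\<lambda>a. encL e' (map (g a) (xs a)))"
proof -
  have "ptime X \<mu> i (\<lambda>a. encL e' (rev (map (g a) (xs a))))"
  proof (rule ptimeI)
    have "tcomp X \<mu> i (\<lambda>a. encL e' (rev (map (g a) (xs a)) @ []))"
      by (rule tcomp_rev_map[OF ptime_tcomp[OF assms(1)] pbd_length[OF assms(1)]])
         (simp add: tcomp_nil, rule ptime_tcomp[OF assms(2)])
    then show "tcomp X \<mu> i (\<lambda>a. encL e' (rev (map (g a) (xs a))))" by simp
    from ptime_pbd[OF assms(2)] obtain d where
      d: "\<And>a x. a \<in> X \<Longrightarrow> x \<in> set (xs a) \<Longrightarrow> size (e' (g a x)) \<le> (\<mu> a + 2) ^ d"
      unfolding pbd_def by fastforce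
    have "pbd X \<mu> (\<lambda>a. length (xs a) * ((\<mu> a + 2) ^ d + 1))"
      by (intro pbd_mult pbd_add pbd_power pbd_const pbd_length[OF assms(1)] pbd_measure)
    then show "pbd X \<mu> (\<lambda>a. size (encL e' (rev (map (g a) (xs a)))))"
      by (rule pbd_mono) (rule order_trans[OF size_encL_le], use d in auto)
  qed
  from ptime_rev[OF this] show ?thesis by simp
qed

lemma size_encL_append: "size (encL e (xs @ ys)) = size (encL e xs) + size (encL e ys)"
  by (induction xs) auto

lemma ptime_append:
  assumes "ptime X \<mu> i (\<lambda>a. encL e (xs a))" "ptime X \<mu> i (\<lambda>a. encL e (ys a))"
  shows "ptime X \<mu> i (\<lambda>a. encL e (xs a @ ys a))"
proof (rule ptimeI)
  note r = ptime_rev[OF assms(1)]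
  have "tcomp X \<mu> i (\<lambda>a. encL e (rev (map (\<lambda>b. b) (rev (xs a))) @ ys a))"
    by (rule tcomp_rev_map[OF ptime_tcomp[OF r] pbd_length[OF r] ptime_tcomp[OF assms(2)]])
       (rule ptime_tcomp[OF ptime_elem[OF r]])
  then show "tcomp X \<mu> i (\<lambda>a. encL e (xs a @ ys a))" by simp
  show "pbd X \<mu> (\<lambda>a. size (encL e (xs a @ ys a)))"
    unfolding size_encL_append by (rule pbd_add[OF ptime_pbd[OF assms(1)] ptime_pbd[OF assms(2)]])
qed

lemma fold_rev_concat: "fold (\<lambda>b acc. rev b @ acc) xs ys = rev (concat xs) @ ys"
  by (induction xs arbitrary: ys) auto

lemma ptime_concat:
  assumes xs: "ptime X \<mu> i (\<lambda>a. encL (encL e) (xs a))"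
  shows "ptime X \<mu> i (\<lambda>a. encL e (concat (xs a)))"
proof -
  have "ptime X \<mu> i (\<lambda>a. encL e (rev (concat (xs a))))"
  proof (rule ptimeI)
    let ?Y = "{(a, b, y). a \<in> X \<and> b \<in> set (xs a)}" and ?\<nu> = "\<lambda>(a, b, y::'b list). \<mu> a"
      and ?j = "\<lambda>(a, b, y). Cn (i a) (Cn (encL e b) (encL e y))"
    \<comment> \<open>The accumulator gets no size bound: prepending \<open>rev b\<close> takes time
      depending on \<open>b\<close> alone.\<close>
    have 2: "tcomp ?Y ?\<nu> ?j (\<lambda>p. encL e (snd (snd p)))"
      by (rule tcomp_assign[where e = "TlE (TlE (Var 0))"]) auto
    have 1: "ptime ?Y ?\<nu> ?j (\<lambda>p. encL e (fst (snd p)))"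
    proof (rule ptimeI)
      show "tcomp ?Y ?\<nu> ?j (\<lambda>p. encL e (fst (snd p)))"
        by (rule tcomp_assign[where e = "HdE (TlE (Var 0))"]) auto
      have "pbd ?Y ?\<nu> (\<lambda>p. size (encL (encL e) (xs (fst p))))"
        using ptime_pbd[OF xs] by (rule pbd_reindex) auto
      then show "pbd ?Y ?\<nu> (\<lambda>p. size (encL e (fst (snd p))))"
        by (rule pbd_mono) (auto intro: size_le_size_encL)
    qed
    have "tcomp ?Y ?\<nu> ?j (\<lambda>p. encL e (rev (map (\<lambda>x. x) (fst (snd p))) @ snd (snd p)))"
      by (rule tcomp_rev_map[OF ptime_tcomp[OF 1] pbd_length[OF 1] 2])
         (rule ptime_tcomp[OF ptime_elem[OF 1]])
    then have 3: "tcomp ?Y ?\<nu> ?j (\<lambda>(a, b, y). encL e (rev b @ y))"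
      by (rule tcomp_cong) auto
    from tcomp_fold[where e' = "encL e" and st = "\<lambda>a b y. rev b @ y" and z = "\<lambda>_. []",
        OF ptime_tcomp[OF xs] _ 3 pbd_length[OF xs]]
    show "tcomp X \<mu> i (\<lambda>a. encL e (rev (concat (xs a))))" by (simp add: fold_rev_concat tcomp_nil)
    have "size (encL e (concat ys)) \<le> size (encL (encL e) ys)" for ys
      by (induction ys) (auto simp: size_encL_append)
    moreover have "size (encL e (rev ys)) = size (encL e ys)" for ys
      by (induction ys) (auto simp: size_encL_append)
    ultimately show "pbd X \<mu> (\<lambda>a. size (encL e (rev (concat (xs a)))))"
      by (intro pbd_mono[OF ptime_pbd[OF xs]]) simp
  qed
  from ptime_rev[OF this] show ?thesis by simp
qed

lemma ptime_Nil: "ptime X \<mu> i (\<lambda>a. encL e [])"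
  by (simp add: ptime_const)

lemma ptime_Cons: "ptime X \<mu> i (\<lambda>a. e (x a)) \<Longrightarrow> ptime X \<mu> i (\<lambda>a. encL e (xs a)) \<Longrightarrow>
    ptime X \<mu> i (\<lambda>a. encL e (x a # xs a))"
  by (simp add: ptime_Cn)

lemma ptime_filter:
  assumes "ptime X \<mu> i (\<lambda>a. encL e (xs a))"
    "ptime (SIGMA a:X. set (xs a)) (\<lambda>p. \<mu> (fst p)) (\<lambda>p. Cn (i (fst p)) (e (snd p))) (\<lambda>p. enc_bool (P (fst p) (snd p)))"
  shows "ptime X \<mu> i (\<lambda>a. encL e (filter (P a) (xs a)))"
proof -
  have "ptime X \<mu> i (\<lambda>a. encL e (concat (map (\<lambda>x. if P a x then [x] else []) (xs a))))"
    by (rule ptime_concat, rule ptime_map[OF assms(1)], rule ptime_if[OF assms(2)])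
       (rule ptime_Cons ptime_Nil ptime_elem assms)+
  moreover have "concat (map (\<lambda>x. if Q x then [x] else []) ys) = filter Q ys" for Q and ys :: "'b list"
    by (induction ys) auto
  ultimately show ?thesis by simp
qed

lemma encL_eq_Nl [simp]: "encL e xs = Nl \<longleftrightarrow> xs = []"
  by (cases xs) auto

lemma ptime_Nil_eq: "ptime X \<mu> i (\<lambda>a. encL e (xs a)) \<Longrightarrow> ptime X \<mu> i (\<lambda>a. enc_bool (xs a = []))"
  by (drule ptime_not[OF ptime_nonnil[OF ptime_tcomp]]) simp

lemma ptime_ex:
  assumes "ptime X \<mu> i (\<lambda>a. encL e (xs a))"
    "ptime (SIGMA a:X. set (xs a)) (\<lambda>p. \<mu> (fst p)) (\<lambda>p. Cn (i (fst p)) (e (snd p))) (\<lambda>p. enc_bool (P (fst p) (snd p)))"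
  shows "ptime X \<mu> i (\<lambda>a. enc_bool (\<exists>x\<in>set (xs a). P a x))"
  by (rule ptime_cong[OF ptime_not[OF ptime_Nil_eq[OF ptime_filter[OF assms]]]])
     (auto simp: filter_empty_conv)

lemma ptime_all:
  assumes "ptime X \<mu> i (\<lambda>a. encL e (xs a))"
    "ptime (SIGMA a:X. set (xs a)) (\<lambda>p. \<mu> (fst p)) (\<lambda>p. Cn (i (fst p)) (e (snd p))) (\<lambda>p. enc_bool (P (fst p) (snd p)))"
  shows "ptime X \<mu> i (\<lambda>a. enc_bool (\<forall>x\<in>set (xs a). P a x))"
  by (rule ptime_cong[OF ptime_Nil_eq[OF ptime_filter[OF assms(1) ptime_not[OF assms(2)]]]])
     (auto simp: filter_empty_conv)

lemma ptime_product:
  assumes "ptime X \<mu> i (\<lambda>a. encL e (xs a))" "ptime X \<mu> i (\<lambda>a. encL e' (ys a))"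
  shows "ptime X \<mu> i (\<lambda>a. encL (encP e e') (List.product (xs a) (ys a)))"
  unfolding product_concat_map
  by (intro ptime_concat ptime_map[OF assms(1)] ptime_map[OF ptime_outer[OF assms(2)]] ptime_Pair
      ptime_elem[OF ptime_outer[OF assms(2)]] ptime_outer[OF ptime_elem[OF assms(1)]])

lemma ptime_zip:
  assumes xs: "ptime X \<mu> i (\<lambda>a. encL e (xs a))" and ys: "ptime X \<mu> i (\<lambda>a. encL e' (ys a))"
  shows "ptime X \<mu> i (\<lambda>a. encL (encP e e') (zip (xs a) (ys a)))"
proof -
  \<comment> \<open>The loop runs over the first list only; the second one is consumed through the
    accumulator.\<close>
  define st where "st = (\<lambda>(b::'b) (r::'c list, out). case r of [] \<Rightarrow> (r, out) | y # r' \<Rightarrow> (r', (b, y) # out))"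
  have st: "fold st us (vs, out) = (drop (length us) vs, rev (zip us vs) @ out)" for us vs out
    by (induction us arbitrary: vs out) (auto simp: st_def split: list.splits)
  let ?E = "encP (encL e') (encL (encP e e'))"
  have "tcomp X \<mu> i (\<lambda>a. ?E (fold st (xs a) (ys a, [])))"
  proof (rule tcomp_fold[OF ptime_tcomp[OF xs] _ _ pbd_length[OF xs]])
    show "tcomp X \<mu> i (\<lambda>a. ?E (ys a, []))"
      by (simp add: tcomp_pair tcomp_nil ptime_tcomp[OF ys])
    let ?Y = "{(a, b, y). a \<in> X \<and> b \<in> set (xs a)}" and ?\<nu> = "\<lambda>(a, b, y::'c list \<times> ('b \<times> 'c) list). \<mu> a"
      and ?j = "\<lambda>(a, b, y). Cn (i a) (Cn (e b) (?E y))"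
    have "tcomp ?Y ?\<nu> ?j (\<lambda>(a, b, r, out). encL e' r)"
      by (rule tcomp_assign[where e = "HdE (TlE (TlE (Var 0)))"]) auto
    moreover have "tcomp ?Y ?\<nu> ?j (\<lambda>(a, b, r, out). Cn (tl_tree (encL e' r))
          (Cn (Cn (e b) (hd_tree (encL e' r))) (encL (encP e e') out)))"
      by (rule tcomp_assign[where e = "ConsE (TlE (HdE (TlE (TlE (Var 0))))) (ConsE (ConsE (HdE (TlE (Var 0))) (HdE (HdE (TlE (TlE (Var 0)))))) (TlE (TlE (TlE (Var 0)))))"]) auto
    moreover have "tcomp ?Y ?\<nu> ?j (\<lambda>(a, b, r, out). ?E (r, out))"
      by (rule tcomp_assign[where e = "TlE (TlE (Var 0))"]) auto
    ultimately have "tcomp ?Y ?\<nu> ?j (\<lambda>p. if (\<lambda>(a, b, r, out). encL e' r) p \<noteq> Nl then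
        (\<lambda>(a, b, r, out). Cn (tl_tree (encL e' r)) (Cn (Cn (e b) (hd_tree (encL e' r))) (encL (encP e e') out))) p
        else (\<lambda>(a, b, r, out). ?E (r, out)) p)"
      by (rule tcomp_if)
    then show "tcomp ?Y ?\<nu> ?j (\<lambda>(a, b, y). ?E (st b y))"
      by (rule tcomp_cong) (auto simp: st_def split: list.splits)
  qed
  then have "tcomp X \<mu> i (\<lambda>a. encL (encP e e') (rev (zip (xs a) (ys a))))"
    using tcomp_tl by (fastforce simp: st)
  then have "ptime X \<mu> i (\<lambda>a. encL (encP e e') (rev (zip (xs a) (ys a))))"
  proof (rule ptimeI)
    have "pbd X \<mu> (\<lambda>a. length (xs a) * (size (encL e (xs a)) + size (encL e' (ys a)) + 1 + 1))"
      by (intro pbd_mult pbd_add pbd_const pbd_length[OF xs] ptime_pbd[OF xs] ptime_pbd[OF ys])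
    then show "pbd X \<mu> (\<lambda>a. size (encL (encP e e') (rev (zip (xs a) (ys a)))))"
    proof (rule pbd_mono)
      fix a assume "a \<in> X"
      have "size (encL (encP e e') (rev (zip (xs a) (ys a))))
          \<le> length (rev (zip (xs a) (ys a))) * (size (encL e (xs a)) + size (encL e' (ys a)) + 1 + 1)"
        by (rule size_encL_le)
           (auto intro!: add_mono size_le_size_encL elim: in_set_zipE simp: encP_def)
      also have "\<dots> \<le> length (xs a) * (size (encL e (xs a)) + size (encL e' (ys a)) + 1 + 1)"
        by (rule mult_right_mono) auto
      finally show "size (encL (encP e e') (rev (zip (xs a) (ys a)))) \<le> \<dots>" .
    qed
  qed
  from ptime_rev[OF this] show ?thesis by simp
qed

subsection \<open>Numbers\<close>

lemma enc_nat_encL: "enc_nat (length xs) = encL (\<lambda>_. Nl) xs"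
  by (simp add: enc_nat_def encL_def map_replicate_const)

lemma enc_nat_simps [simp]: "enc_nat 0 = Nl" "enc_nat (Suc n) = Cn Nl (enc_nat n)"
  by (simp_all add: enc_nat_def)

lemma size_enc_nat [simp]: "size (enc_nat n) = n"
  by (induction n) auto

text \<open>A unary number is a list of dummies, so arithmetic comes from lists: addition is
  \<open>append\<close>, multiplication is the product, and comparison is
  \<open>drop\<close>.\<close>

lemma ptime_unary_list:
  "ptime X \<mu> i (\<lambda>a. enc_nat (n a)) \<longleftrightarrow> ptime X \<mu> i (\<lambda>a. encL (\<lambda>_. Nl) (replicate (n a) ()))"
  by (simp add: enc_nat_encL[symmetric])

lemma ptime_length:
  assumes "ptime X \<mu> i (\<lambda>a. encL e (xs a))"
  shows "ptime X \<mu> i (\<lambda>a. enc_nat (length (xs a)))"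
proof -
  have "ptime X \<mu> i (\<lambda>a. encL (\<lambda>_. Nl) (map (\<lambda>_. ()) (xs a)))"
    by (rule ptime_map[OF assms ptime_const])
  then show ?thesis by (simp add: enc_nat_encL[symmetric])
qed

lemma ptime_Suc: "ptime X \<mu> i (\<lambda>a. enc_nat (n a)) \<Longrightarrow> ptime X \<mu> i (\<lambda>a. enc_nat (Suc (n a)))"
  by (simp add: ptime_Cn ptime_const)

lemma ptime_add:
  assumes "ptime X \<mu> i (\<lambda>a. enc_nat (m a))" "ptime X \<mu> i (\<lambda>a. enc_nat (n a))"
  shows "ptime X \<mu> i (\<lambda>a. enc_nat (m a + n a))"
  using ptime_length[OF ptime_append[OF assms[unfolded ptime_unary_list]]] by simp

lemma ptime_mult:
  assumes "ptime X \<mu> i (\<lambda>a. enc_nat (m a))" "ptime X \<mu> i (\<lambda>a. enc_nat (n a))"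
  shows "ptime X \<mu> i (\<lambda>a. enc_nat (m a * n a))"
  using ptime_length[OF ptime_product[OF assms[unfolded ptime_unary_list]]] by simp

text \<open>Stated for arbitrary trees without a size bound, because it also reads the answer of the
  approximation algorithm.\<close>

lemma tcomp_tl_pow:
  assumes n: "ptime X \<mu> i (\<lambda>a. enc_nat (n a))" and f: "tcomp X \<mu> i f"
  shows "tcomp X \<mu> i (\<lambda>a. (tl_tree ^^ n a) (f a))"
proof -
  note n' = n[unfolded ptime_unary_list]
  have "tcomp X \<mu> i (\<lambda>a. id (fold (\<lambda>_. tl_tree) (replicate (n a) ()) (f a)))"
    by (rule tcomp_fold[OF ptime_tcomp[OF n'] _ _ pbd_length[OF n']])
       (auto intro!: f tcomp_assign[where e = "TlE (TlE (TlE (Var 0)))"])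
  moreover have "fold (\<lambda>_. tl_tree) (replicate m ()) = tl_tree ^^ m" for m
    by (induction m) (auto simp: funpow_swap1)
  ultimately show ?thesis by simp
qed

lemma tl_pow_encL: "(tl_tree ^^ n) (encL e xs) = encL e (drop n xs)"
proof (induction n)
  case (Suc n)
  have "tl_tree (encL e ys) = encL e (tl ys)" for ys by (cases ys) auto
  with Suc show ?case by (simp add: drop_Suc tl_drop)
qed simp

lemma ptime_drop:
  assumes n: "ptime X \<mu> i (\<lambda>a. enc_nat (n a))" and xs: "ptime X \<mu> i (\<lambda>a. encL e (xs a))"
  shows "ptime X \<mu> i (\<lambda>a. encL e (drop (n a) (xs a)))"
proof (rule ptimeI)
  show "tcomp X \<mu> i (\<lambda>a. encL e (drop (n a) (xs a)))"
    using tcomp_tl_pow[OF n ptime_tcomp[OF xs]] by (simp add: tl_pow_encL)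
  show "pbd X \<mu> (\<lambda>a. size (encL e (drop (n a) (xs a))))"
    by (rule pbd_mono[OF ptime_pbd[OF xs]]) (metis append_take_drop_id size_encL_append le_add2)
qed

lemma ptime_take:
  assumes n: "ptime X \<mu> i (\<lambda>a. enc_nat (n a))" and xs: "ptime X \<mu> i (\<lambda>a. encL e (xs a))"
  shows "ptime X \<mu> i (\<lambda>a. encL e (take (n a) (xs a)))"
proof -
  note z = ptime_zip[OF xs n[unfolded ptime_unary_list]]
  have "ptime X \<mu> i (\<lambda>a. encL e (map fst (zip (xs a) (replicate (n a) ()))))"
    by (rule ptime_map[OF z]) (rule ptime_fst[OF ptime_elem[OF z]])
  then show ?thesis by (simp add: map_fst_zip_take min_def take_all_iff cong: if_cong)
     (erule ptime_cong, auto)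
qed

lemma ptime_le:
  assumes m: "ptime X \<mu> i (\<lambda>a. enc_nat (m a))" and n: "ptime X \<mu> i (\<lambda>a. enc_nat (n a))"
  shows "ptime X \<mu> i (\<lambda>a. enc_bool (m a \<le> n a))"
  using ptime_Nil_eq[OF ptime_drop[OF n m[unfolded ptime_unary_list]]] by simp

lemma ptime_nat_eq:
  assumes "ptime X \<mu> i (\<lambda>a. enc_nat (m a))" and "ptime X \<mu> i (\<lambda>a. enc_nat (n a))"
  shows "ptime X \<mu> i (\<lambda>a. enc_bool (m a = n a))"
  by (rule ptime_cong[OF ptime_conj[OF ptime_le[OF assms] ptime_le[OF assms(2,1)]]])
     (simp add: eq_iff)

lemma ptime_list_eq:
  assumes xs: "ptime X \<mu> i (\<lambda>a. encL enc_bool (xs a))" and ys: "ptime X \<mu> i (\<lambda>a. encL enc_bool (ys a))"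
  shows "ptime X \<mu> i (\<lambda>a. enc_bool (xs a = ys a))"
proof -
  note z = ptime_zip[OF xs ys]
  have "ptime X \<mu> i (\<lambda>a. enc_bool (length (xs a) = length (ys a) \<and>
      (\<forall>p\<in>set (zip (xs a) (ys a)). fst p = snd p)))"
    by (intro ptime_conj ptime_nat_eq ptime_length[OF xs] ptime_length[OF ys] ptime_all[OF z]
        ptime_bool_eq ptime_fst[OF ptime_elem[OF z]] ptime_snd[OF ptime_elem[OF z]])
  then show ?thesis by (simp add: list_eq_iff_zip_eq[of "xs _"] split_beta)
qed

lemma ptime_upt:
  assumes n: "ptime X \<mu> i (\<lambda>a. enc_nat (n a))"
  shows "ptime X \<mu> i (\<lambda>a. encL enc_nat [0..<n a])"
proof -
  note n' = n[unfolded ptime_unary_list]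
  define st where "st = (\<lambda>(_::unit) (j, out). (Suc j, j # out))"
  have st: "fold st (replicate m ()) (0, []) = (m, rev [0..<m])" for m
    by (induction m) (simp_all add: replicate_append_same[symmetric] st_def del: replicate.simps(2))
  let ?E = "encP enc_nat (encL enc_nat)"
  have "tcomp X \<mu> i (\<lambda>a. ?E (fold st (replicate (n a) ()) (0, [])))"
    by (rule tcomp_fold[OF ptime_tcomp[OF n'] _ _ pbd_length[OF n']])
       (auto intro!: tcomp_const tcomp_assign[where e = "ConsE (ConsE NilE (HdE (TlE (TlE (Var 0)))))
          (ConsE (HdE (TlE (TlE (Var 0)))) (TlE (TlE (TlE (Var 0)))))"] simp: st_def)
  from tcomp_tl[OF this[unfolded st]] have "tcomp X \<mu> i (\<lambda>a. encL enc_nat (rev [0..<n a]))"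
    by simp
  then have "ptime X \<mu> i (\<lambda>a. encL enc_nat (rev [0..<n a]))"
  proof (rule ptimeI)
    have "pbd X \<mu> (\<lambda>a. n a * (n a + 1))"
      using ptime_pbd[OF n] by (intro pbd_mult pbd_add pbd_const) auto
    then show "pbd X \<mu> (\<lambda>a. size (encL enc_nat (rev [0..<n a])))"
      by (rule pbd_mono) (rule order_trans[OF size_encL_le], auto intro: less_imp_le)
  qed
  from ptime_rev[OF this] show ?thesis by simp
qed

lemma ptime_odd:
  assumes n: "ptime X \<mu> i (\<lambda>a. enc_nat (n a))"
  shows "ptime X \<mu> i (\<lambda>a. enc_bool (odd (n a)))"
proof (rule ptimeI)
  note n' = n[unfolded ptime_unary_list]
  have "tcomp X \<mu> i (\<lambda>a. enc_bool (fold (\<lambda>_. Not) (replicate (n a) ()) False))"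
  proof (rule tcomp_fold[OF ptime_tcomp[OF n'] _ _ pbd_length[OF n']])
    let ?Y = "{(a, b, y). a \<in> X \<and> b \<in> set (replicate (n a) ())}" and ?\<nu> = "\<lambda>(a, b, y::bool). \<mu> a"
      and ?j = "\<lambda>(a, b::unit, y). Cn (i a) (Cn Nl (enc_bool y))"
    have "tcomp ?Y ?\<nu> ?j (\<lambda>p. enc_bool (snd (snd p)))"
      by (rule tcomp_assign[where e = "TlE (TlE (Var 0))"]) auto
    then have "ptime ?Y ?\<nu> ?j (\<lambda>p. enc_bool (snd (snd p)))"
      by (rule ptimeI) (rule pbd_mono[OF pbd_const[where n = 1]], simp add: enc_bool_def)
    from ptime_tcomp[OF ptime_not[OF this]] show "tcomp ?Y ?\<nu> ?j (\<lambda>(a, b, y). enc_bool (\<not> y))"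
      by (rule tcomp_cong) auto
  qed (rule tcomp_const)
  moreover have "fold (\<lambda>_. Not) (replicate m ()) b = (odd m \<noteq> b)" for m b
    by (induction m arbitrary: b) auto
  ultimately show "tcomp X \<mu> i (\<lambda>a. enc_bool (odd (n a)))" by simp
  show "pbd X \<mu> (\<lambda>a. size (enc_bool (odd (n a))))"
    by (rule pbd_mono[OF pbd_const[where n = 1]]) (simp add: enc_bool_def)
qed

text \<open>The number of lists is multiplied by \<open>length (xs a)\<close> in every round. Only
  an invariant that fixes the accumulator after \<open>j\<close> rounds keeps it below the final
  number.\<close>

lemma ptime_n_lists:
  assumes n: "ptime X \<mu> i (\<lambda>a. enc_nat (n a))" and xs: "ptime X \<mu> i (\<lambda>a. encL e (xs a))"
    and pow: "pbd X \<mu> (\<lambda>a. length (xs a) ^ n a)"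
  shows "ptime X \<mu> i (\<lambda>a. encL (encL e) (List.n_lists (n a) (xs a)))"
proof -
  note n' = n[unfolded ptime_unary_list]
  \<comment> \<open>The \<open>+ 1\<close> next to the power covers \<open>xs a = []\<close>: round
    0 has one list although \<open>0 ^ n a\<close> may be 0.\<close>
  define B where "B = (\<lambda>a. (length (xs a) ^ n a + 1) * (n a * (size (encL e (xs a)) + 1) + 1))"
  have pB: "pbd X \<mu> B"
    unfolding B_def using ptime_pbd[OF n]
    by (intro pbd_mult pbd_add pbd_const pow ptime_pbd[OF xs]) simp
  have B: "size (encL (encL e) (List.n_lists j (xs a))) \<le> B a" if j: "j \<le> n a" for a j
  proof -
    have "size (encL (encL e) (List.n_lists j (xs a)))
        \<le> length (List.n_lists j (xs a)) * (n a * (size (encL e (xs a)) + 1) + 1)"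
    proof (rule size_encL_le)
      fix ys assume ys: "ys \<in> set (List.n_lists j (xs a))"
      have "size (encL e ys) \<le> length ys * (size (encL e (xs a)) + 1)"
        using ys by (intro size_encL_le size_le_size_encL) (auto simp: set_n_lists)
      also have "\<dots> \<le> n a * (size (encL e (xs a)) + 1)"
        using ys j by (intro mult_right_mono) (auto simp: set_n_lists)
      finally show "size (encL e ys) \<le> n a * (size (encL e (xs a)) + 1)" .
    qed
    also have "length (List.n_lists j (xs a)) \<le> length (xs a) ^ n a + 1"
    proof (cases "xs a = []")
      case True
      then show ?thesis by (simp add: length_n_lists power_0_left)
    next
      case False
      then have "1 \<le> length (xs a)" by (simp add: Suc_le_eq One_nat_def)
      then have "length (xs a) ^ j \<le> length (xs a) ^ n a"
        by (rule power_increasing[OF j])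
      then show ?thesis by (simp add: length_n_lists)
    qed
    finally show ?thesis unfolding B_def by (simp add: mult_right_mono)
  qed
  have fold_eq: "fold (\<lambda>_ acc. concat (map (\<lambda>ys. map (\<lambda>y. y # ys) us) acc)) (replicate m ()) [[]]
      = List.n_lists m us" for m and us :: "'b list"
    by (induction m) (simp_all add: replicate_append_same[symmetric] del: replicate.simps(2))
  have "tcomp X \<mu> i (\<lambda>a. encL (encL e) (fold (\<lambda>_ acc. concat (map (\<lambda>ys. map (\<lambda>y. y # ys) (xs a)) acc))
      (replicate (n a) ()) [[]]))"
  proof (rule tcomp_fold_counted[where I = "\<lambda>a j y. y = List.n_lists j (xs a)",
        OF ptime_tcomp[OF n'] _ _ pbd_length[OF n']])
    let ?Y = "{(a, b, y). a \<in> X \<and> b \<in> set (replicate (n a) ()) \<and>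
        (\<exists>j<length (replicate (n a) ()). y = List.n_lists j (xs a))}"
      and ?\<nu> = "\<lambda>(a, b::unit, y::'b list list). \<mu> a"
      and ?j = "\<lambda>(a, b::unit, y). Cn (i a) (Cn Nl (encL (encL e) y))"
    have y: "ptime ?Y ?\<nu> ?j (\<lambda>p. encL (encL e) (snd (snd p)))"
    proof (rule ptimeI)
      show "tcomp ?Y ?\<nu> ?j (\<lambda>p. encL (encL e) (snd (snd p)))"
        by (rule tcomp_assign[where e = "TlE (TlE (Var 0))"]) auto
      have "pbd ?Y ?\<nu> (\<lambda>p. B (fst p))"
        using pB by (rule pbd_reindex) auto
      then show "pbd ?Y ?\<nu> (\<lambda>p. size (encL (encL e) (snd (snd p))))"
        by (rule pbd_mono) (auto intro!: B)
    qed
    have x: "ptime ?Y ?\<nu> ?j (\<lambda>p. encL e (xs (fst p)))"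
    proof (rule ptime_comp[where f = "\<lambda>p. i (fst p)"])
      show "tcomp ?Y ?\<nu> ?j (\<lambda>p. i (fst p))"
        by (rule tcomp_assign[where e = "HdE (Var 0)"]) auto
    qed (rule ptime_reindex[OF xs], auto)
    have "ptime ?Y ?\<nu> ?j (\<lambda>p. encL (encL e)
        (concat (map (\<lambda>ys. map (\<lambda>y. y # ys) (xs (fst p))) (snd (snd p)))))"
      by (intro ptime_concat ptime_map[OF y] ptime_map[OF ptime_outer[OF x]] ptime_Cons
          ptime_elem[OF ptime_outer[OF x]] ptime_outer[OF ptime_elem[OF y]])
    from ptime_tcomp[OF this] show "tcomp ?Y ?\<nu> ?j (\<lambda>(a, b, y). encL (encL e)
        (concat (map (\<lambda>ys. map (\<lambda>y. y # ys) (xs a)) y)))"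
      by (rule tcomp_cong) auto
  qed (auto intro: tcomp_const)
  then show ?thesis
    unfolding fold_eq by (rule ptimeI) (auto intro!: pbd_mono[OF pB] B)
qed

lemma ptime_div:
  assumes m: "ptime X \<mu> i (\<lambda>a. enc_nat (m a))" and n: "ptime X \<mu> i (\<lambda>a. enc_nat (n a))"
    and pos: "\<And>a. a \<in> X \<Longrightarrow> n a > 0"
  shows "ptime X \<mu> i (\<lambda>a. enc_nat (m a div n a))"
proof -
  text \<open>The quotient counts the multiples of \<open>n\<close> in \<open>{1..m}\<close>.\<close>
  have "card {x. x < m \<and> n * Suc x \<le> m} = m div n" if "n > 0" for m n :: nat
  proof -
    have "x < m" if "n * Suc x \<le> m" for x
    proof -
      have "1 * Suc x \<le> n * Suc x" using \<open>n > 0\<close> by (intro mult_right_mono) auto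
      with that have "1 * Suc x \<le> m" by (rule order_trans[rotated])
      then show ?thesis by simp
    qed
    then have "{x. x < m \<and> n * Suc x \<le> m} = {..<m div n}"
      using that by (auto simp: Suc_le_eq[symmetric] less_eq_div_iff_mult_less_eq mult.commute
          simp del: mult_Suc mult_Suc_right)
    then show ?thesis by simp
  qed
  then have *: "length (filter (\<lambda>x. n * Suc x \<le> m) [0..<m]) = m div n" if "n > 0" for m n :: nat
    using that by (simp add: length_filter_conv_card cong: conj_cong)
  note u = ptime_upt[OF m]
  have "ptime X \<mu> i (\<lambda>a. enc_nat (length (filter (\<lambda>x. n a * Suc x \<le> m a) [0..<m a])))"
    by (intro ptime_length[OF ptime_filter[OF u]] ptime_le ptime_mult ptime_Suc ptime_elem[OF u]
        ptime_outer[OF n] ptime_outer[OF m])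
  then show ?thesis by (rule ptime_cong) (simp only: *[OF pos])
qed

section \<open>Toeplitz hashing\<close>

definition inner :: "bool list \<Rightarrow> bool list \<Rightarrow> bool" where
  "inner s r = odd (length (filter (\<lambda>p. fst p \<and> snd p) (zip s r)))"

text \<open>Multiplication over GF(2) by the matrix with entry \<open>r ! (j + t)\<close> in row
  \<open>j\<close> and column \<open>t\<close>, a Toeplitz matrix up to the order of its columns. It
  needs about \<open>length s + h\<close> key bits where an unstructured matrix needs
  \<open>h * length s\<close>; this keeps the number of keys polynomial in
  \<open>2 ^ c\<close>.\<close>

definition hash :: "nat \<Rightarrow> bool list \<Rightarrow> bool list \<Rightarrow> bool list" where
  "hash h r s = map (\<lambda>j. inner s (drop j r)) [0..<h]"

lemma inner_Cons: "inner (x # s) (y # r) = ((x \<and> y) \<noteq> inner s r)"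
  by (auto simp: inner_def)

lemma hash_Suc: "hash (Suc h) (y # r) s = inner s (y # r) # hash h r s"
proof -
  have "[0..<Suc h] = 0 # map Suc [0..<h]" by (simp add: map_Suc_upt upt_conv_Cons del: upt_Suc)
  then show ?thesis by (simp add: hash_def del: upt_Suc)
qed

lemma finite_bits: "finite {r :: bool list. length r = n \<and> P r}"
  by (rule finite_subset[OF _ finite_lists_length_eq[of UNIV n]]) auto

lemma card_bits: "card {r :: bool list. length r = n} = 2 ^ n"
  using card_lists_length_eq[of "UNIV :: bool set" n] by simp

text \<open>The first differing position \<open>t\<close> makes the \<open>j\<close>-th output bit determine \<open>r ! (j + t)\<close> from the
  later bits of \<open>r\<close>.\<close>

lemma hash_collision:
  assumes "length s = length s'" "s \<noteq> s'" "length s + h \<le> n"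
  shows "card {r. length r = n \<and> hash h r s = hash h r s'} * 2 ^ h \<le> 2 ^ n"
  using assms
proof (induction s s' arbitrary: n rule: list_induct2)
  case Nil
  then show ?case by simp
next
  case (Cons x s x' s')
  show ?case
  proof (cases "x = x'")
    case True
    obtain m where n: "n = Suc m" "length s + h \<le> m" using Cons.prems by (cases n) auto
    \<comment> \<open>A common first bit contributes equally to both sides, and what remains is the
      hash under the key without its first bit. That bit is free, whence the factor 2 below.\<close>
    have eq: "hash h (y # r) (x # s) = hash h (y # r) (x # s') \<longleftrightarrow> hash h r s = hash h r s'"
      if "length r = m" for y r
    proof -
      have "inner (x # s) (drop j (y # r)) = inner (x # s') (drop j (y # r)) \<longleftrightarrow>
          inner s (drop j r) = inner s' (drop j r)" if "j < h" for j
      proof -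
        have "drop j (y # r) = (y # r) ! j # drop j r"
          using Cons_nth_drop_Suc[of j "y # r"] that n \<open>length r = m\<close> by simp
        then show ?thesis by (auto simp: inner_Cons)
      qed
      then show ?thesis by (simp add: hash_def)
    qed
    let ?C = "{r. length r = m \<and> hash h r s = hash h r s'}"
    have "{r. length r = n \<and> hash h r (x # s) = hash h r (x # s')} \<subseteq> (\<lambda>(y, r). y # r) ` (UNIV \<times> ?C)"
    proof
      fix r' assume "r' \<in> {r. length r = n \<and> hash h r (x # s) = hash h r (x # s')}"
      then obtain y r where "r' = y # r" "length r = m" "hash h (y # r) (x # s) = hash h (y # r) (x # s')"
        using n(1) by (cases r') auto
      then show "r' \<in> (\<lambda>(y, r). y # r) ` (UNIV \<times> ?C)" using eq by force
    qed
    then have "card {r. length r = n \<and> hash h r (x # s) = hash h r (x # s')} \<le> card ((UNIV :: bool set) \<times> ?C)"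
      by (rule surj_card_le[rotated]) (simp add: finite_bits)
    then have "card {r. length r = n \<and> hash h r (x # s) = hash h r (x # s')} * 2 ^ h \<le> 2 * (card ?C * 2 ^ h)"
      by (simp add: card_cartesian_product)
    also have "\<dots> \<le> 2 * 2 ^ m"
      by (rule mult_left_mono[OF Cons.IH]) (use Cons.prems n True in auto)
    finally show ?thesis using True n by simp
  next
    case False
    have hn: "h \<le> n" using Cons.prems(2) by simp
    show "card {r. length r = n \<and> hash h r (x # s) = hash h r (x' # s')} * 2 ^ h \<le> 2 ^ n"
      using hn
    proof (induction h arbitrary: n)
      case 0
      then show ?case using card_bits[of n] by (simp add: hash_def)
    next
      case (Suc h)
      obtain m where n: "n = Suc m" "h \<le> m" using Suc.prems by (cases n) auto
      let ?A = "{r. length r = n \<and> hash (Suc h) r (x # s) = hash (Suc h) r (x' # s')}"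
      let ?B = "{r. length r = m \<and> hash h r (x # s) = hash h r (x' # s')}"
      have A: "r = (inner s (tl r) \<noteq> inner s' (tl r)) # tl r \<and> tl r \<in> ?B" if "r \<in> ?A" for r
      proof (cases r)
        case (Cons y \<rho>)
        have "length \<rho> = m" "inner (x # s) (y # \<rho>) = inner (x' # s') (y # \<rho>)"
          "hash h \<rho> (x # s) = hash h \<rho> (x' # s')"
          using that n(1) unfolding Cons by (simp_all add: hash_Suc)
        then show ?thesis
          unfolding Cons using False by (cases x; cases x') (auto simp: inner_Cons)
      qed (use that n(1) in simp)
      have "card ?A \<le> card ?B"
      proof (rule card_inj_on_le[where f = tl])
        show "inj_on tl ?A"
        proof (rule inj_onI)
          fix r r' assume r: "r \<in> ?A" "r' \<in> ?A" "tl r = tl r'"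
          define G where "G \<rho> = (inner s \<rho> \<noteq> inner s' \<rho>) # \<rho>" for \<rho>
          have "r = G (tl r)" unfolding G_def using A[OF r(1)] by (rule conjunct1)
          also have "tl r = tl r'" by (rule r(3))
          also have "G (tl r') = r'" unfolding G_def using A[OF r(2)] by (rule conjunct1[THEN sym])
          finally show "r = r'" .
        qed
        show "tl ` ?A \<subseteq> ?B" by (rule image_subsetI, rule conjunct2[OF A])
      qed (rule finite_bits)
      then have "card ?A * 2 ^ Suc h \<le> card ?B * 2 ^ Suc h" by (rule mult_right_mono) simp
      then have "card ?A * 2 ^ Suc h \<le> 2 * (card ?B * 2 ^ h)" unfolding power_Suc by (simp only: ac_simps)
      also have "\<dots> \<le> 2 * 2 ^ m" by (rule mult_left_mono[OF Suc.IH[OF n(2)]]) simp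
      finally show ?case unfolding n(1) power_Suc .
    qed
  qed
qed

section \<open>The reduction\<close>

text \<open>With three occurrences per variable there are at most \<open>3 * n + 1\<close> clauses,
  so \<open>k\<close> chunks of \<open>3 * c\<close> clauses suffice once
  \<open>k * c \<ge> n + 1\<close>. A chunk then has at most \<open>9 * c\<close> variable
  occurrences, the source of the key length \<open>9 * c + h\<close>.\<close>

definition chunk :: "cnf \<Rightarrow> nat \<Rightarrow> nat \<Rightarrow> cnf" where
  "chunk F c i = take (3 * c) (drop (i * (3 * c)) F)"

definition vars :: "cnf \<Rightarrow> nat \<Rightarrow> nat \<Rightarrow> nat list" where
  "vars F c i = map snd (concat (chunk F c i))"

definition shared :: "cnf \<Rightarrow> nat \<Rightarrow> nat \<Rightarrow> nat \<Rightarrow> nat list" where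
  "shared F c a b = filter (\<lambda>x. x \<in> set (vars F c b)) (vars F c a)"

definition sat_by :: "nat list \<Rightarrow> cnf \<Rightarrow> bool" where
  "sat_by w C \<longleftrightarrow> (\<forall>cl\<in>set C. \<exists>q\<in>set cl. (snd q \<in> set w) = fst q)"

text \<open>\<open>vars\<close> may repeat a variable; it then counts as true if one of its
  occurrences is marked, so every bit vector still denotes an assignment.\<close>

definition assignments :: "cnf \<Rightarrow> nat \<Rightarrow> nat \<Rightarrow> nat list list" where
  "assignments F c i = filter (\<lambda>w. sat_by w (chunk F c i))
     (map (\<lambda>bs. map fst (filter snd (zip (vars F c i) bs))) (List.n_lists (length (vars F c i)) [True, False]))"

text \<open>A label \<open>(i, w)\<close> is an assignment of the variables of chunk \<open>i\<close>, given as the list of its true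
  variables.\<close>

definition labels :: "cnf \<Rightarrow> nat \<Rightarrow> nat \<Rightarrow> (nat \<times> nat list) list" where
  "labels F k c = concat (map (\<lambda>i. map (\<lambda>w. (i, w)) (assignments F c i)) [0..<k])"

text \<open>The order of the shared variables is that of the first chunk of the pair for labels of
  either chunk, which makes their patterns comparable.\<close>

definition pattern :: "cnf \<Rightarrow> nat \<Rightarrow> nat list \<Rightarrow> nat \<times> nat \<Rightarrow> bool list" where
  "pattern F c w ab = map (\<lambda>x. x \<in> set w) (shared F c (fst ab) (snd ab))"

text \<open>A guess lists, for each pair of chunks, a hash value of the assignment of the shared variables.\<close>

definition guesses :: "nat \<Rightarrow> nat \<Rightarrow> bool list list list" where
  "guesses k h = List.n_lists (k * k) (List.n_lists h [True, False])"

text \<open>The labels of \<open>a\<close> and of \<open>b\<close> are both tested against the same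
  entry of \<open>u\<close> at \<open>(a, b)\<close>. Hence agreement of one label per chunk with a
  common guess gives all pairwise matches, although each test involves a single label.\<close>

definition agrees :: "cnf \<Rightarrow> nat \<Rightarrow> nat \<Rightarrow> nat \<Rightarrow> bool list \<Rightarrow> nat \<times> nat list \<Rightarrow> bool list list \<Rightarrow> bool" where
  "agrees F k c h r p u \<longleftrightarrow> (\<forall>q\<in>set (zip (List.product [0..<k] [0..<k]) u).
     (fst (fst q) = fst p \<or> snd (fst q) = fst p) \<longrightarrow> hash h r (pattern F c (snd p) (fst q)) = snd q)"

text \<open>An element \<open>(r, f)\<close> consists of a hash key and a function \<open>f\<close> from the guesses to the chunks, as
  in Feige's hypercube gadget.\<close>

definition elems :: "nat \<Rightarrow> nat \<Rightarrow> nat \<Rightarrow> (bool list \<times> nat list) list" where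
  "elems k c h = List.product (List.n_lists (9 * c + h) [True, False])
     (List.n_lists (length (guesses k h)) [0..<k])"

text \<open>The incidence relation of a set cover instance, with labels as sets and elements as
  points.\<close>

definition covers :: "cnf \<Rightarrow> nat \<Rightarrow> nat \<Rightarrow> nat \<Rightarrow> nat \<times> nat list \<Rightarrow> bool list \<times> nat list \<Rightarrow> bool" where
  "covers F k c h p e \<longleftrightarrow>
     (\<exists>q\<in>set (zip (guesses k h) (snd e)). snd q = fst p \<and> agrees F k c h (fst e) p (fst q))"

text \<open>Labels of different chunks are adjacent, so labels from two chunks dominate all labels
  and only the elements remain to be covered. Elements are pairwise non-adjacent, so an element is
  dominated only by itself or by a label covering it.\<close>

definition matrix :: "cnf \<Rightarrow> nat \<Rightarrow> nat \<Rightarrow> nat \<Rightarrow> bool list list" where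
  "matrix F k c h =
     map (\<lambda>p. map (\<lambda>q. fst p \<noteq> fst q) (labels F k c) @ map (\<lambda>e. covers F k c h p e) (elems k c h)) (labels F k c) @
     map (\<lambda>e. map (\<lambda>p. covers F k c h p e) (labels F k c) @ map (\<lambda>_. False) (elems k c h)) (elems k c h)"

section \<open>Boolean matrices as adjacency matrices of graphs\<close>

definition graph_of :: "bool list list \<Rightarrow> nat set set" where
  "graph_of M = {{v, u} |v u. v < length M \<and> u < length M \<and> M ! v ! u}"

definition adjacency :: "bool list list \<Rightarrow> bool" where
  "adjacency M \<longleftrightarrow> (\<forall>v<length M. length (M ! v) = length M \<and> \<not> M ! v ! v \<and> (\<forall>u<length M. M ! v ! u = M ! u ! v))"

lemma mem_graph_of: "adjacency M \<Longrightarrow> v < length M \<Longrightarrow> u < length M \<Longrightarrow> {v, u} \<in> graph_of M \<longleftrightarrow> M ! v ! u"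
  unfolding graph_of_def adjacency_def by (auto simp: doubleton_eq_iff)

lemma graph_graph_of:
  assumes "adjacency M"
  shows "graph (length M) (graph_of M)"
  unfolding graph_def
proof
  fix e assume "e \<in> graph_of M"
  then obtain v u where e: "e = {v, u}" "v < length M" "u < length M" "M ! v ! u"
    unfolding graph_of_def by blast
  then have "v \<noteq> u" using assms unfolding adjacency_def by blast
  then show "e \<subseteq> {..<length M} \<and> card e = 2" using e by simp
qed

lemma enc_graph_graph_of:
  assumes "adjacency M"
  shows "enc_graph (length M) (graph_of M) = encL (encL enc_bool) M"
proof -
  have "map (\<lambda>v. enc_set (length M) {u. {v, u} \<in> graph_of M}) [0..<length M] = map (encL enc_bool) M"
  proof (rule nth_equalityI)
    fix v assume "v < length (map (\<lambda>v. enc_set (length M) {u. {v, u} \<in> graph_of M}) [0..<length M])"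
    then have v: "v < length M" by simp
    have "map (\<lambda>u. enc_bool (u \<in> {u. {v, u} \<in> graph_of M})) [0..<length M] = map enc_bool (M ! v)"
      using assms v by (intro nth_equalityI) (auto simp: mem_graph_of adjacency_def)
    then show "map (\<lambda>v. enc_set (length M) {u. {v, u} \<in> graph_of M}) [0..<length M] ! v = map (encL enc_bool) M ! v"
      using v by (simp add: enc_set_def encL_def)
  qed simp
  then show ?thesis by (simp add: enc_graph_def encL_def)
qed

lemma length_matrix: "length (matrix F k c h) = length (labels F k c) + length (elems k c h)"
  by (simp add: matrix_def)

lemma matrix_nth:
  fixes F k c h
  defines "L \<equiv> labels F k c" and "E \<equiv> elems k c h"
  assumes "v < length L + length E" "u < length L + length E"
  shows "matrix F k c h ! v ! u =
    (if v < length L then if u < length L then fst (L ! v) \<noteq> fst (L ! u) else covers F k c h (L ! v) (E ! (u - length L))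
     else u < length L \<and> covers F k c h (L ! u) (E ! (v - length L)))"
  using assms by (auto simp: matrix_def nth_append)

lemma adjacency_matrix: "adjacency (matrix F k c h)"
  unfolding adjacency_def
proof (intro allI impI conjI)
  fix v assume v: "v < length (matrix F k c h)"
  show "length (matrix F k c h ! v) = length (matrix F k c h)"
    using v by (auto simp: matrix_def nth_append)
  show "\<not> matrix F k c h ! v ! v" using v by (simp add: length_matrix matrix_nth)
  fix u assume "u < length (matrix F k c h)"
  with v show "matrix F k c h ! v ! u = matrix F k c h ! u ! v"
    unfolding length_matrix by (simp add: matrix_nth) (intro impI eq_commute)
qed

section \<open>Completeness: satisfiable formulae give small dominating sets\<close>

lemma in_labels_iff:
  "(i, w) \<in> set (labels F k c) \<longleftrightarrow> i < k \<and> sat_by w (chunk F c i) \<and>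
     (\<exists>bs. length bs = length (vars F c i) \<and> w = map fst (filter snd (zip (vars F c i) bs)))"
  by (auto simp: labels_def assignments_def set_n_lists image_iff)

lemma in_guesses_iff: "u \<in> set (guesses k h) \<longleftrightarrow> length u = k * k \<and> (\<forall>s\<in>set u. length s = h)"
  by (auto simp: guesses_def set_n_lists subset_iff)

lemma in_elems_iff: "(r, f) \<in> set (elems k c h) \<longleftrightarrow>
    length r = 9 * c + h \<and> length f = length (guesses k h) \<and> (\<forall>i\<in>set f. i < k)"
  by (auto simp: elems_def set_n_lists subset_iff)

text \<open>A satisfying assignment restricts to one label per chunk. For an element
  \<open>(r, f)\<close> the guess \<open>u\<close> of the true hash values agrees with all these
  labels, in particular with the label of the chunk that \<open>f\<close> assigns to
  \<open>u\<close>; that label covers the element.\<close>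

lemma matrix_dominating_set_exists:
  assumes "satisfiable F" "k \<ge> 2"
  shows "\<exists>D. dominating_set (length (matrix F k c h)) (graph_of (matrix F k c h)) D \<and> card D \<le> k"
proof -
  let ?L = "labels F k c" and ?E = "elems k c h" and ?M = "matrix F k c h"
  from assms(1) obtain val where val: "\<forall>cl\<in>set F. \<exists>(b, i)\<in>set cl. val i = b"
    unfolding satisfiable_def by blast
  define w where "w i = filter val (vars F c i)" for i
  have w: "(i, w i) \<in> set ?L" if "i < k" for i
  proof -
    have "filter val us = map fst (filter snd (zip us (map val us)))" for us
      by (induction us) auto
    then have 1: "\<exists>bs. length bs = length (vars F c i) \<and> w i = map fst (filter snd (zip (vars F c i) bs))"
      unfolding w_def by (metis length_map)
    have "sat_by (w i) (chunk F c i)"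
      unfolding sat_by_def
    proof
      fix cl assume cl: "cl \<in> set (chunk F c i)"
      then have "cl \<in> set F" unfolding chunk_def by (metis in_set_dropD in_set_takeD)
      with val obtain q where q: "q \<in> set cl" "val (snd q) = fst q" by force
      then have "snd q \<in> set (vars F c i)" using cl by (auto simp: vars_def image_iff)
      then show "\<exists>q\<in>set cl. (snd q \<in> set (w i)) = fst q" using q by (auto simp: w_def)
    qed
    with 1 that show ?thesis by (simp add: in_labels_iff)
  qed
  then have "\<forall>i\<in>{..<k}. \<exists>v<length ?L. ?L ! v = (i, w i)" by (auto simp: in_set_conv_nth)
  then obtain v where v: "\<And>i. i < k \<Longrightarrow> v i < length ?L" "\<And>i. i < k \<Longrightarrow> ?L ! v i = (i, w i)"
    unfolding bchoice_iff by auto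
  define D where "D = v ` {..<k}"
  have "\<exists>u\<in>D. {u, x} \<in> graph_of ?M" if x: "x < length ?M" for x
  proof -
    have "\<exists>i<k. ?M ! v i ! x"
    proof (cases "x < length ?L")
      case True
      \<comment> \<open>A label is dominated from any chunk other than its own; such a chunk exists
        because \<open>k \<ge> 2\<close>.\<close>
      define i where "i = (if fst (?L ! x) = 0 then 1 else 0 :: nat)"
      have "i < k" "i \<noteq> fst (?L ! x)" using assms(2) by (auto simp: i_def)
      then show ?thesis using v True by (intro exI[of _ i]) (simp add: matrix_nth length_matrix trans_less_add1)
    next
      case False
      define e where "e = ?E ! (x - length ?L)"
      have "e \<in> set ?E" using x False by (auto simp: e_def length_matrix)
      then obtain r f where e: "e = (r, f)" "length f = length (guesses k h)" "\<forall>i\<in>set f. i < k"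
        by (metis in_elems_iff prod.exhaust)
      define u where "u = map (\<lambda>ab. hash h r (map val (shared F c (fst ab) (snd ab)))) (List.product [0..<k] [0..<k])"
      have "u \<in> set (guesses k h)" by (auto simp: in_guesses_iff u_def hash_def)
      then obtain t where t: "t < length (guesses k h)" "guesses k h ! t = u" by (auto simp: in_set_conv_nth)
      define i where "i = f ! t"
      have ik: "i < k" using t e by (auto simp: i_def)
      have pat: "pattern F c (w i) ab = map val (shared F c (fst ab) (snd ab))" if "fst ab = i \<or> snd ab = i" for ab
        using that by (auto simp: pattern_def shared_def w_def)
      have "agrees F k c h r (i, w i) u"
        unfolding agrees_def u_def by (auto simp: zip_map2 zip_same_conv_map pat)
      moreover have "(u, i) \<in> set (zip (guesses k h) f)"
        using t e by (auto simp: in_set_zip i_def)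
      ultimately have "covers F k c h (i, w i) e" unfolding covers_def e by force
      then show ?thesis using ik v x False
        by (intro exI[of _ i]) (simp add: matrix_nth length_matrix trans_less_add1 e_def)
    qed
    then obtain i where i: "i < k" "?M ! v i ! x" by blast
    then have "{v i, x} \<in> graph_of ?M"
      using mem_graph_of[OF adjacency_matrix, of "v i" F k c h x] v(1)[OF i(1)] x by (simp add: length_matrix)
    then show ?thesis using i(1) by (auto simp: D_def)
  qed
  moreover have "D \<subseteq> {..<length ?M}" using v(1) by (auto simp: D_def length_matrix trans_less_add1)
  moreover have "card D \<le> k" unfolding D_def using card_image_le[of "{..<k}" v] by simp
  ultimately show ?thesis unfolding dominating_set_def by blast
qed

section \<open>Soundness: small dominating sets give satisfying assignments\<close>

lemma length_vars:
  assumes "\<forall>cl\<in>set F. length cl \<le> 3"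
  shows "length (vars F c i) \<le> 9 * c"
proof -
  have "length (concat C) \<le> length C * 3" if "\<forall>cl\<in>set C. length cl \<le> 3" for C :: cnf
    using that by (induction C) auto
  then have "length (concat (chunk F c i)) \<le> length (chunk F c i) * 3"
    using assms by (metis chunk_def in_set_dropD in_set_takeD)
  then show ?thesis by (simp add: vars_def chunk_def)
qed

lemma in_chunk:
  assumes "cl \<in> set F" "length F \<le> 3 * k * c"
  shows "\<exists>i<k. cl \<in> set (chunk F c i)"
proof -
  from assms(1) obtain j where j: "j < length F" "F ! j = cl" by (auto simp: in_set_conv_nth)
  have c: "3 * c > 0" using assms j by (cases c) auto
  have jm: "j = j div (3 * c) * (3 * c) + j mod (3 * c)" by (rule div_mult_mod_eq[symmetric])
  have "j div (3 * c) < k"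
    using j assms(2) c by (simp add: div_less_iff_less_mult mult.assoc mult.left_commute)
  moreover have "j mod (3 * c) < 3 * c" using c by (rule mod_less_divisor)
  then have "chunk F c (j div (3 * c)) ! (j mod (3 * c)) = cl" "j mod (3 * c) < length (chunk F c (j div (3 * c)))"
    using j jm by (auto simp: chunk_def)
  ultimately show ?thesis using nth_mem by metis
qed

text \<open>A union bound yields a key \<open>r\<close> that separates the patterns of the labels in
  \<open>D\<close> and is the key of no element in \<open>D\<close>. Under this key some guess is
  met in every chunk by a label in \<open>D\<close>; such labels agree on shared variables and can
  be glued together.\<close>

lemma small_dominating_set_imp_satisfiable:
  assumes dom: "dominating_set (length (matrix F k c (3 * l))) (graph_of (matrix F k c (3 * l))) D"
    and card: "card D \<le> 2 ^ l" and l: "l \<ge> 1" and c: "c \<ge> 1" and k: "k \<ge> 1"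
    and len: "\<forall>cl\<in>set F. length cl \<le> 3" and F: "length F \<le> 3 * k * c"
  shows "satisfiable F"
proof -
  let ?h = "3 * l"
  let ?L = "labels F k c" and ?E = "elems k c ?h" and ?M = "matrix F k c ?h" and ?R = "9 * c + ?h"
  have D: "D \<subseteq> {..<length ?M}" "\<And>x. x < length ?M \<Longrightarrow> x \<notin> D \<Longrightarrow> \<exists>u\<in>D. {u, x} \<in> graph_of ?M"
    using dom unfolding dominating_set_def by auto
  have finD: "finite D" using D(1) finite_subset by blast
  define DL where "DL = {p. \<exists>v\<in>D. v < length ?L \<and> p = ?L ! v}"
  have DL: "DL \<subseteq> (!) ?L ` D" by (auto simp: DL_def)
  then have finDL: "finite DL" and cardDL: "card DL \<le> 2 ^ l"
    using finD card card_image_le[OF finD, of "(!) ?L"] card_mono[OF finite_imageI[OF finD] DL]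
    by (auto intro: finite_subset)
  \<comment> \<open>For a label vertex the truncated subtraction gives index 0, which at worst
    excludes one more key; the bound \<open>card D\<close> on the size of \<open>N\<close> holds all
    the same.\<close>
  define N where "N = (\<lambda>v. fst (?E ! (v - length ?L))) ` D"
  define C where "C p q = {r. length r = ?R \<and>
      pattern F c (snd p) (fst p, fst q) \<noteq> pattern F c (snd q) (fst p, fst q) \<and>
      hash ?h r (pattern F c (snd p) (fst p, fst q)) = hash ?h r (pattern F c (snd q) (fst p, fst q))}" for p q
  have cardC: "card (C p q) * 2 ^ ?h \<le> 2 ^ ?R" for p q
  proof (cases "pattern F c (snd p) (fst p, fst q) = pattern F c (snd q) (fst p, fst q)")
    case False
    have "length (shared F c (fst p) (fst q)) \<le> 9 * c"
      unfolding shared_def by (rule order_trans[OF length_filter_le length_vars[OF len]])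
    then show ?thesis using hash_collision[of _ _ ?h ?R] False by (simp add: C_def pattern_def)
  qed (simp add: C_def)
  have "\<exists>r. length r = ?R \<and> r \<notin> N \<and> (\<forall>p\<in>DL. \<forall>q\<in>DL. r \<notin> C p q)"
  proof (rule ccontr)
    assume "\<not> ?thesis"
    then have "{r. length r = ?R} \<subseteq> N \<union> (\<Union>pq\<in>DL \<times> DL. C (fst pq) (snd pq))" by auto
    moreover have fin: "finite N" "\<And>p q. finite (C p q)" using finD finite_bits by (auto simp: N_def C_def)
    ultimately have "2 ^ ?R \<le> card (N \<union> (\<Union>pq\<in>DL \<times> DL. C (fst pq) (snd pq)))"
      unfolding card_bits[symmetric] by - (rule card_mono, use finDL in auto)
    also have "\<dots> \<le> card N + card (\<Union>pq\<in>DL \<times> DL. C (fst pq) (snd pq))" by (rule card_Un_le)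
    also have "\<dots> \<le> 2 ^ l + (\<Sum>pq\<in>DL \<times> DL. card (C (fst pq) (snd pq)))"
      using card_image_le[OF finD, of "\<lambda>v. fst (?E ! (v - length ?L))"] card
      by (intro add_mono card_UN_le finite_cartesian_product finDL) (auto simp: N_def)
    \<comment> \<open>Multiplied through by \<open>2 ^ ?h\<close>, so that the collision bound
      applies without division.\<close>
    finally have "2 ^ ?R * 2 ^ ?h \<le> (2 ^ l + (\<Sum>pq\<in>DL \<times> DL. card (C (fst pq) (snd pq)))) * 2 ^ ?h"
      by (rule mult_right_mono) simp
    also have "\<dots> = 2 ^ l * 2 ^ ?h + (\<Sum>pq\<in>DL \<times> DL. card (C (fst pq) (snd pq)) * 2 ^ ?h)"
      by (simp add: algebra_simps sum_distrib_left)
    also have "(\<Sum>pq\<in>DL \<times> DL. card (C (fst pq) (snd pq)) * 2 ^ ?h) \<le> (\<Sum>pq\<in>DL \<times> DL. 2 ^ ?R)"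
      by (intro sum_mono cardC)
    also have "(\<Sum>pq\<in>DL \<times> DL. 2 ^ ?R) = card DL * card DL * 2 ^ ?R"
      by (simp add: card_cartesian_product)
    also have "card DL * card DL * 2 ^ ?R \<le> 2 ^ l * 2 ^ l * 2 ^ ?R"
      by (intro mult_mono cardDL) auto
    finally have "(2::nat) ^ (?R + ?h) \<le> 2 ^ (l + ?h) + 2 ^ (2 * l + ?R)"
      by (simp only: mult_2[of l] power_add[of 2 ?R ?h] power_add[of 2 l ?h] power_add[of 2 "l + l" ?R]
          power_add[of 2 l l])
    \<comment> \<open>The first summand is below half of the left side and the second at most half:
      \<open>3 * l\<close> hash bits beat \<open>2 ^ (2 * l)\<close> pairs as soon as
      \<open>l \<ge> 1\<close>.\<close>
    moreover have "(2::nat) ^ (l + ?h) < 2 ^ (?R + ?h - 1)"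
      by (rule power_strict_increasing) (use l c in linarith, simp)
    moreover have "(2::nat) ^ (2 * l + ?R) \<le> 2 ^ (?R + ?h - 1)"
      by (rule power_increasing) (use l in linarith, simp)
    moreover have "(2::nat) ^ (?R + ?h) = 2 * 2 ^ (?R + ?h - 1)"
      unfolding power_Suc[symmetric] by (rule arg_cong[where f = "(^) 2"]) (use l in linarith)
    ultimately show False by linarith
  qed
  then obtain r where r: "length r = ?R" "r \<notin> N" "\<And>p q. p \<in> DL \<Longrightarrow> q \<in> DL \<Longrightarrow> r \<notin> C p q" by blast
  have "\<exists>u\<in>set (guesses k ?h). \<forall>i<k. \<exists>w. (i, w) \<in> DL \<and> agrees F k c ?h r (i, w) u"
  proof (rule ccontr)
    assume "\<not> ?thesis"
    then have "\<forall>u\<in>set (guesses k ?h). \<exists>i. i < k \<and> (\<forall>w. (i, w) \<in> DL \<longrightarrow> \<not> agrees F k c ?h r (i, w) u)" by blast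
    then obtain g where g: "\<And>u. u \<in> set (guesses k ?h) \<Longrightarrow> g u < k"
      "\<And>u w. u \<in> set (guesses k ?h) \<Longrightarrow> (g u, w) \<in> DL \<Longrightarrow> \<not> agrees F k c ?h r (g u, w) u"
      unfolding bchoice_iff by blast
    \<comment> \<open>Every guess is sent to a chunk where no label in \<open>D\<close> agrees with
      it, so no label in \<open>D\<close> covers \<open>e\<close>. As the key of \<open>e\<close>
      avoids \<open>N\<close>, the vertex of \<open>e\<close> is not in \<open>D\<close>
      either.\<close>
    define e where "e = (r, map g (guesses k ?h))"
    have "e \<in> set ?E" using g(1) r(1) by (auto simp: e_def in_elems_iff)
    then obtain t where t: "t < length ?E" "?E ! t = e" by (auto simp: in_set_conv_nth)
    define x where "x = length ?L + t"
    have x: "x < length ?M" using t by (simp add: x_def length_matrix)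
    have "x \<notin> D"
    proof
      assume "x \<in> D"
      then have "fst (?E ! (x - length ?L)) \<in> N" by (auto simp: N_def)
      then show False using r(2) t by (simp add: x_def e_def)
    qed
    then obtain v where v: "v \<in> D" "{v, x} \<in> graph_of ?M" using D(2)[OF x] by blast
    have vM: "v < length ?M" using v(1) D(1) by auto
    have "?M ! v ! x" using v(2) mem_graph_of[OF adjacency_matrix vM x] by simp
    then have vL: "v < length ?L" and cov: "covers F k c ?h (?L ! v) e"
      using vM x t by (auto simp: matrix_nth length_matrix x_def split: if_splits)
    obtain i w where iw: "?L ! v = (i, w)" by (cases "?L ! v")
    have DLv: "(i, w) \<in> DL" using v(1) vL iw by (auto simp: DL_def intro!: bexI[of _ v])
    from cov obtain u i' where u: "(u, i') \<in> set (zip (guesses k ?h) (map g (guesses k ?h)))"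
      "i' = i" "agrees F k c ?h r (i, w) u"
      by (auto simp: covers_def e_def iw)
    have "u \<in> set (guesses k ?h)" "g u = i"
      using u(1,2) by (auto simp: zip_map2 zip_same_conv_map)
    then show False using g(2)[of u w] DLv u(3) by simp
  qed
  then obtain u where u: "u \<in> set (guesses k ?h)"
    "\<forall>i\<in>{..<k}. \<exists>w. (i, w) \<in> DL \<and> agrees F k c ?h r (i, w) u" by auto
  then obtain w where w: "\<And>i. i < k \<Longrightarrow> (i, w i) \<in> DL" "\<And>i. i < k \<Longrightarrow> agrees F k c ?h r (i, w i) u"
    unfolding bchoice_iff by auto
  have eq: "x \<in> set (w a) \<longleftrightarrow> x \<in> set (w b)"
    if "a < k" "b < k" "x \<in> set (vars F c a)" "x \<in> set (vars F c b)" for a b x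
  proof -
    let ?P = "List.product [0..<k] [0..<k]"
    have "(a, b) \<in> set ?P" using that by simp
    then obtain t where t: "t < length ?P" "?P ! t = (a, b)" by (metis in_set_conv_nth)
    have z: "((a, b), u ! t) \<in> set (zip ?P u)"
      using t u(1) by (auto simp: in_set_zip in_guesses_iff)
    have "hash ?h r (pattern F c (w a) (a, b)) = u ! t" "hash ?h r (pattern F c (w b) (a, b)) = u ! t"
      using bspec[OF w(2)[OF that(1), unfolded agrees_def] z] bspec[OF w(2)[OF that(2), unfolded agrees_def] z]
      by simp_all
    then have "pattern F c (w a) (a, b) = pattern F c (w b) (a, b)"
      using r(3)[OF w(1)[OF that(1)] w(1)[OF that(2)]] r(1) by (auto simp: C_def)
    then show ?thesis using that by (simp add: pattern_def shared_def map_eq_conv)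
  qed
  define val where "val x \<longleftrightarrow> (\<exists>a<k. x \<in> set (vars F c a) \<and> x \<in> set (w a))" for x
  have val: "val x \<longleftrightarrow> x \<in> set (w a)" if "a < k" "x \<in> set (vars F c a)" for a x
    using that eq unfolding val_def by blast
  show ?thesis unfolding satisfiable_def
  proof (intro exI[of _ val] ballI)
    fix cl assume "cl \<in> set F"
    then obtain a where a: "a < k" "cl \<in> set (chunk F c a)" using in_chunk[OF _ F] by blast
    have "(a, w a) \<in> set ?L" using w(1)[OF a(1)] by (auto simp: DL_def)
    then have "sat_by (w a) (chunk F c a)" by (simp add: in_labels_iff)
    then obtain q where q: "q \<in> set cl" "(snd q \<in> set (w a)) = fst q" using a(2) unfolding sat_by_def by blast
    have "snd q \<in> set (vars F c a)" using q(1) a(2) by (auto simp: vars_def image_iff)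
    then have "val (snd q) = fst q" using q(2) val[OF a(1)] by simp
    then show "\<exists>(b, i)\<in>set cl. val i = b" using q(1) by (intro bexI[of _ q]) (simp_all add: split_beta)
  qed
qed

section \<open>The reduction runs in polynomial time\<close>

lemma length_two: "length [True, False] = 2"
  by simp

abbreviation encF :: "cnf \<Rightarrow> tree" where
  "encF \<equiv> encL (encL (encP enc_bool enc_nat))"

lemma ptime_mem:
  assumes x: "ptime X \<mu> i (\<lambda>a. enc_nat (x a))" and xs: "ptime X \<mu> i (\<lambda>a. encL enc_nat (xs a))"
  shows "ptime X \<mu> i (\<lambda>a. enc_bool (x a \<in> set (xs a)))"
proof -
  have "ptime X \<mu> i (\<lambda>a. enc_bool (\<exists>y\<in>set (xs a). y = x a))"
    by (intro ptime_ex[OF xs] ptime_nat_eq ptime_elem[OF xs] ptime_outer[OF x])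
  then show ?thesis by simp
qed

lemma ptime_chunk:
  assumes "ptime X \<mu> i (\<lambda>a. encF (F a))" "ptime X \<mu> i (\<lambda>a. enc_nat (c a))" "ptime X \<mu> i (\<lambda>a. enc_nat (j a))"
  shows "ptime X \<mu> i (\<lambda>a. encF (chunk (F a) (c a) (j a)))"
  unfolding chunk_def by (intro ptime_take ptime_drop ptime_mult ptime_const assms)

lemma ptime_vars:
  assumes "ptime X \<mu> i (\<lambda>a. encF (F a))" "ptime X \<mu> i (\<lambda>a. enc_nat (c a))" "ptime X \<mu> i (\<lambda>a. enc_nat (j a))"
  shows "ptime X \<mu> i (\<lambda>a. encL enc_nat (vars (F a) (c a) (j a)))"
proof -
  note ch = ptime_concat[OF ptime_chunk[OF assms]]
  show ?thesis
    unfolding vars_def by (rule ptime_map[OF ch]) (rule ptime_snd[OF ptime_elem[OF ch]])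
qed

lemma ptime_shared:
  assumes "ptime X \<mu> i (\<lambda>a. encF (F a))" "ptime X \<mu> i (\<lambda>a. enc_nat (c a))"
    "ptime X \<mu> i (\<lambda>a. enc_nat (j a))" "ptime X \<mu> i (\<lambda>a. enc_nat (j' a))"
  shows "ptime X \<mu> i (\<lambda>a. encL enc_nat (shared (F a) (c a) (j a) (j' a)))"
proof -
  note v = ptime_vars[OF assms(1,2,3)] and v' = ptime_vars[OF assms(1,2,4)]
  show ?thesis unfolding shared_def
    by (intro ptime_filter[OF v] ptime_mem ptime_elem[OF v] ptime_outer[OF v'])
qed

lemma ptime_sat_by:
  assumes w: "ptime X \<mu> i (\<lambda>a. encL enc_nat (w a))" and C: "ptime X \<mu> i (\<lambda>a. encF (C a))"
  shows "ptime X \<mu> i (\<lambda>a. enc_bool (sat_by (w a) (C a)))"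
proof -
  note cl = ptime_elem[OF C] and w1 = ptime_outer[OF w]
  show ?thesis unfolding sat_by_def
    by (intro ptime_all[OF C] ptime_ex[OF cl] ptime_bool_eq ptime_mem ptime_snd[OF ptime_elem[OF cl]]
        ptime_fst[OF ptime_elem[OF cl]] ptime_outer[OF w1])
qed

lemma ptime_assignments:
  assumes F: "ptime X \<mu> i (\<lambda>a. encF (F a))" and c: "ptime X \<mu> i (\<lambda>a. enc_nat (c a))"
    and j: "ptime X \<mu> i (\<lambda>a. enc_nat (j a))" and pow: "pbd X \<mu> (\<lambda>a. 2 ^ (9 * c a))"
    and len: "\<And>a. a \<in> X \<Longrightarrow> \<forall>cl\<in>set (F a). length cl \<le> 3"
  shows "ptime X \<mu> i (\<lambda>a. encL (encL enc_nat) (assignments (F a) (c a) (j a)))"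
proof -
  note v = ptime_vars[OF F c j]
  have n: "ptime X \<mu> i (\<lambda>a. encL (encL enc_bool) (List.n_lists (length (vars (F a) (c a) (j a))) [True, False]))"
  proof (rule ptime_n_lists[OF ptime_length[OF v] ptime_const])
    show "pbd X \<mu> (\<lambda>a. length [True, False] ^ length (vars (F a) (c a) (j a)))"
      unfolding length_two
      by (rule pbd_mono[OF pow], rule power_increasing) (use len length_vars in \<open>auto\<close>)
  qed
  note z = ptime_zip[OF ptime_outer[OF v] ptime_elem[OF n]]
  note f = ptime_filter[OF z ptime_snd[OF ptime_elem[OF z]]]
  have m: "ptime X \<mu> i (\<lambda>a. encL (encL enc_nat) (map (\<lambda>bs. map fst (filter snd (zip (vars (F a) (c a) (j a)) bs)))
      (List.n_lists (length (vars (F a) (c a) (j a))) [True, False])))"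
    by (intro ptime_map[OF n] ptime_map[OF f] ptime_fst[OF ptime_elem[OF f]])
  show ?thesis unfolding assignments_def
    by (intro ptime_filter[OF m] ptime_sat_by ptime_elem[OF m] ptime_outer[OF ptime_chunk[OF F c j]])
qed

abbreviation encLab :: "nat \<times> nat list \<Rightarrow> tree" where
  "encLab \<equiv> encP enc_nat (encL enc_nat)"

lemma ptime_labels:
  assumes F: "ptime X \<mu> i (\<lambda>a. encF (F a))" and k: "ptime X \<mu> i (\<lambda>a. enc_nat (k a))"
    and c: "ptime X \<mu> i (\<lambda>a. enc_nat (c a))" and pow: "pbd X \<mu> (\<lambda>a. 2 ^ (9 * c a))"
    and len: "\<And>a. a \<in> X \<Longrightarrow> \<forall>cl\<in>set (F a). length cl \<le> 3"
  shows "ptime X \<mu> i (\<lambda>a. encL encLab (labels (F a) (k a) (c a)))"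
proof -
  note u = ptime_upt[OF k]
  let ?Y = "SIGMA a:X. set [0..<k a]" and ?\<nu> = "\<lambda>p::'a \<times> nat. \<mu> (fst p)" and ?j = "\<lambda>p. Cn (i (fst p)) (enc_nat (snd p))"
  have w: "ptime ?Y ?\<nu> ?j (\<lambda>p. encL (encL enc_nat) (assignments (F (fst p)) (c (fst p)) (snd p)))"
  proof (rule ptime_assignments[OF ptime_outer[OF F] ptime_outer[OF c] ptime_elem[OF u]])
    show "pbd ?Y ?\<nu> (\<lambda>p. 2 ^ (9 * c (fst p)))"
      by (rule pbd_reindex[OF pow]) auto
  qed (use len in auto)
  show ?thesis unfolding labels_def
    by (intro ptime_concat ptime_map[OF u] ptime_map[OF w] ptime_Pair ptime_outer[OF ptime_elem[OF u]] ptime_elem[OF w])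
qed

lemma ptime_pattern:
  assumes F: "ptime X \<mu> i (\<lambda>a. encF (F a))" and c: "ptime X \<mu> i (\<lambda>a. enc_nat (c a))"
    and w: "ptime X \<mu> i (\<lambda>a. encL enc_nat (w a))" and ab: "ptime X \<mu> i (\<lambda>a. encP enc_nat enc_nat (ab a))"
  shows "ptime X \<mu> i (\<lambda>a. encL enc_bool (pattern (F a) (c a) (w a) (ab a)))"
proof -
  note s = ptime_shared[OF F c ptime_fst[OF ab] ptime_snd[OF ab]]
  show ?thesis unfolding pattern_def
    by (intro ptime_map[OF s] ptime_mem ptime_elem[OF s] ptime_outer[OF w])
qed

lemma ptime_inner:
  assumes "ptime X \<mu> i (\<lambda>a. encL enc_bool (s a))" "ptime X \<mu> i (\<lambda>a. encL enc_bool (r a))"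
  shows "ptime X \<mu> i (\<lambda>a. enc_bool (inner (s a) (r a)))"
proof -
  note z = ptime_zip[OF assms]
  note f = ptime_filter[OF z ptime_conj[OF ptime_fst[OF ptime_elem[OF z]] ptime_snd[OF ptime_elem[OF z]]]]
  show ?thesis unfolding inner_def by (rule ptime_odd[OF ptime_length[OF f]])
qed

lemma ptime_hash:
  assumes h: "ptime X \<mu> i (\<lambda>a. enc_nat (h a))" and r: "ptime X \<mu> i (\<lambda>a. encL enc_bool (r a))"
    and s: "ptime X \<mu> i (\<lambda>a. encL enc_bool (s a))"
  shows "ptime X \<mu> i (\<lambda>a. encL enc_bool (hash (h a) (r a) (s a)))"
proof -
  note u = ptime_upt[OF h]
  show ?thesis unfolding hash_def
    by (intro ptime_map[OF u] ptime_inner ptime_drop ptime_outer[OF s] ptime_outer[OF r] ptime_elem[OF u])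
qed

lemma ptime_bits:
  assumes "ptime X \<mu> i (\<lambda>a. enc_nat (h a))" "pbd X \<mu> (\<lambda>a. 2 ^ h a)"
  shows "ptime X \<mu> i (\<lambda>a. encL (encL enc_bool) (List.n_lists (h a) [True, False]))"
  by (rule ptime_n_lists[OF assms(1) ptime_const]) (use assms(2) in \<open>simp only: length_two\<close>)

lemma ptime_guesses:
  assumes k: "ptime X \<mu> i (\<lambda>a. enc_nat (k a))" and h: "ptime X \<mu> i (\<lambda>a. enc_nat (h a))"
    and pow: "pbd X \<mu> (\<lambda>a. 2 ^ h a)" "pbd X \<mu> (\<lambda>a. (2 ^ h a) ^ (k a * k a))"
  shows "ptime X \<mu> i (\<lambda>a. encL (encL (encL enc_bool)) (guesses (k a) (h a)))"
  unfolding guesses_def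
  by (rule ptime_n_lists[OF ptime_mult[OF k k] ptime_bits[OF h pow(1)]])
     (use pow(2) in \<open>simp only: length_n_lists length_two\<close>)

lemma ptime_agrees:
  assumes F: "ptime X \<mu> i (\<lambda>a. encF (F a))" and k: "ptime X \<mu> i (\<lambda>a. enc_nat (k a))"
    and c: "ptime X \<mu> i (\<lambda>a. enc_nat (c a))" and h: "ptime X \<mu> i (\<lambda>a. enc_nat (h a))"
    and r: "ptime X \<mu> i (\<lambda>a. encL enc_bool (r a))" and p: "ptime X \<mu> i (\<lambda>a. encLab (p a))"
    and u: "ptime X \<mu> i (\<lambda>a. encL (encL enc_bool) (u a))"
  shows "ptime X \<mu> i (\<lambda>a. enc_bool (agrees (F a) (k a) (c a) (h a) (r a) (p a) (u a)))"
proof -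
  note z = ptime_zip[OF ptime_product[OF ptime_upt[OF k] ptime_upt[OF k]] u]
  note ab = ptime_fst[OF ptime_elem[OF z]] and p1 = ptime_fst[OF p]
  show ?thesis unfolding agrees_def
    by (intro ptime_all[OF z] ptime_imp ptime_disj ptime_nat_eq ptime_fst[OF ab] ptime_snd[OF ab]
        ptime_outer[OF p1] ptime_list_eq ptime_snd[OF ptime_elem[OF z]])
       (rule ptime_hash, rule ptime_outer[OF h], rule ptime_outer[OF r], rule ptime_pattern,
        rule ptime_outer[OF F], rule ptime_outer[OF c], rule ptime_outer[OF ptime_snd[OF p]], rule ab)
qed

abbreviation encEl :: "bool list \<times> nat list \<Rightarrow> tree" where
  "encEl \<equiv> encP (encL enc_bool) (encL enc_nat)"

lemma ptime_elems:
  assumes k: "ptime X \<mu> i (\<lambda>a. enc_nat (k a))" and c: "ptime X \<mu> i (\<lambda>a. enc_nat (c a))"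
    and h: "ptime X \<mu> i (\<lambda>a. enc_nat (h a))"
    and pow: "pbd X \<mu> (\<lambda>a. 2 ^ h a)" "pbd X \<mu> (\<lambda>a. (2 ^ h a) ^ (k a * k a))" "pbd X \<mu> (\<lambda>a. 2 ^ (9 * c a + h a))"
      "pbd X \<mu> (\<lambda>a. k a ^ ((2 ^ h a) ^ (k a * k a)))"
  shows "ptime X \<mu> i (\<lambda>a. encL encEl (elems (k a) (c a) (h a)))"
  unfolding elems_def
proof (rule ptime_product)
  show "ptime X \<mu> i (\<lambda>a. encL (encL enc_bool) (List.n_lists (9 * c a + h a) [True, False]))"
    by (intro ptime_bits ptime_add ptime_mult ptime_const c h pow)
  show "ptime X \<mu> i (\<lambda>a. encL (encL enc_nat) (List.n_lists (length (guesses (k a) (h a))) [0..<k a]))"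
    by (rule ptime_n_lists[OF ptime_length[OF ptime_guesses[OF k h pow(1,2)]] ptime_upt[OF k]])
       (use pow(4) in \<open>simp only: guesses_def length_n_lists length_two length_upt diff_zero\<close>)
qed

lemma ptime_covers:
  assumes F: "ptime X \<mu> i (\<lambda>a. encF (F a))" and k: "ptime X \<mu> i (\<lambda>a. enc_nat (k a))"
    and c: "ptime X \<mu> i (\<lambda>a. enc_nat (c a))" and h: "ptime X \<mu> i (\<lambda>a. enc_nat (h a))"
    and U: "ptime X \<mu> i (\<lambda>a. encL (encL (encL enc_bool)) (guesses (k a) (h a)))"
    and p: "ptime X \<mu> i (\<lambda>a. encLab (p a))" and e: "ptime X \<mu> i (\<lambda>a. encEl (e a))"
  shows "ptime X \<mu> i (\<lambda>a. enc_bool (covers (F a) (k a) (c a) (h a) (p a) (e a)))"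
proof -
  note z = ptime_zip[OF U ptime_snd[OF e]]
  show ?thesis unfolding covers_def
    by (intro ptime_ex[OF z] ptime_conj ptime_nat_eq ptime_snd[OF ptime_elem[OF z]] ptime_outer[OF ptime_fst[OF p]]
        ptime_agrees ptime_outer[OF F] ptime_outer[OF k] ptime_outer[OF c] ptime_outer[OF h]
        ptime_outer[OF ptime_fst[OF e]] ptime_outer[OF p] ptime_fst[OF ptime_elem[OF z]])
qed

lemma ptime_matrix:
  assumes F: "ptime X \<mu> i (\<lambda>a. encF (F a))" and k: "ptime X \<mu> i (\<lambda>a. enc_nat (k a))"
    and c: "ptime X \<mu> i (\<lambda>a. enc_nat (c a))" and h: "ptime X \<mu> i (\<lambda>a. enc_nat (h a))"
    and pow: "pbd X \<mu> (\<lambda>a. (2 ^ h a) ^ (k a * k a))" "pbd X \<mu> (\<lambda>a. 2 ^ (9 * c a + h a))"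
      "pbd X \<mu> (\<lambda>a. k a ^ ((2 ^ h a) ^ (k a * k a)))"
    and len: "\<And>a. a \<in> X \<Longrightarrow> \<forall>cl\<in>set (F a). length cl \<le> 3"
  shows "ptime X \<mu> i (\<lambda>a. encL (encL enc_bool) (matrix (F a) (k a) (c a) (h a)))"
proof -
  have pow': "pbd X \<mu> (\<lambda>a. 2 ^ h a)" "pbd X \<mu> (\<lambda>a. 2 ^ (9 * c a))"
    by (rule pbd_mono[OF pow(2)], rule power_increasing, simp, simp)+
  note L = ptime_labels[OF F k c pow'(2) len]
  note E = ptime_elems[OF k c h pow'(1) pow]
  note U = ptime_guesses[OF k h pow'(1) pow(1)]
  note o = ptime_outer
  note l = ptime_elem[OF L] and e = ptime_elem[OF E]
  note L1 = o[OF L] and E1 = o[OF E]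
  note L2 = ptime_elem[OF L1] and E2 = ptime_elem[OF E1]
  show ?thesis unfolding matrix_def
    by (intro ptime_append ptime_map[OF L] ptime_map[OF E] ptime_map[OF L1] ptime_map[OF E1] ptime_not ptime_nat_eq
      ptime_covers ptime_const o[OF o[OF F]] o[OF o[OF k]] o[OF o[OF c]] o[OF o[OF h]] o[OF o[OF U]]
      ptime_fst[OF L2] ptime_fst[OF o[OF l]] o[OF l] o[OF e] L2 E2)
qed

section \<open>Verifying the answer of the approximation algorithm\<close>

definition marks :: "nat \<Rightarrow> tree \<Rightarrow> bool list" where
  "marks n y = map (\<lambda>v. hd_tree ((tl_tree ^^ v) y) \<noteq> Nl) [0..<n]"

text \<open>If the domination number exceeds \<open>k\<close>, the algorithm may output anything, so
  its answer is verified instead of trusted. Any tree can be read by \<open>marks\<close>: missing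
  entries count as false, since \<open>hd\<close> and \<open>tl\<close> of nil are nil.\<close>

definition check :: "bool list list \<Rightarrow> nat \<Rightarrow> tree \<Rightarrow> bool" where
  "check M l y \<longleftrightarrow> (\<forall>q\<in>set (zip M (marks (length M) y)).
       snd q \<or> (\<exists>z\<in>set (zip (fst q) (marks (length M) y)). fst z \<and> snd z)) \<and>
     length (filter (\<lambda>b. b) (marks (length M) y)) \<le> 2 ^ l"

lemma ptime_check:
  assumes M: "ptime X \<mu> i (\<lambda>a. encL (encL enc_bool) (M a))" and l: "ptime X \<mu> i (\<lambda>a. enc_nat (l a))"
    and pow: "pbd X \<mu> (\<lambda>a. 2 ^ l a)" and y: "tcomp X \<mu> i y"
  shows "ptime X \<mu> i (\<lambda>a. enc_bool (check (M a) (l a) (y a)))"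
proof -
  note u = ptime_upt[OF ptime_length[OF M]]
  have B: "ptime X \<mu> i (\<lambda>a. encL enc_bool (marks (length (M a)) (y a)))"
    unfolding marks_def
  proof (rule ptime_map[OF u], rule ptime_nonnil, rule tcomp_hd, rule tcomp_tl_pow[OF ptime_elem[OF u]])
    show "tcomp (SIGMA a:X. set [0..<length (M a)]) (\<lambda>p. \<mu> (fst p)) (\<lambda>p. Cn (i (fst p)) (enc_nat (snd p))) (\<lambda>p. y (fst p))"
    proof (rule tcomp_comp)
      show "tcomp (SIGMA a:X. set [0..<length (M a)]) (\<lambda>p. \<mu> (fst p)) (\<lambda>p. Cn (i (fst p)) (enc_nat (snd p))) (\<lambda>p. i (fst p))"
        by (rule tcomp_assign[where e = "HdE (Var 0)"]) simp
    qed (rule tcomp_reindex[OF y], auto)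
  qed
  note z = ptime_zip[OF M B]
  note z1 = ptime_zip[OF ptime_fst[OF ptime_elem[OF z]] ptime_outer[OF B]]
  \<comment> \<open>The number \<open>2 ^ l a\<close> is obtained in unary as the number of bit
    strings of length \<open>l a\<close>.\<close>
  note bits = ptime_length[OF ptime_bits[OF l pow]]
  have "ptime X \<mu> i (\<lambda>a. enc_bool ((\<forall>q\<in>set (zip (M a) (marks (length (M a)) (y a))).
       snd q \<or> (\<exists>z\<in>set (zip (fst q) (marks (length (M a)) (y a))). fst z \<and> snd z)) \<and>
     length (filter (\<lambda>b. b) (marks (length (M a)) (y a))) \<le> length (List.n_lists (l a) [True, False])))"
    by (intro ptime_conj ptime_all[OF z] ptime_disj ptime_snd[OF ptime_elem[OF z]] ptime_ex[OF z1]
        ptime_fst[OF ptime_elem[OF z1]] ptime_snd[OF ptime_elem[OF z1]] ptime_le ptime_length[OF ptime_filter[OF B]]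
        ptime_elem[OF B] bits)
  then show ?thesis by (simp only: check_def length_n_lists length_two)
qed

lemma nth_marks: "v < n \<Longrightarrow> marks n y ! v \<longleftrightarrow> hd_tree ((tl_tree ^^ v) y) \<noteq> Nl"
  by (simp add: marks_def)

lemma marks_enc_set:
  assumes "D \<subseteq> {..<n}"
  shows "marks n (enc_set n D) = map (\<lambda>v. v \<in> D) [0..<n]"
proof (rule nth_equalityI)
  fix v assume "v < length (marks n (enc_set n D))"
  then have v: "v < n" by (simp add: marks_def)
  let ?xs = "map (\<lambda>v. v \<in> D) [0..<n]"
  have "enc_set n D = encL enc_bool ?xs"
    by (simp add: enc_set_def encL_def comp_def)
  moreover have "drop v ?xs = (v \<in> D) # drop (Suc v) ?xs"
    using Cons_nth_drop_Suc[of v ?xs] v by simp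
  ultimately have "hd_tree ((tl_tree ^^ v) (enc_set n D)) = enc_bool (v \<in> D)"
    by (simp only: tl_pow_encL encL_simps hd_tree.simps)
  then show "marks n (enc_set n D) ! v = ?xs ! v"
    using v by (simp add: nth_marks enc_bool_def)
qed (simp add: marks_def)

lemma Ball_zip: "(\<forall>q\<in>set (zip xs ys). P q) \<longleftrightarrow> (\<forall>v<min (length xs) (length ys). P (xs ! v, ys ! v))"
  by (auto simp: set_zip)

lemma Bex_zip: "(\<exists>q\<in>set (zip xs ys). P q) \<longleftrightarrow> (\<exists>v<min (length xs) (length ys). P (xs ! v, ys ! v))"
  by (auto simp: set_zip)

lemma check_iff:
  assumes M: "adjacency M" and n: "n = length M"
  shows "check M l y \<longleftrightarrow> dominating_set n (graph_of M) {v\<in>{..<n}. marks n y ! v} \<and>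
    card {v\<in>{..<n}. marks n y ! v} \<le> 2 ^ l"
proof -
  define B where "B = marks n y"
  have B: "length B = n" by (simp add: B_def marks_def)
  have M': "length (M ! v) = n" if "v < n" for v using M n that by (simp add: adjacency_def)
  have E: "{u, v} \<in> graph_of M \<longleftrightarrow> M ! v ! u" if "u < n" "v < n" for u v
    using mem_graph_of[OF M, of v u] that n by (simp add: insert_commute)
  have "(\<forall>q\<in>set (zip M B). snd q \<or> (\<exists>z\<in>set (zip (fst q) B). fst z \<and> snd z)) \<longleftrightarrow>
      (\<forall>v<n. B ! v \<or> (\<exists>u<n. M ! v ! u \<and> B ! u))"
    using B M' n by (simp add: Ball_zip Bex_zip)
  also have "\<dots> \<longleftrightarrow> (\<forall>v<n. B ! v \<or> (\<exists>u<n. {u, v} \<in> graph_of M \<and> B ! u))"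
    using E by blast
  also have "\<dots> \<longleftrightarrow> dominating_set n (graph_of M) {v\<in>{..<n}. B ! v}"
    unfolding dominating_set_def by blast
  finally have 1: "(\<forall>q\<in>set (zip M B). snd q \<or> (\<exists>z\<in>set (zip (fst q) B). fst z \<and> snd z)) \<longleftrightarrow>
      dominating_set n (graph_of M) {v\<in>{..<n}. B ! v}" .
  have "length (filter (\<lambda>b. b) B) = card {v\<in>{..<n}. B ! v}"
    using B by (simp add: length_filter_conv_card)
  with 1 show ?thesis by (simp only: check_def B_def n)
qed

section \<open>Integer logarithms\<close>

definition dlog :: "nat \<Rightarrow> nat \<Rightarrow> nat" where
  "dlog B x = length (filter (\<lambda>j. 1 \<le> x div B ^ Suc j) [0..<x])"

text \<open>The search range \<open>[0..<x]\<close> in \<open>dlog\<close> is long enough because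
  the true logarithm \<open>n\<close> satisfies \<open>n < B ^ n \<le> x\<close>.\<close>

lemma dlog_bounds:
  assumes "B \<ge> 2" "x \<ge> 1"
  shows "B ^ dlog B x \<le> x" "x < B ^ Suc (dlog B x)"
proof -
  obtain n where n: "B ^ n \<le> x" "x < B ^ Suc n"
    using ex_power_ivl1[OF assms] unfolding Suc_eq_plus1 by blast
  have "n < B ^ n" using less_exp[of n] power_mono[of 2 B n] assms(1) by (meson less_le_trans zero_le)
  then have nx: "n \<le> x" using n(1) by linarith
  have "1 \<le> x div B ^ Suc j \<longleftrightarrow> j < n" for j
  proof -
    have "1 \<le> x div B ^ Suc j \<longleftrightarrow> B ^ Suc j \<le> x"
      using assms(1) by (simp add: less_eq_div_iff_mult_less_eq)
    also have "\<dots> \<longleftrightarrow> j < n"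
    proof
      assume "B ^ Suc j \<le> x"
      then have "B ^ Suc j < B ^ Suc n" using n(2) by linarith
      then show "j < n" using assms(1) by (simp add: power_strict_increasing_iff del: power_Suc)
    next
      assume "j < n"
      then have "B ^ Suc j \<le> B ^ n" using assms(1) by (intro power_increasing) auto
      then show "B ^ Suc j \<le> x" using n(1) by linarith
    qed
    finally show ?thesis .
  qed
  then have "dlog B x = card {j. j < x \<and> j < n}"
    unfolding dlog_def length_filter_conv_card by (simp cong: conj_cong)
  also have "{j. j < x \<and> j < n} = {..<n}" using nx by auto
  finally have "dlog B x = n" by simp
  with n show "B ^ dlog B x \<le> x" "x < B ^ Suc (dlog B x)" by auto
qed

text \<open>Iterated division never builds \<open>B ^ n a\<close>, which in unary may be
  exponentially longer than \<open>x a\<close>. This is why \<open>dlog\<close> tests a quotient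
  instead of comparing with a power.\<close>

lemma ptime_div_power:
  assumes x: "ptime X \<mu> i (\<lambda>a. enc_nat (x a))" and n: "ptime X \<mu> i (\<lambda>a. enc_nat (n a))" and B: "B \<ge> 2"
  shows "ptime X \<mu> i (\<lambda>a. enc_nat (x a div B ^ n a))"
proof (rule ptimeI)
  note n' = n[unfolded ptime_unary_list]
  have "tcomp X \<mu> i (\<lambda>a. enc_nat (fold (\<lambda>_ y. y div B) (replicate (n a) ()) (x a)))"
  proof (rule tcomp_fold_counted[where I = "\<lambda>a _ y. y \<le> x a", OF ptime_tcomp[OF n'] ptime_tcomp[OF x] _ pbd_length[OF n']])
    let ?Y = "{(a, b, y). a \<in> X \<and> b \<in> set (replicate (n a) ()) \<and> (\<exists>j<length (replicate (n a) ()). y \<le> x a)}"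
      and ?\<nu> = "\<lambda>(a, b::unit, y::nat). \<mu> a" and ?j = "\<lambda>(a, b::unit, y). Cn (i a) (Cn Nl (enc_nat y))"
    have y: "ptime ?Y ?\<nu> ?j (\<lambda>p. enc_nat (snd (snd p)))"
    proof (rule ptimeI)
      show "tcomp ?Y ?\<nu> ?j (\<lambda>p. enc_nat (snd (snd p)))"
        by (rule tcomp_assign[where e = "TlE (TlE (Var 0))"]) auto
      have "pbd ?Y ?\<nu> (\<lambda>p. size (enc_nat (x (fst p))))"
        by (rule pbd_reindex[OF ptime_pbd[OF x]]) auto
      then show "pbd ?Y ?\<nu> (\<lambda>p. size (enc_nat (snd (snd p))))"
        by (rule pbd_mono) auto
    qed
    have "ptime ?Y ?\<nu> ?j (\<lambda>p. enc_nat (snd (snd p) div B))"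
      by (rule ptime_div[OF y ptime_const]) (use B in simp)
    from ptime_tcomp[OF this] show "tcomp ?Y ?\<nu> ?j (\<lambda>(a, b, y). enc_nat (y div B))"
      by (rule tcomp_cong) auto
  qed (auto intro: order_trans[OF div_le_dividend])
  moreover have "fold (\<lambda>_ y. y div B) (replicate m ()) z = z div B ^ m" for m z
    by (induction m arbitrary: z) (simp_all add: div_mult2_eq)
  ultimately show "tcomp X \<mu> i (\<lambda>a. enc_nat (x a div B ^ n a))" by (simp only:)
  show "pbd X \<mu> (\<lambda>a. size (enc_nat (x a div B ^ n a)))"
    by (rule pbd_mono[OF ptime_pbd[OF x]]) simp
qed

lemma ptime_dlog:
  assumes x: "ptime X \<mu> i (\<lambda>a. enc_nat (x a))" and B: "B \<ge> 2"
  shows "ptime X \<mu> i (\<lambda>a. enc_nat (dlog B (x a)))"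
proof -
  note u = ptime_upt[OF x]
  have "ptime X \<mu> i (\<lambda>a. encL enc_nat (filter (\<lambda>j. 1 \<le> x a div B ^ Suc j) [0..<x a]))"
    by (intro ptime_filter[OF u] ptime_le ptime_const ptime_div_power B ptime_outer[OF x] ptime_Suc ptime_elem[OF u])
  then show ?thesis unfolding dlog_def by (rule ptime_length)
qed

section \<open>Calling the approximation algorithm\<close>

fun exp_bound :: "exp \<Rightarrow> nat" where
  "exp_bound (Var x) = Suc x"
| "exp_bound NilE = 0"
| "exp_bound (ConsE a b) = max (exp_bound a) (exp_bound b)"
| "exp_bound (HdE a) = exp_bound a"
| "exp_bound (TlE a) = exp_bound a"

fun com_bound :: "com \<Rightarrow> nat" where
  "com_bound Skip = 0"
| "com_bound (Assign x e) = max (Suc x) (exp_bound e)"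
| "com_bound (Seq c d) = max (com_bound c) (com_bound d)"
| "com_bound (If e c d) = max (exp_bound e) (max (com_bound c) (com_bound d))"
| "com_bound (While e c) = max (exp_bound e) (com_bound c)"

lemma eval_exp_agree: "exp_bound e \<le> m \<Longrightarrow> (\<forall>v<m. s v = r v) \<Longrightarrow> eval_exp e s = eval_exp e r"
  by (induction e) auto

text \<open>Variables from \<open>com_bound\<close> on are neither read nor written. A caller can
  thus keep data there while it runs an algorithm that knows nothing of the stack convention and is
  specified only for initially empty variables.\<close>

lemma exec_agree:
  "exec c s t s' \<Longrightarrow> com_bound c \<le> m \<Longrightarrow> (\<forall>v<m. s v = r v) \<Longrightarrow>
    \<exists>r'. exec c r t r' \<and> (\<forall>v<m. s' v = r' v) \<and> (\<forall>v\<ge>m. r' v = r v)"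
proof (induction arbitrary: r rule: exec.induct)
  case (Skip s)
  then show ?case by (blast intro: exec.Skip)
next
  case (Assign x e s)
  then show ?case
    using eval_exp_agree[of e m s r]
    by (intro exI[of _ "r(x := eval_exp e r)"] conjI exec.Assign) auto
next
  case (Seq c s t s' d u s'')
  from Seq.prems Seq.IH(1)[of r] obtain r' where
    r': "exec c r t r'" "\<forall>v<m. s' v = r' v" "\<forall>v\<ge>m. r' v = r v" by auto
  from Seq.prems Seq.IH(2)[of r'] r'(2) obtain r'' where
    "exec d r' u r''" "\<forall>v<m. s'' v = r'' v" "\<forall>v\<ge>m. r'' v = r' v" by auto
  with r' show ?case by (intro exI[of _ r'']) (auto intro: exec.Seq)
next
  case (IfTrue e s c t s' d)
  from IfTrue.prems IfTrue.IH[of r] obtain r' where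
    r': "exec c r t r'" "\<forall>v<m. s' v = r' v" "\<forall>v\<ge>m. r' v = r v" by auto
  have "eval_exp e r \<noteq> Nl" using IfTrue.hyps(1) IfTrue.prems eval_exp_agree[of e m s r] by simp
  with r' show ?case by (intro exI[of _ r']) (auto intro: exec.IfTrue)
next
  case (IfFalse e s d t s' c)
  from IfFalse.prems IfFalse.IH[of r] obtain r' where
    r': "exec d r t r'" "\<forall>v<m. s' v = r' v" "\<forall>v\<ge>m. r' v = r v" by auto
  have "eval_exp e r = Nl" using IfFalse.hyps(1) IfFalse.prems eval_exp_agree[of e m s r] by simp
  with r' show ?case by (intro exI[of _ r']) (auto intro: exec.IfFalse)
next
  case (WhileFalse e s c)
  then show ?case
    using eval_exp_agree[of e m s r] by (intro exI[of _ r]) (auto intro: exec.WhileFalse)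
next
  case (WhileTrue e s c t s' u s'')
  from WhileTrue.prems WhileTrue.IH(1)[of r] obtain r' where
    r': "exec c r t r'" "\<forall>v<m. s' v = r' v" "\<forall>v\<ge>m. r' v = r v" by auto
  from WhileTrue.prems WhileTrue.IH(2)[of r'] r'(2) obtain r'' where
    r'': "exec (While e c) r' u r''" "\<forall>v<m. s'' v = r'' v" "\<forall>v\<ge>m. r'' v = r' v" by auto
  have "eval_exp e r \<noteq> Nl" using WhileTrue.hyps(1) WhileTrue.prems eval_exp_agree[of e m s r] by simp
  then have "exec (While e c) r (cost_exp e + 1 + t + u) r''"
    using r'(1) r''(1) by (rule exec.WhileTrue)
  with r' r'' show ?case by (intro exI[of _ r'']) auto
qed

fun clear :: "nat \<Rightarrow> com" where
  "clear 0 = Skip"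
| "clear (Suc v) = Seq (clear v) (Assign (Suc v) NilE)"

lemma halts_clear:
  "halts (clear m) s (3 * m + 1) (\<lambda>s'. s' = (\<lambda>v. if 0 < v \<and> v \<le> m then Nl else s v))"
proof (induction m)
  case 0
  show ?case unfolding clear.simps by (rule halts_mono[OF halts_Skip[where P = "\<lambda>s'. s' = s"]]) auto
next
  case (Suc m)
  have "halts (Seq (clear m) (Assign (Suc m) NilE)) s (3 * m + 1 + (cost_exp NilE + 1))
      (\<lambda>s'. s' = (\<lambda>v. if 0 < v \<and> v \<le> Suc m then Nl else s v))"
    by (rule halts_Seq, rule halts_mono[OF Suc.IH order_refl], rule halts_Assign) auto
  then show ?case unfolding clear.simps by (rule halts_mono) auto
qed

text \<open>Stack programs restore variable 1, so the instance survives \<open>c2\<close> there; it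
  then moves to a variable that \<open>A\<close> does not touch. The offset 2 keeps that variable
  apart from variables 0 and 1 even if \<open>com_bound A\<close> is 0.\<close>

definition call_com :: "com \<Rightarrow> com \<Rightarrow> com \<Rightarrow> com \<Rightarrow> com" where
  "call_com c1 c2 A c3 = Seq c1 (Seq (Assign 1 (Var 0)) (Seq c2
     (Seq (Assign (com_bound A + 2) (Var 1)) (Seq (clear (com_bound A + 1)) (Seq A
     (Seq (Assign 0 (ConsE (Var (com_bound A + 2)) (Var 0))) c3))))))"

lemma outputs_call:
  assumes c1: "runs c1 x B1 e" and c2: "runs c2 e B2 q" and A: "outputs A q t y"
    and c3: "runs c3 (Cn e y) B3 w"
  shows "\<exists>t'. outputs (call_com c1 c2 A c3) x t' w \<and> t' \<le> B1 + B2 + t + B3 + (3 * com_bound A + 50)"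
proof -
  let ?z = "com_bound A + 2"
  obtain sA where sA: "exec A ((\<lambda>_. Nl)(0 := q)) t sA" "sA 0 = y"
    using A unfolding outputs_def by blast
  have A': "halts A s t (\<lambda>s'. s' 0 = y \<and> s' ?z = e)"
    if "s 0 = q" "s ?z = e" "\<And>v. 0 < v \<Longrightarrow> v < ?z \<Longrightarrow> s v = Nl" for s
  proof -
    have "\<exists>r'. exec A s t r' \<and> (\<forall>v<?z. sA v = r' v) \<and> (\<forall>v\<ge>?z. r' v = s v)"
      by (rule exec_agree[OF sA(1)]) (use that in auto)
    then show ?thesis unfolding halts_def using sA(2) that by fastforce
  qed
  let ?s0 = "(\<lambda>_. Nl)(0 := x)"
  have "halts (call_com c1 c2 A c3) ?s0 (B1 + B2 + t + B3 + (3 * com_bound A + 50)) (\<lambda>s'. s' 0 = w)"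
    unfolding call_com_def
    apply (rule halts_mono)
      apply (rule halts_Seq, rule halts_runs[where B = B1 and y = e])
       apply (simp add: c1)
      apply (rule halts_Seq, rule halts_Assign)
      apply (rule halts_Seq, rule halts_runs[where B = B2 and y = q])
       apply (simp add: c2)
      apply (rule halts_Seq, rule halts_Assign)
      apply (rule halts_Seq, rule halts_mono[OF halts_clear order_refl])
      apply (rule halts_Seq, rule halts_mono[OF A' order_refl])
         apply simp
        apply simp
       apply (simp split: if_splits)
      apply (rule halts_Seq, rule halts_Assign)
      apply (rule halts_runs[where B = B3 and y = w])
       apply (simp add: c3)
      apply assumption
     apply simp
    apply simp
    done
  then show ?thesis unfolding halts_def outputs_def by blast
qed

section \<open>Sizes\<close>

lemma enc_cnf_encF: "enc_cnf n F = Cn (enc_nat n) (encF F)"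
  unfolding enc_cnf_def enc_clause_def encL_def encP_def by (simp add: case_prod_beta')

text \<open>Every nonempty clause is counted at one of its variables, at most three per variable.
  The \<open>+ 1\<close> is for the empty clause, which is listed at most once.\<close>

lemma length_le_three_occurrences:
  assumes F: "cnf3 n F" and occ: "three_occurrences F"
  shows "length F \<le> 3 * n + 1"
proof -
  have "distinct F" using F unfolding cnf3_def by (simp add: distinct_map)
  then have "length F = card (set F)" by (simp add: distinct_card)
  also have "set F \<subseteq> insert [] (\<Union>i<n. {c \<in> set F. \<exists>b. (b, i) \<in> set c})"
  proof
    fix c assume c: "c \<in> set F"
    show "c \<in> insert [] (\<Union>i<n. {c \<in> set F. \<exists>b. (b, i) \<in> set c})"
    proof (cases c)
      case (Cons l ls)
      then obtain b i where "(b, i) \<in> set c" by (cases l) auto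
      moreover have "i < n" using F c \<open>(b, i) \<in> set c\<close> unfolding cnf3_def by fastforce
      ultimately show ?thesis using c by blast
    qed simp
  qed
  then have "card (set F) \<le> card (insert [] (\<Union>i<n. {c \<in> set F. \<exists>b. (b, i) \<in> set c}))"
    by (rule card_mono[rotated]) simp
  also have "\<dots> \<le> Suc (card (\<Union>i<n. {c \<in> set F. \<exists>b. (b, i) \<in> set c}))"
    by (rule card_insert_le_m1[THEN order_trans]) auto
  also have "card (\<Union>i<n. {c \<in> set F. \<exists>b. (b, i) \<in> set c}) \<le> (\<Sum>i<n. card {c \<in> set F. \<exists>b. (b, i) \<in> set c})"
    by (rule card_UN_le) simp
  also have "\<dots> \<le> (\<Sum>i<n. 3)"
    by (rule sum_mono) (use occ in \<open>simp add: three_occurrences_def\<close>)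
  finally show ?thesis by simp
qed

lemma size_encF_le:
  assumes F: "cnf3 n F" and occ: "three_occurrences F"
  shows "size (encF F) \<le> 100 * (n + 1)\<^sup>2"
proof -
  have lit: "size (encP enc_bool enc_nat q) \<le> n + 1" if "q \<in> set c" "c \<in> set F" for q c
  proof -
    have "snd q < n" using F that unfolding cnf3_def by fastforce
    then show ?thesis by (cases q) (auto simp: enc_bool_def)
  qed
  have cl: "size (encL (encP enc_bool enc_nat) c) \<le> 3 * (n + 1 + 1)" if "c \<in> set F" for c
  proof -
    have "size (encL (encP enc_bool enc_nat) c) \<le> length c * (n + 1 + 1)"
      by (rule size_encL_le) (use lit that in auto)
    also have "\<dots> \<le> 3 * (n + 1 + 1)"
      by (rule mult_right_mono) (use F that in \<open>auto simp: cnf3_def\<close>)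
    finally show ?thesis .
  qed
  have "size (encF F) \<le> length F * (3 * (n + 1 + 1) + 1)"
    by (rule size_encL_le) (use cl in auto)
  also have "\<dots> \<le> (3 * n + 1) * (3 * (n + 1 + 1) + 1)"
    by (rule mult_right_mono[OF length_le_three_occurrences[OF F occ]]) simp
  also have "\<dots> \<le> 100 * (n + 1)\<^sup>2" by (simp add: power2_eq_square algebra_simps)
  finally show ?thesis .
qed

section \<open>The uniform part of the reduction\<close>

type_synonym inst = "cnf \<times> nat \<times> nat \<times> nat"

definition enc_inst :: "inst \<Rightarrow> tree" where
  "enc_inst = encP encF (encP enc_nat (encP enc_nat enc_nat))"

text \<open>The hypothesis on \<open>c\<close> bounds the number \<open>k^|U|\<close> of functions from the guesses \<open>U\<close> to the
  chunks by \<open>2^c\<close>, so that the whole reduction is polynomial in \<open>2^c\<close>, with an exponent independent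
  of \<open>k\<close>.\<close>

definition insts :: "inst set" where
  "insts = {(F, k, c, l). (\<forall>cl\<in>set F. length cl \<le> 3) \<and> k \<ge> 1 \<and> k * (2 ^ (3 * l)) ^ (k * k) \<le> c}"

definition weight :: "inst \<Rightarrow> nat" where
  "weight = (\<lambda>(F, k, c, l). size (encF F) + k + 2 ^ c)"

definition inst_matrix :: "inst \<Rightarrow> bool list list" where
  "inst_matrix = (\<lambda>(F, k, c, l). matrix F k c (3 * l))"

lemma inst_length_le:
  assumes "(F, k, c, l) \<in> insts"
  shows "3 * l < c"
proof -
  have k: "k \<ge> 1" "k * (2 ^ (3 * l)) ^ (k * k) \<le> c" using assms by (auto simp: insts_def)
  have "3 * l < 2 ^ (3 * l)" by (rule less_exp)
  also have "\<dots> \<le> (2 ^ (3 * l)) ^ (k * k)"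
    using power_increasing[of 1 "k * k" "(2::nat) ^ (3 * l)"] mult_le_mono[OF k(1) k(1)] by simp
  also have "\<dots> \<le> k * (2 ^ (3 * l)) ^ (k * k)" using k(1) by simp
  also note k(2)
  finally show ?thesis .
qed

lemma ptime_inst_parts:
  shows "ptime insts weight enc_inst (\<lambda>a. encF (fst a))"
    and "ptime insts weight enc_inst (\<lambda>a. enc_nat (fst (snd a)))"
    and "ptime insts weight enc_inst (\<lambda>a. enc_nat (fst (snd (snd a))))"
    and "ptime insts weight enc_inst (\<lambda>a. enc_nat (snd (snd (snd a))))"
proof -
  have "ptime insts weight enc_inst (\<lambda>a. encP encF (encP enc_nat (encP enc_nat enc_nat)) a)"
  proof (rule ptimeI)
    show "tcomp insts weight enc_inst (\<lambda>a. encP encF (encP enc_nat (encP enc_nat enc_nat)) a)"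
      using tcomp_id[of insts weight enc_inst] by (simp add: enc_inst_def)
    have "pbd insts weight (\<lambda>a. 5 * weight a + 5)"
      by (intro pbd_add pbd_mult pbd_const pbd_measure)
    then show "pbd insts weight (\<lambda>a. size (encP encF (encP enc_nat (encP enc_nat enc_nat)) a))"
    proof (rule pbd_mono)
      fix a assume a: "a \<in> insts"
      obtain F k c l where eq: "a = (F, k, c, l)" by (cases a)
      have "c < (2::nat) ^ c" by (rule less_exp)
      then have c: "c + l \<le> 2 * (2::nat) ^ c" using inst_length_le[OF a[unfolded eq]] by linarith
      show "size (encP encF (encP enc_nat (encP enc_nat enc_nat)) a) \<le> 5 * weight a + 5"
        unfolding eq using c by (simp add: weight_def)
    qed
  qed
  note E = this and E' = ptime_snd[OF this]
  show "ptime insts weight enc_inst (\<lambda>a. encF (fst a))" by (rule ptime_fst[OF E])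
  show "ptime insts weight enc_inst (\<lambda>a. enc_nat (fst (snd a)))" by (rule ptime_fst[OF E'])
  show "ptime insts weight enc_inst (\<lambda>a. enc_nat (fst (snd (snd a))))" by (rule ptime_fst[OF ptime_snd[OF E']])
  show "ptime insts weight enc_inst (\<lambda>a. enc_nat (snd (snd (snd a))))" by (rule ptime_snd[OF ptime_snd[OF E']])
qed

lemma ptime_inst_matrix: "ptime insts weight enc_inst (\<lambda>a. encL (encL enc_bool) (inst_matrix a))"
proof -
  have pc: "pbd insts weight (\<lambda>a. 2 ^ fst (snd (snd a)))"
    by (rule pbd_mono[OF pbd_measure]) (auto simp: weight_def)
  have *: "ptime insts weight enc_inst (\<lambda>a. encL (encL enc_bool)
     (matrix (fst a) (fst (snd a)) (fst (snd (snd a))) (3 * snd (snd (snd a)))))"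
  proof (rule ptime_matrix)
    show "ptime insts weight enc_inst (\<lambda>a. enc_nat (3 * snd (snd (snd a))))"
      by (intro ptime_mult ptime_const ptime_inst_parts)
    show "pbd insts weight (\<lambda>a. (2 ^ (3 * snd (snd (snd a)))) ^ (fst (snd a) * fst (snd a)))"
    proof (rule pbd_mono[OF pc])
      fix a assume a: "a \<in> insts"
      obtain F k c l where eq: "a = (F, k, c, l)" by (cases a)
      from a have k: "k \<ge> 1" "k * (2 ^ (3 * l)) ^ (k * k) \<le> c" by (auto simp: insts_def eq)
      have "(2 ^ (3 * l)) ^ (k * k) \<le> k * (2 ^ (3 * l)) ^ (k * k)" using k(1) by simp
      also note k(2)
      also have "c \<le> 2 ^ c" by (rule less_imp_le, rule less_exp)
      finally show "((2::nat) ^ (3 * snd (snd (snd a)))) ^ (fst (snd a) * fst (snd a)) \<le> 2 ^ fst (snd (snd a))"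
        unfolding eq fst_conv snd_conv .
    qed
    show "pbd insts weight (\<lambda>a. 2 ^ (9 * fst (snd (snd a)) + 3 * snd (snd (snd a))))"
    \<comment> \<open>The exponent 10 comes from \<open>9 * c + 3 * l \<le> 10 * c\<close>.\<close>
    proof (rule pbd_mono[OF pbd_power[OF pc, of 10]])
      fix a assume a: "a \<in> insts"
      obtain F k c l where eq: "a = (F, k, c, l)" by (cases a)
      show "(2::nat) ^ (9 * fst (snd (snd a)) + 3 * snd (snd (snd a))) \<le> (2 ^ fst (snd (snd a))) ^ 10"
        unfolding power_mult[symmetric] eq fst_conv snd_conv
        by (rule power_increasing) (use inst_length_le[of F k c l] a eq in simp_all)
    qed
    show "pbd insts weight (\<lambda>a. fst (snd a) ^ (2 ^ (3 * snd (snd (snd a)))) ^ (fst (snd a) * fst (snd a)))"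
    proof (rule pbd_mono[OF pc])
      fix a assume a: "a \<in> insts"
      obtain F k c l where eq: "a = (F, k, c, l)" by (cases a)
      from a have k: "k * (2 ^ (3 * l)) ^ (k * k) \<le> c" by (auto simp: insts_def eq)
      have "k ^ (2 ^ (3 * l)) ^ (k * k) \<le> (2 ^ k) ^ (2 ^ (3 * l)) ^ (k * k)"
        by (rule power_mono) (auto intro: less_imp_le)
      also have "\<dots> = 2 ^ (k * (2 ^ (3 * l)) ^ (k * k))" by (rule power_mult[symmetric])
      also have "\<dots> \<le> 2 ^ c" by (rule power_increasing[OF k]) simp
      finally show "fst (snd a) ^ (2 ^ (3 * snd (snd (snd a)))) ^ (fst (snd a) * fst (snd a)) \<le> 2 ^ fst (snd (snd a))"
        unfolding eq fst_conv snd_conv .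
    qed
    show "\<forall>cl\<in>set (fst a). length cl \<le> 3" if "a \<in> insts" for a
      using that by (auto simp: insts_def)
  qed (rule ptime_inst_parts)+
  show ?thesis by (rule ptime_cong[OF *]) (simp add: inst_matrix_def split_beta)
qed

text \<open>The program and the exponent are fixed before any instance, hence before
  \<open>k\<close>; this allows \<open>k\<close> to be taken large compared to
  \<open>d\<close>.\<close>

lemma uniform_reduction:
  obtains c d where "\<And>a. a \<in> insts \<Longrightarrow>
      runs c (enc_inst a) ((weight a + 2) ^ d) (Cn (enc_nat (fst (snd a))) (encL (encL enc_bool) (inst_matrix a)))"
    "\<And>a. a \<in> insts \<Longrightarrow> length (inst_matrix a) \<le> (weight a + 2) ^ d"
proof -
  have "ptime insts weight enc_inst (\<lambda>a. Cn (enc_nat (fst (snd a))) (encL (encL enc_bool) (inst_matrix a)))"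
    by (intro ptime_Cn ptime_inst_parts ptime_inst_matrix)
  from ptime_tcomp[OF this] obtain c B where c: "pbd insts weight B" "\<And>a. a \<in> insts \<Longrightarrow>
      runs c (enc_inst a) (B a) (Cn (enc_nat (fst (snd a))) (encL (encL enc_bool) (inst_matrix a)))"
    by (rule tcompE) blast
  from pbd_add[OF c(1) pbd_length[OF ptime_inst_matrix]] obtain d where
    d: "\<And>a. a \<in> insts \<Longrightarrow> B a + length (inst_matrix a) \<le> (weight a + 2) ^ d"
    unfolding pbd_def by blast
  show thesis
  proof (rule that)
    fix a assume a: "a \<in> insts"
    show "runs c (enc_inst a) ((weight a + 2) ^ d) (Cn (enc_nat (fst (snd a))) (encL (encL enc_bool) (inst_matrix a)))"
      by (rule runs_mono[OF c(2)[OF a] order_trans[OF _ d[OF a]]]) simp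
    show "length (inst_matrix a) \<le> (weight a + 2) ^ d"
      by (rule order_trans[OF _ d[OF a]]) simp
  qed
qed

lemma uniform_check:
  obtains c d where "\<And>a y. a \<in> insts \<Longrightarrow>
      runs c (Cn (enc_inst a) y) ((weight a + 2) ^ d) (enc_bool (check (inst_matrix a) (snd (snd (snd a))) y))"
proof -
  let ?X = "SIGMA a:insts. (UNIV :: tree set)" and ?\<mu> = "\<lambda>p::inst \<times> tree. weight (fst p)"
    and ?i = "\<lambda>p. Cn (enc_inst (fst p)) (id (snd p))"
  have pow: "pbd ?X ?\<mu> (\<lambda>p. 2 ^ snd (snd (snd (fst p))))"
  proof (rule pbd_mono[OF pbd_measure])
    fix p :: "inst \<times> tree" assume p: "p \<in> ?X"
    obtain F k c l y where eq: "p = ((F, k, c, l), y)" by (cases p) auto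
    have "(2::nat) ^ l \<le> 2 ^ c" using inst_length_le[of F k c l] p eq by (intro power_increasing) auto
    then show "2 ^ snd (snd (snd (fst p))) \<le> weight (fst p)"
      unfolding eq weight_def fst_conv snd_conv prod.case by linarith
  qed
  have y: "tcomp ?X ?\<mu> ?i snd"
    by (rule tcomp_assign[where e = "TlE (Var 0)"]) simp
  have "ptime ?X ?\<mu> ?i (\<lambda>p. enc_bool (check (inst_matrix (fst p)) (snd (snd (snd (fst p)))) (snd p)))"
    by (rule ptime_check[OF ptime_outer[OF ptime_inst_matrix] ptime_outer[OF ptime_inst_parts(4)] pow y])
  from ptime_tcomp[OF this] obtain c B where c: "pbd ?X ?\<mu> B" "\<And>p. p \<in> ?X \<Longrightarrow>
      runs c (?i p) (B p) (enc_bool (check (inst_matrix (fst p)) (snd (snd (snd (fst p)))) (snd p)))"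
    by (rule tcompE) blast
  from c(1) obtain d where d: "\<And>p. p \<in> ?X \<Longrightarrow> B p \<le> (weight (fst p) + 2) ^ d"
    unfolding pbd_def by blast
  show thesis
  proof (rule that)
    fix a y assume a: "a \<in> insts"
    then have "(a, y) \<in> ?X" by simp
    from runs_mono[OF c(2)[OF this] d[OF this]]
    show "runs c (Cn (enc_inst a) y) ((weight a + 2) ^ d) (enc_bool (check (inst_matrix a) (snd (snd (snd a))) y))"
      by simp
  qed
qed

text \<open>The padding \<open>N\<close> makes \<open>c\<close> as large as the estimates require
  even for small \<open>n\<close>. The logarithm is the largest \<open>l\<close> with
  \<open>(2 ^ (3 * l)) ^ (k * k) \<le> c div k\<close>, which is what membership in
  \<open>insts\<close> needs.\<close>

definition inst_of :: "nat \<Rightarrow> nat \<Rightarrow> nat \<Rightarrow> cnf \<Rightarrow> inst" where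
  "inst_of k N n F = (let c = (n + N) div k + 1 in (F, k, c, dlog (2 ^ (3 * (k * k))) (c div k)))"

text \<open>Here the exponent may depend on \<open>k\<close> and \<open>N\<close>, because the time
  is polynomial in the size of the formula and not in \<open>2 ^ c\<close>.\<close>

lemma parameters_computable:
  assumes k: "k \<ge> 1"
  obtains c d where "\<And>n F. runs c (enc_cnf n F) ((size (enc_cnf n F) + 2) ^ d) (enc_inst (inst_of k N n F))"
proof -
  let ?i = "\<lambda>p. enc_cnf (fst p) (snd p)" and ?\<mu> = "\<lambda>p. size (enc_cnf (fst p) (snd p))"
  have "ptime UNIV ?\<mu> ?i ?i"
    by (rule ptimeI[OF tcomp_id pbd_measure])
  then have "ptime UNIV ?\<mu> ?i (\<lambda>p. encP enc_nat encF (fst p, snd p))"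
    by (rule ptime_cong) (simp add: enc_cnf_encF encP_def split_beta)
  from ptime_fst[OF this] ptime_snd[OF this]
  have n: "ptime UNIV ?\<mu> ?i (\<lambda>p. enc_nat (fst p))" and F: "ptime UNIV ?\<mu> ?i (\<lambda>p. encF (snd p))" by simp_all
  have c: "ptime UNIV ?\<mu> ?i (\<lambda>p. enc_nat ((fst p + N) div k + 1))"
    by (intro ptime_add ptime_div ptime_const n) (use k in simp)
  have "ptime UNIV ?\<mu> ?i (\<lambda>p. enc_nat (((fst p + N) div k + 1) div k))"
    by (intro ptime_div c ptime_const) (use k in simp)
  moreover have "(2::nat) \<le> 2 ^ (3 * (k * k))"
    using power_increasing[of 1 "3 * (k * k)" "2::nat"] mult_le_mono[OF k k] by simp
  ultimately have l: "ptime UNIV ?\<mu> ?i (\<lambda>p. enc_nat (dlog (2 ^ (3 * (k * k))) (((fst p + N) div k + 1) div k)))"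
    by (rule ptime_dlog)
  have "ptime UNIV ?\<mu> ?i (\<lambda>p. Cn (encF (snd p)) (Cn (enc_nat k) (Cn (enc_nat ((fst p + N) div k + 1))
      (enc_nat (dlog (2 ^ (3 * (k * k))) (((fst p + N) div k + 1) div k))))))"
    by (intro ptime_Cn F ptime_const c l)
  then have "ptime UNIV ?\<mu> ?i (\<lambda>p. enc_inst (inst_of k N (fst p) (snd p)))"
    by (simp add: enc_inst_def inst_of_def Let_def)
  from ptime_tcomp[OF this] obtain c B where c: "pbd UNIV ?\<mu> B" "\<And>p. runs c (?i p) (B p) (enc_inst (inst_of k N (fst p) (snd p)))"
    by (rule tcompE) blast
  from c(1) obtain d where d: "\<And>p. B p \<le> (?\<mu> p + 2) ^ d" unfolding pbd_def by blast
  show thesis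
  proof (rule that)
    show "runs c (enc_cnf n F) ((size (enc_cnf n F) + 2) ^ d) (enc_inst (inst_of k N n F))" for n F
      using runs_mono[OF c(2) d, of "(n, F)"] by simp
  qed
qed

section \<open>The parameters\<close>

lemma polynomial_le_exponential:
  assumes "\<epsilon> > 0"
  shows "\<exists>C\<ge>0. \<forall>n::nat. (real n + 1) ^ m \<le> C * 2 powr (\<epsilon> * real n)"
proof (cases "m = 0")
  case True
  then show ?thesis using assms by (intro exI[of _ 1]) (auto intro: ge_one_powr_ge_zero)
next
  case False
  \<comment> \<open>The bound 1 gives \<open>a * (n + 1) \<le> 1 + a * n \<le> exp (a * n)\<close>;
    the other bound makes the \<open>m\<close>-th power of the latter at most
    \<open>2 powr (\<epsilon> * n)\<close>.\<close>
  define a where "a = min 1 (\<epsilon> * ln 2 / m)"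
  have a: "a > 0" "a \<le> 1" "a \<le> \<epsilon> * ln 2 / m" using assms False by (auto simp: a_def)
  have "(real n + 1) ^ m \<le> (1 / a) ^ m * 2 powr (\<epsilon> * real n)" for n
  proof -
    have "a * (real n + 1) \<le> 1 + a * real n" using a by (simp add: algebra_simps)
    also have "\<dots> \<le> exp (a * real n)" by (rule exp_ge_add_one_self)
    also have "\<dots> \<le> exp (\<epsilon> * ln 2 / m * real n)" using mult_right_mono[OF a(3), of "real n"] by simp
    finally have "(a * (real n + 1)) ^ m \<le> exp (\<epsilon> * ln 2 / m * real n) ^ m"
      using a(1) by (intro power_mono) auto
    also have "\<dots> = exp (real m * (\<epsilon> * ln 2 / m * real n))" by (rule exp_of_nat_mult[symmetric])
    also have "real m * (\<epsilon> * ln 2 / m * real n) = \<epsilon> * real n * ln 2" using False by simp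
    also have "exp (\<epsilon> * real n * ln 2) = 2 powr (\<epsilon> * real n)" by (simp add: powr_def)
    finally have "a ^ m * (real n + 1) ^ m \<le> 2 powr (\<epsilon> * real n)" unfolding power_mult_distrib .
    then show ?thesis using a(1) by (simp add: power_divide field_simps)
  qed
  then show ?thesis using a(1) by (intro exI[of _ "(1 / a) ^ m"]) auto
qed

text \<open>With \<open>u = k * k\<close>, the logarithm gives \<open>c\<close> at most a constant
  times \<open>2 ^ (3 * u * l)\<close>. So \<open>2 ^ (4 * u * l)\<close> is at least of order
  \<open>c powr (4 / 3)\<close> and beats the left side, linear in \<open>c\<close>, for large
  \<open>c\<close>. Fourth powers against cubes keep the comparison in the natural numbers; the
  threshold for \<open>c\<close> is what is left after cancelling \<open>c ^ 3\<close>.\<close>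

lemma dlog_gap:
  assumes k: "k \<ge> 1" and c: "c \<ge> k" "c \<ge> 2 ^ (12 * (k * k)) * (2 * k) ^ 4 * k ^ (12 * (k * k)) * (2 * d) ^ 3"
  shows "k ^ (4 * (k * k)) * (2 * d * c) \<le> 2 ^ (4 * (k * k) * dlog (2 ^ (3 * (k * k))) (c div k))"
proof -
  define l where "l = dlog (2 ^ (3 * (k * k))) (c div k)"
  define u where "u = k * k"
  have u: "u \<ge> 1" using mult_le_mono[OF k k] by (simp add: u_def)
  have q: "c div k \<ge> 1" using c(1) k by (simp add: less_eq_div_iff_mult_less_eq)
  have "(2::nat) \<le> 2 ^ (3 * u)" using power_increasing[of 1 "3 * u" "2::nat"] u by simp
  from dlog_bounds(2)[OF this q] have "c div k < (2 ^ (3 * u)) ^ Suc l" by (simp add: l_def u_def)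
  then have ql: "c div k < 2 ^ (3 * u * Suc l)" by (simp only: power_mult)
  have "c mod k < k" "k \<le> k * (c div k)" using k mult_le_mono2[OF q, of k] by simp_all
  then have "c \<le> k * (c div k) + k * (c div k)" using mult_div_mod_eq[of k c] by linarith
  also have "\<dots> = 2 * k * (c div k)" by simp
  also have "\<dots> \<le> 2 * k * 2 ^ (3 * u * Suc l)" by (rule mult_left_mono[OF less_imp_le[OF ql]]) simp
  finally have "c ^ 4 \<le> (2 * k * 2 ^ (3 * u * Suc l)) ^ 4" by (rule power_mono) simp
  also have "\<dots> = 2 ^ (12 * u) * (2 * k) ^ 4 * (2 ^ (4 * u * l)) ^ 3"
    by (simp add: power_mult_distrib power_mult[symmetric] power_add[symmetric] algebra_simps)
  finally have c4: "c ^ 4 \<le> 2 ^ (12 * u) * (2 * k) ^ 4 * (2 ^ (4 * u * l)) ^ 3" .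
  have "(2 ^ (12 * u) * (2 * k) ^ 4) * (k ^ (4 * u) * (2 * d * c)) ^ 3
      = 2 ^ (12 * u) * (2 * k) ^ 4 * k ^ (12 * u) * (2 * d) ^ 3 * c ^ 3"
    by (simp add: power_mult_distrib power_mult[symmetric] algebra_simps)
  also have "\<dots> \<le> c * c ^ 3" using c(2) by (intro mult_right_mono) (simp_all add: u_def)
  also have "\<dots> = c ^ 4" using power_Suc[of c 3] by simp
  also note c4
  finally have "2 ^ (12 * u) * (2 * k) ^ 4 * (k ^ (4 * u) * (2 * d * c)) ^ 3
      \<le> 2 ^ (12 * u) * (2 * k) ^ 4 * (2 ^ (4 * u * l)) ^ 3" .
  then have "(k ^ (4 * u) * (2 * d * c)) ^ 3 \<le> (2 ^ (4 * u * l)) ^ 3"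
    by (rule mult_left_le_imp_le) (use k in simp)
  then have "k ^ (4 * u) * (2 * d * c) \<le> 2 ^ (4 * u * l)"
    unfolding numeral_3_eq_3 by (rule power_le_imp_le_base) simp
  then show ?thesis by (simp add: u_def l_def)
qed

text \<open>The inequality of \<open>dlog_gap\<close> after taking roots of order
  \<open>4 * k\<^sup>2\<close>; \<open>L\<close> will be the logarithm of the number of
  vertices.\<close>

lemma root_gap:
  assumes "k \<ge> (1::nat)" "0 \<le> L" "L \<le> real x" "k ^ (4 * (k * k)) * x \<le> 2 ^ (4 * (k * k) * l)"
  shows "L powr (1 / (4 * (real k)\<^sup>2)) * real k \<le> 2 ^ l"
proof -
  define m where "m = 4 * (k * k)"
  have m: "m > 0" using assms(1) by (simp add: m_def)
  have mr: "real m = 4 * (real k)\<^sup>2" by (simp add: m_def power2_eq_square)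
  have "(L powr (1 / real m)) ^ m = L"
    using assms(2) m by (cases "L = 0") (simp_all add: powr_powr flip: powr_realpow)
  then have "(L powr (1 / real m) * real k) ^ m = L * real k ^ m" by (simp add: power_mult_distrib)
  also have "\<dots> \<le> real x * real k ^ m" using assms(3) by (simp add: mult_right_mono)
  also have "\<dots> = real (k ^ m * x)" by simp
  also have "\<dots> \<le> real (2 ^ (m * l))" using assms(4) unfolding m_def by (simp only: of_nat_le_iff)
  also have "\<dots> = (2 ^ l) ^ m" by (simp add: power_mult[symmetric] mult.commute)
  finally have "(L powr (1 / real m) * real k) ^ m \<le> (2 ^ l) ^ m" .
  then have "L powr (1 / real m) * real k \<le> 2 ^ l"
    using m by (simp add: power_mono_iff)
  then show ?thesis by (simp add: mr)
qed

text \<open>Makes the number of vertices at most \<open>2 ^ (2 * d * c)\<close>, so that its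
  logarithm is linear in \<open>c\<close>.\<close>

lemma weight_eventually_le:
  "\<exists>K. \<forall>c\<ge>K. 100 * (k * c)\<^sup>2 + k + 2 ^ c + 2 \<le> (2::nat) ^ (2 * c)"
proof -
  obtain C where C: "C \<ge> 0" "\<And>n::nat. (real n + 1) ^ 2 \<le> C * 2 powr ((1/2) * real n)"
    using polynomial_le_exponential[of "1/2" 2] by auto
  define K where "K = nat \<lceil>(2 * (100 * (real k)\<^sup>2 * C + real k + 3))\<rceil>"
  have "100 * (k * c)\<^sup>2 + k + 2 ^ c + 2 \<le> 2 ^ (2 * c)" if "c \<ge> K" for c
  proof -
    define z where "z = (2::real) powr ((1/2) * real c)"
    have z1: "z \<ge> 1" unfolding z_def by (rule ge_one_powr_ge_zero) auto
    have zz: "z * z = 2 ^ c" by (simp add: z_def powr_add[symmetric] powr_realpow)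
    have "(real c)\<^sup>2 \<le> (real c + 1)\<^sup>2" by (rule power_mono) auto
    also have "\<dots> \<le> C * z" unfolding z_def by (rule C(2))
    finally have c2: "(real c)\<^sup>2 \<le> C * z" .
    have e: "100 * (real k)\<^sup>2 * (real c)\<^sup>2 \<le> 100 * (real k)\<^sup>2 * (C * z)" "(real k + 2) * 1 \<le> (real k + 2) * z"
      by (rule mult_left_mono[OF c2], simp) (rule mult_left_mono[OF z1], simp)
    have "real (100 * (k * c)\<^sup>2 + k + 2 ^ c + 2) = 100 * (real k)\<^sup>2 * (real c)\<^sup>2 + real k + 2 + 2 ^ c"
      by (simp add: power_mult_distrib)
    also have "\<dots> \<le> 100 * (real k)\<^sup>2 * (C * z) + (real k + 2) * z + 2 ^ c"
      using add_right_mono[OF add_mono[OF e], of "2 ^ c"] by (simp only: mult_1_right add.assoc)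
    also have "\<dots> = (100 * (real k)\<^sup>2 * C + real k + 2) * z + z * z" by (simp add: zz algebra_simps)
    also have "\<dots> \<le> (100 * (real k)\<^sup>2 * C + real k + 2) * (z * z) + z * z"
      using z1 C(1) by (intro add_mono mult_left_mono) auto
    also have "\<dots> = (100 * (real k)\<^sup>2 * C + real k + 3) * 2 ^ c" by (simp add: zz algebra_simps)
    also have "\<dots> \<le> 2 ^ c * 2 ^ c"
    proof (rule mult_right_mono)
      have "100 * (real k)\<^sup>2 * C + real k + 3 \<le> 2 * (100 * (real k)\<^sup>2 * C + real k + 3)"
        using C(1) by simp
      also have "\<dots> \<le> real K" unfolding K_def by (rule real_nat_ceiling_ge)
      also have "\<dots> \<le> real c" using that by simp
      also have "\<dots> \<le> 2 ^ c" by (rule less_imp_le) (rule of_nat_less_two_power)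
      finally show "100 * (real k)\<^sup>2 * C + real k + 3 \<le> 2 ^ c" .
    qed simp
    also have "\<dots> = real (2 ^ (2 * c))" by (simp add: power_add[symmetric] mult_2)
    finally show ?thesis by (simp only: of_nat_le_iff)
  qed
  then show ?thesis by blast
qed

lemma satisfiable_iff_check:
  assumes inst: "(F, k, c, l) \<in> insts" and k: "k \<ge> 2" and l: "l \<ge> 1" and F: "length F \<le> 3 * k * c"
  defines "M \<equiv> inst_matrix (F, k, c, l)"
  assumes approx: "domination_number (length M) (graph_of M) \<le> k \<Longrightarrow>
    \<exists>D. dominating_set (length M) (graph_of M) D \<and> real (card D) \<le> \<rho> \<and> y = enc_set (length M) D"
    and \<rho>: "\<rho> \<le> 2 ^ l"
  shows "check M l y \<longleftrightarrow> satisfiable F"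
proof -
  have M: "M = matrix F k c (3 * l)" by (simp add: M_def inst_matrix_def)
  have adj: "adjacency M" unfolding M by (rule adjacency_matrix)
  have c: "c \<ge> 1" using inst_length_le[OF inst] by simp
  have len: "\<forall>cl\<in>set F. length cl \<le> 3" using inst by (auto simp: insts_def)
  show ?thesis
  proof
    assume "check M l y"
    then have "dominating_set (length M) (graph_of M) {v\<in>{..<length M}. marks (length M) y ! v}"
      "card {v\<in>{..<length M}. marks (length M) y ! v} \<le> 2 ^ l"
      unfolding check_iff[OF adj refl] by auto
    then show "satisfiable F"
      using k l c len F unfolding M by (intro small_dominating_set_imp_satisfiable) auto
  next
    assume "satisfiable F"
    from matrix_dominating_set_exists[OF this k, of c "3 * l"] obtain D where
      D: "dominating_set (length M) (graph_of M) D" "card D \<le> k" unfolding M by blast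
    have "finite {card S |S. dominating_set (length M) (graph_of M) S}"
      by (rule finite_subset[of _ "card ` Pow {..<length M}"]) (auto simp: dominating_set_def)
    then have "domination_number (length M) (graph_of M) \<le> card D"
      unfolding domination_number_def using D(1) by (intro Min_le) auto
    then obtain D' where D': "dominating_set (length M) (graph_of M) D'" "real (card D') \<le> \<rho>"
      "y = enc_set (length M) D'"
      using approx D(2) by (meson le_trans)
    have sub: "D' \<subseteq> {..<length M}" using D'(1) by (simp add: dominating_set_def)
    then have eq: "{v\<in>{..<length M}. marks (length M) y ! v} = D'"
      by (auto simp: D'(3) marks_enc_set)
    have "real (card D') \<le> real (2 ^ l)" unfolding of_nat_power of_nat_numeral using D'(2) \<rho> by linarith
    then have "card D' \<le> 2 ^ l" by (simp only: of_nat_le_iff)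
    then show "check M l y"
      unfolding check_iff[OF adj refl] eq using D'(1) by simp
  qed
qed

lemma inst_of_facts:
  fixes k n N d :: nat
  assumes F: "cnf3 n F" and occ: "three_occurrences F" and k: "k \<ge> 1"
    and N: "N = k * K" and K: "K \<ge> k * 2 ^ (3 * (k * k))"
  obtains c l where "inst_of k N n F = (F, k, c, l)" "(F, k, c, l) \<in> insts" "l \<ge> 1" "c \<ge> K"
    "length F \<le> 3 * k * c" "n + 1 \<le> k * c" "real c \<le> real n / real k + real K + 1"
    "l = dlog (2 ^ (3 * (k * k))) (c div k)"
proof -
  define c where "c = (n + N) div k + 1"
  define l where "l = dlog (2 ^ (3 * (k * k))) (c div k)"
  have cK: "c = n div k + K + 1" using k by (simp add: c_def N)
  have kk: "1 \<le> k * k" using mult_le_mono[OF k k] by simp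
  have c_ge: "c \<ge> k * 2 ^ (3 * (k * k))" using K cK by linarith
  then have q: "2 ^ (3 * (k * k)) \<le> c div k" using k by (simp add: less_eq_div_iff_mult_less_eq mult.commute)
  then have q1: "1 \<le> c div k" by (rule order_trans[rotated]) simp
  have B: "(2::nat) \<le> 2 ^ (3 * (k * k))"
    using power_increasing[of 1 "3 * (k * k)" "2::nat"] kk by simp
  note dl = dlog_bounds[OF B q1, folded l_def]
  have l: "l \<ge> 1"
  proof (rule ccontr)
    assume "\<not> ?thesis"
    then have "l = 0" by simp
    with dl(2) q show False by simp
  qed
  have "((2::nat) ^ (3 * l)) ^ (k * k) = (2 ^ (3 * (k * k))) ^ l"
    unfolding power_mult[symmetric] by (rule arg_cong[where f = "(^) 2"]) (simp add: ac_simps)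
  then have "k * (2 ^ (3 * l)) ^ (k * k) \<le> k * (c div k)" using dl(1) by simp
  also have "\<dots> \<le> c" by simp
  finally have inst: "(F, k, c, l) \<in> insts"
    using F k by (auto simp: insts_def cnf3_def)
  have "n < k * (n div k + 1)" using k dividend_less_div_times[of k n] by (simp add: algebra_simps)
  also have "\<dots> \<le> k * c" using cK by (intro mult_left_mono) auto
  finally have n: "n + 1 \<le> k * c" by simp
  have "length F \<le> 3 * n + 1" by (rule length_le_three_occurrences[OF F occ])
  also have "\<dots> \<le> 3 * k * c" using n by (simp add: mult.assoc)
  finally have len: "length F \<le> 3 * k * c" .
  have "real (n div k) \<le> real n / real k" using of_nat_div_le_of_nat[of n k, where ?'a = real] by simp
  then have "real c \<le> real n / real k + real K + 1" by (simp add: cK)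
  with inst l n len show thesis
    by (intro that[of c l]) (auto simp: inst_of_def c_def l_def Let_def cK[unfolded c_def])
qed

lemma length_inst_matrix_ge:
  assumes "(F, k, c, l) \<in> insts"
  shows "2 \<le> length (inst_matrix (F, k, c, l))"
proof -
  have k: "k \<ge> 1" using assms by (simp add: insts_def)
  have "(2::nat) ^ 1 \<le> 2 ^ (9 * c + 3 * l)"
    by (rule power_increasing) (use inst_length_le[OF assms] in simp_all)
  moreover have "1 \<le> k ^ length (guesses k (3 * l))" using k by (rule one_le_power)
  ultimately have "2 * 1 \<le> 2 ^ (9 * c + 3 * l) * k ^ length (guesses k (3 * l))"
    by (intro mult_le_mono) simp_all
  also have "\<dots> = length (elems k c (3 * l))"
    by (simp only: elems_def length_product length_n_lists length_two length_upt diff_zero)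
  also have "\<dots> \<le> length (inst_matrix (F, k, c, l))"
    by (simp add: inst_matrix_def length_matrix)
  finally show ?thesis by simp
qed

text \<open>Up to constants depending on \<open>k\<close>, the weight is at most
  \<open>2 powr (n / k)\<close>. Construction and check take about \<open>weight ^ d\<close>, which
  \<open>d / k \<le> \<delta>\<close> keeps within the bound. \<open>A\<close> is run on at most
  that many vertices, and \<open>d * g k / k \<le> \<delta>\<close> does the same for its running
  time.\<close>

lemma three_sat_from_domset:
  fixes d :: nat and \<delta> :: real
  assumes red: "\<And>a. a \<in> insts \<Longrightarrow>
      runs c2 (enc_inst a) ((weight a + 2) ^ d) (Cn (enc_nat (fst (snd a))) (encL (encL enc_bool) (inst_matrix a)))"
      "\<And>a. a \<in> insts \<Longrightarrow> length (inst_matrix a) \<le> (weight a + 2) ^ d"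
    and chk: "\<And>a y. a \<in> insts \<Longrightarrow>
      runs c3 (Cn (enc_inst a) y) ((weight a + 2) ^ d) (enc_bool (check (inst_matrix a) (snd (snd (snd a))) y))"
    and d: "d \<ge> 1" and \<delta>: "\<delta> > 0" and k: "k \<ge> 2" "real d / real k \<le> \<delta>"
    and g: "0 \<le> g k" "real d * g k / real k \<le> \<delta>"
    and A: "approximates_domset A (\<lambda>k n. real (T k) * real n powr g k)
      (\<lambda>k n. log 2 (real n) powr (1 / (4 * (real k)\<^sup>2)))"
  shows "\<exists>P C. solves_3sat_on three_occurrences P (\<lambda>n. C * 2 powr (\<delta> * real n))"
proof -
  have k1: "k \<ge> 1" using k(1) by simp
  define K0 where "K0 = 2 ^ (12 * (k * k)) * (2 * k) ^ 4 * k ^ (12 * (k * k)) * (2 * d) ^ 3"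
  obtain K1 where K1: "\<And>c. c \<ge> K1 \<Longrightarrow> 100 * (k * c)\<^sup>2 + k + 2 ^ c + 2 \<le> (2::nat) ^ (2 * c)"
    using weight_eventually_le by blast
  \<comment> \<open>\<open>K0\<close> is the threshold of \<open>dlog_gap\<close> and
    \<open>K1\<close> that of \<open>weight_eventually_le\<close>; the other summands ensure
    \<open>l \<ge> 1\<close> and \<open>c \<ge> k\<close>.\<close>
  define K where "K = K0 + K1 + k * 2 ^ (3 * (k * k)) + k"
  have K: "K \<ge> K0" "K \<ge> K1" "K \<ge> k * 2 ^ (3 * (k * k))" "K \<ge> k" by (simp_all add: K_def)
  obtain c1 d1 where c1: "\<And>n F. runs c1 (enc_cnf n F) ((size (enc_cnf n F) + 2) ^ d1) (enc_inst (inst_of k (k * K) n F))"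
    using parameters_computable[OF k1] by metis
  obtain C1 where C1: "C1 \<ge> 0" "\<And>n::nat. (real n + 1) ^ (2 * d1) \<le> C1 * 2 powr (\<delta> * real n)"
    using polynomial_le_exponential[OF \<delta>] by metis
  have "1 / real k > 0" using k1 by simp
  from polynomial_le_exponential[OF this, of 2] obtain C2 where
    C2: "C2 \<ge> 0" "\<And>n::nat. (real n + 1)\<^sup>2 \<le> C2 * 2 powr (1 / real k * real n)" by metis
  \<comment> \<open>\<open>CW\<close> bounds the weight relative to \<open>2 powr (n / k)\<close>.
    The summands of \<open>C\<close> pay for \<open>c1\<close>, for \<open>c2\<close> and
    \<open>c3\<close>, for \<open>A\<close>, and for the overhead of the call.\<close>
  define CW where "CW = 100 * C2 + real k + 2 + 2 powr (real K + 1)"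
  define C where "C = 200 ^ d1 * C1 + 2 * CW ^ d + real (T k) * (CW ^ d) powr g k + (3 * real (com_bound A) + 50)"
  have CW: "CW \<ge> 0" unfolding CW_def using C2(1) by simp
  let ?P = "call_com c1 c2 A c3"
  have "\<exists>t. outputs ?P (enc_cnf n F) t (enc_bool (satisfiable F)) \<and> real t \<le> C * 2 powr (\<delta> * real n)"
    if F: "cnf3 n F" and occ: "three_occurrences F" for n F
  proof -
    obtain c l where a: "inst_of k (k * K) n F = (F, k, c, l)" and inst: "(F, k, c, l) \<in> insts"
      and l: "l \<ge> 1" and cK: "c \<ge> K" and len: "length F \<le> 3 * k * c" and n: "n + 1 \<le> k * c"
      and c_le: "real c \<le> real n / real k + real K + 1" and l_def: "l = dlog (2 ^ (3 * (k * k))) (c div k)"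
      using inst_of_facts[OF F occ k1 refl K(3)] by metis
    define M where "M = inst_matrix (F, k, c, l)"
    define W where "W = weight (F, k, c, l) + 2"
    define X where "X = 2 powr (\<delta> * real n)"
    define E where "E = 2 powr (1 / real k * real n)"
    have X1: "X \<ge> 1" unfolding X_def using \<delta> by (intro ge_one_powr_ge_zero) auto
    have E1: "E \<ge> 1" unfolding E_def by (intro ge_one_powr_ge_zero) auto
    have adj: "adjacency M" by (simp add: M_def inst_matrix_def adjacency_matrix)
    have M2: "length M \<ge> 2" unfolding M_def by (rule length_inst_matrix_ge[OF inst])
    have MW: "length M \<le> W ^ d" unfolding M_def W_def by (rule red(2)[OF inst])
    have W_le: "W \<le> 100 * (n + 1)\<^sup>2 + k + 2 ^ c + 2"
      using size_encF_le[OF F occ] by (simp add: W_def weight_def)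
    have "W \<le> 100 * (k * c)\<^sup>2 + k + 2 ^ c + 2"
      by (rule order_trans[OF W_le]) (intro add_right_mono mult_left_mono power_mono n, simp_all)
    also have "\<dots> \<le> 2 ^ (2 * c)" using K1 cK K(2) by (meson le_trans)
    finally have "W ^ d \<le> (2 ^ (2 * c)) ^ d" by (rule power_mono) simp
    then have "length M \<le> 2 ^ (2 * d * c)" using MW by (simp add: power_mult[symmetric] ac_simps)
    then have "real (length M) \<le> real (2 ^ (2 * d * c))" by (simp only: of_nat_le_iff)
    then have "real (length M) \<le> 2 powr real (2 * d * c)" by (simp add: powr_realpow[symmetric])
    moreover have pos: "0 < real (length M)" using M2 by linarith
    ultimately have log_le: "log 2 (real (length M)) \<le> real (2 * d * c)"
      using pos by (subst log_le_iff) simp_all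
    have "1 \<le> real (length M)" using M2 by linarith
    with pos have log_ge: "0 \<le> log 2 (real (length M))" by (subst zero_le_log_cancel_iff) (rule one_less_numeral_iff[THEN iffD2], simp, assumption+)
    have gap: "k ^ (4 * (k * k)) * (2 * d * c) \<le> 2 ^ (4 * (k * k) * l)"
      unfolding l_def by (rule dlog_gap[OF k1]) (use cK K(1,4) in \<open>simp_all add: K0_def\<close>)
    have \<rho>: "log 2 (real (length M)) powr (1 / (4 * (real k)\<^sup>2)) * real k \<le> 2 ^ l"
      by (rule root_gap[OF k1 log_ge log_le gap])
    from A k1 M2 graph_graph_of[OF adj] obtain t y where
      ty: "outputs A (Cn (enc_nat k) (enc_graph (length M) (graph_of M))) t y"
        "real t \<le> real (T k) * real (length M) powr g k"
        "domination_number (length M) (graph_of M) \<le> k \<Longrightarrow>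
         \<exists>D. dominating_set (length M) (graph_of M) D \<and>
           real (card D) \<le> log 2 (real (length M)) powr (1 / (4 * (real k)\<^sup>2)) * real k \<and> y = enc_set (length M) D"
      unfolding approximates_domset_def by blast
    have sat: "check M l y \<longleftrightarrow> satisfiable F"
      unfolding M_def by (rule satisfiable_iff_check[OF inst k(1) l len ty(3)[unfolded M_def] \<rho>[unfolded M_def]])
    have r1: "runs c1 (enc_cnf n F) ((size (enc_cnf n F) + 2) ^ d1) (enc_inst (F, k, c, l))"
      using c1[of n F] unfolding a .
    have r2: "runs c2 (enc_inst (F, k, c, l)) (W ^ d) (Cn (enc_nat k) (enc_graph (length M) (graph_of M)))"
      using red(1)[OF inst] unfolding enc_graph_graph_of[OF adj] by (simp add: W_def M_def)
    have r3: "runs c3 (Cn (enc_inst (F, k, c, l)) y) (W ^ d) (enc_bool (satisfiable F))"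
      using chk[OF inst, of y] sat by (simp add: W_def M_def)
    from outputs_call[OF r1 r2 ty(1) r3] obtain t' where
      t': "outputs ?P (enc_cnf n F) t' (enc_bool (satisfiable F))"
        "t' \<le> (size (enc_cnf n F) + 2) ^ d1 + W ^ d + t + W ^ d + (3 * com_bound A + 50)" by blast
    have sq: "n + 1 \<le> (n + 1)\<^sup>2" by (simp add: power2_eq_square)
    have "size (enc_cnf n F) + 2 \<le> 200 * (n + 1)\<^sup>2"
      using size_encF_le[OF F occ] sq by (simp add: enc_cnf_encF)
    then have "(size (enc_cnf n F) + 2) ^ d1 \<le> (200 * (n + 1)\<^sup>2) ^ d1" by (rule power_mono) simp
    then have "real ((size (enc_cnf n F) + 2) ^ d1) \<le> real ((200 * (n + 1)\<^sup>2) ^ d1)" by (simp only: of_nat_le_iff)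
    also have "\<dots> = 200 ^ d1 * (real n + 1) ^ (2 * d1)" by (simp add: power_mult_distrib power_mult add.commute)
    also have "\<dots> \<le> 200 ^ d1 * (C1 * X)" unfolding X_def by (intro mult_left_mono C1(2)) simp
    finally have b1: "real ((size (enc_cnf n F) + 2) ^ d1) \<le> 200 ^ d1 * C1 * X" by simp
    have "(2::real) ^ c = 2 powr real c" by (simp add: powr_realpow)
    also have "\<dots> \<le> 2 powr (real n / real k + real K + 1)" using c_le by (rule powr_mono) simp
    also have "\<dots> = 2 powr (real K + 1) * E" by (simp add: E_def powr_add[symmetric] ac_simps)
    finally have pc: "(2::real) ^ c \<le> 2 powr (real K + 1) * E" .
    have "real W \<le> real (100 * (n + 1)\<^sup>2 + k + 2 ^ c + 2)" using W_le by (simp only: of_nat_le_iff)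
    also have "\<dots> = 100 * (real n + 1)\<^sup>2 + (real k + 2) * 1 + 2 ^ c" by (simp add: add.commute)
    also have "\<dots> \<le> 100 * (C2 * E) + (real k + 2) * E + 2 powr (real K + 1) * E"
      using C2(2)[of n] E1 pc unfolding E_def[symmetric] by (intro add_mono mult_left_mono) auto
    also have "\<dots> = CW * E" by (simp add: CW_def algebra_simps)
    finally have WE: "real W \<le> CW * E" .
    have "real (W ^ d) = real W ^ d" by simp
    also have "\<dots> \<le> (CW * E) ^ d" using WE by (rule power_mono) simp
    finally have Wd: "real (W ^ d) \<le> CW ^ d * E ^ d" by (simp add: power_mult_distrib)
    have Ed: "E ^ d = 2 powr (real d / real k * real n)"
      by (simp add: E_def powr_realpow[symmetric] powr_powr ac_simps)
    have "E ^ d \<le> X" unfolding Ed X_def using k(2) by (intro powr_mono mult_right_mono) auto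
    then have b2: "real (W ^ d) \<le> CW ^ d * X"
      using Wd mult_left_mono[of "E ^ d" X "CW ^ d"] CW by fastforce
    have "real (length M) \<le> CW ^ d * E ^ d" using MW Wd by (meson of_nat_le_iff order_trans)
    then have "real (length M) powr g k \<le> (CW ^ d * E ^ d) powr g k"
      by (intro powr_mono2 g(1)) simp_all
    also have "\<dots> = (CW ^ d) powr g k * (E ^ d) powr g k"
      by (rule powr_mult)
    also have "(E ^ d) powr g k = 2 powr (real d * g k / real k * real n)"
      unfolding Ed powr_powr by (simp add: ac_simps)
    also have "\<dots> \<le> X" unfolding X_def using g(2) by (intro powr_mono mult_right_mono) auto
    finally have "real (length M) powr g k \<le> (CW ^ d) powr g k * X" by (simp add: mult_left_mono)
    then have "real (T k) * real (length M) powr g k \<le> real (T k) * ((CW ^ d) powr g k * X)"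
      by (rule mult_left_mono) simp
    with ty(2) have b3: "real t \<le> real (T k) * (CW ^ d) powr g k * X" by simp
    have b4: "3 * real (com_bound A) + 50 \<le> (3 * real (com_bound A) + 50) * X"
      using mult_left_mono[OF X1, of "3 * real (com_bound A) + 50"] by simp
    have "real t' \<le> real ((size (enc_cnf n F) + 2) ^ d1 + W ^ d + t + W ^ d + (3 * com_bound A + 50))"
      using t'(2) by (simp only: of_nat_le_iff)
    also have "\<dots> = real ((size (enc_cnf n F) + 2) ^ d1) + real (W ^ d) + real t + real (W ^ d) +
        (3 * real (com_bound A) + 50)"
      by (simp only: of_nat_add of_nat_mult of_nat_numeral)
    also have "\<dots> \<le> 200 ^ d1 * C1 * X + CW ^ d * X + real (T k) * (CW ^ d) powr g k * X + CW ^ d * X +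
        (3 * real (com_bound A) + 50) * X"
      by (intro add_mono b1 b2 b3 b4)
    also have "\<dots> = C * X" by (simp add: C_def algebra_simps)
    finally show ?thesis using t'(1) unfolding X_def by blast
  qed
  then show ?thesis unfolding solves_3sat_on_def by blast
qed

theorem theorem1p4:
  assumes ETH
  shows "\<exists>p :: real poly. (\<forall>k::nat. k \<ge> 1 \<longrightarrow> poly p (real k) \<ge> 1) \<and>
    (\<forall>(T :: nat \<Rightarrow> nat) (g :: nat \<Rightarrow> real).
       computable T \<longrightarrow> (\<forall>k. g k \<ge> 0) \<longrightarrow> g \<in> o(\<lambda>k. real k) \<longrightarrow>
       \<not> (\<exists>A. approximates_domset A
              (\<lambda>k n. real (T k) * real n powr g k)
              (\<lambda>k n. log 2 (real n) powr (1 / poly p (real k)))))"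
proof -
  from assms obtain \<delta> where \<delta>: "\<delta> > 0" and hard: "\<not> (\<exists>A f. f \<in> O(\<lambda>n. 2 powr (\<delta> * real n)) \<and>
      solves_3sat_on three_occurrences A f)"
    unfolding ETH_def by blast
  obtain c2 d2 where c2: "\<And>a. a \<in> insts \<Longrightarrow>
      runs c2 (enc_inst a) ((weight a + 2) ^ d2) (Cn (enc_nat (fst (snd a))) (encL (encL enc_bool) (inst_matrix a)))"
      "\<And>a. a \<in> insts \<Longrightarrow> length (inst_matrix a) \<le> (weight a + 2) ^ d2"
    using uniform_reduction by metis
  obtain c3 d3 where c3: "\<And>a y. a \<in> insts \<Longrightarrow>
      runs c3 (Cn (enc_inst a) y) ((weight a + 2) ^ d3) (enc_bool (check (inst_matrix a) (snd (snd (snd a))) y))"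
    using uniform_check by metis
  define d where "d = d2 + d3 + 1"
  have le: "(weight a + 2) ^ d2 \<le> (weight a + 2) ^ d" "(weight a + 2) ^ d3 \<le> (weight a + 2) ^ d" for a
    unfolding d_def by (rule power_increasing; simp)+
  note c2' = runs_mono[OF c2(1) le(1)] order_trans[OF c2(2) le(1)] and c3' = runs_mono[OF c3 le(2)]
  \<comment> \<open>The factor 4 leaves a margin over the exponent \<open>3 * k\<^sup>2\<close> in
    the size of the gadget; this margin absorbs all constants once \<open>c\<close> is
    large.\<close>
  define p :: "real poly" where "p = monom 4 2"
  have p: "poly p (real k) = 4 * (real k)\<^sup>2" for k by (simp add: p_def poly_monom)
  have "poly p (real k) \<ge> 1" if "k \<ge> 1" for k :: nat
  proof -
    have "1\<^sup>2 \<le> (real k)\<^sup>2" using that by (intro power_mono) auto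
    then show ?thesis by (simp add: p)
  qed
  moreover have False
    if g0: "\<forall>k. g k \<ge> 0" and g: "g \<in> o(\<lambda>k. real k)" and A: "approximates_domset A
              (\<lambda>k n. real (T k) * real n powr g k)
              (\<lambda>k n. log 2 (real n) powr (1 / poly p (real k)))"
    for T :: "nat \<Rightarrow> nat" and g :: "nat \<Rightarrow> real" and A
  proof -
    have d0: "d \<ge> 1" by (simp add: d_def)
    have "eventually (\<lambda>k. norm (g k) \<le> \<delta> / real d * norm (real k)) at_top"
      using \<delta> d0 by (intro landau_o.smallD[OF g]) simp
    moreover have "eventually (\<lambda>k. k \<ge> max 2 (nat \<lceil>real d / \<delta>\<rceil>)) at_top"
      by (rule eventually_ge_at_top)
    ultimately have "eventually (\<lambda>k. norm (g k) \<le> \<delta> / real d * norm (real k) \<and>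
        k \<ge> max 2 (nat \<lceil>real d / \<delta>\<rceil>)) at_top" by (rule eventually_conj)
    then obtain k where k: "norm (g k) \<le> \<delta> / real d * norm (real k)" "k \<ge> max 2 (nat \<lceil>real d / \<delta>\<rceil>)"
      using eventually_happens'[OF sequentially_bot] by blast
    have k2: "k \<ge> 2" using k(2) by simp
    have "real d / \<delta> \<le> real k" using k(2) real_nat_ceiling_ge[of "real d / \<delta>"] by linarith
    then have dk: "real d / real k \<le> \<delta>" using \<delta> k2 by (simp add: field_simps)
    have gk: "real d * g k / real k \<le> \<delta>" using k(1) k2 d0 g0 by (simp add: field_simps)
    have "\<exists>P C. solves_3sat_on three_occurrences P (\<lambda>n. C * 2 powr (\<delta> * real n))"
      by (rule three_sat_from_domset[where g = g and k = k and T = T and d = d])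
         (rule c2' c3' d0 \<delta> k2 dk gk A[unfolded p] g0[rule_format] | assumption)+
    then obtain P C where P: "solves_3sat_on three_occurrences P (\<lambda>n. C * 2 powr (\<delta> * real n))" by blast
    have "(\<lambda>n. C * 2 powr (\<delta> * real n)) \<in> O(\<lambda>n. 2 powr (\<delta> * real n))" by simp
    with P hard show False by blast
  qed
  ultimately show ?thesis by blast
qed

end
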